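(* Let $\varphi:T\times\mathbb{R}^n\to\overline{\mathbb{R}}$ be a proper normal integrand on a complete finite measure space $(T,\mathcal{A},\mu)$, let $\bar x\in\operatorname{dom}E_\varphi$, $\bar y\in\partial E_\varphi(\bar x)$, and $\bar{\mathsf y}\in\mathcal{S}_\varphi(\bar x,\bar y)$. Suppose that there exist $\rho>0$ and $\kappa\in L^1(T,\mathbb{R}_+)$ such that: (a) $\partial E_\varphi(x)=\int_T\partial\varphi_t(x)\,d\mu$ for all $x\in\mathbb{B}_\rho(\bar x)$; (b) $\varphi_t$ is lower regular at every $x\in\mathbb{B}_\rho(\bar x)$ for all $t\in T_{na}$; (c) $\partial\varphi_t(x)\subset\kappa(t)\mathbb{B}$ for all $x\in\mathbb{B}_\rho(\bar x)$ and a.e. $t\in T$. Suppose also that $\varphi$ enjoys the second-order integrable quasi-Lipschitzian property around $(\bar x,\bar{\mathsf y})$. Then for every $y^*\in\mathbb{R}^n$ $$\breve\partial^2E_\varphi(\bar x,\bar y)(y^* )\subset\int_T\partial^2\varphi_t(\bar x,\bar{\mathsf y}(t))(y^* )\,d\mu.$$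
   Context: $\overline{\mathbb{R}}=[-\infty,\infty]$, $\mathbb{R}_+:=\{\alpha\in\mathbb{R}:\alpha>0\}$; $L^p(T,\cdot)$ are the usual Lebesgue spaces; vectors are identified with constant functions; $\mathbb{B}_r(\cdot)$ is the closed ball, $\mathbb{B}$ the closed unit ball. $T=T_{pa}\cup T_{na}$ is the disjoint measurable decomposition of $T$ such that $\mu(\cdot\cap T_{pa})$ is purely atomic and $\mu(\cdot\cap T_{na})$ is nonatomic. $\varphi_t:=\varphi(t,\cdot)$; $\varphi$ is a normal integrand if it is $\mathcal{A}\otimes\mathcal{B}(\mathbb{R}^n)$-measurable with $\varphi_t$ lower semicontinuous for every $t$; it is proper if each $\varphi_t$ is proper. $E_\varphi(x):=\int_T\varphi_t(x)d\mu$ (with the convention $\infty-\infty=\infty$). The (Aumann) integral of $A:T\rightrightarrows\mathbb{R}^d$ is $\int_TA(t)d\mu=\{\int_T\mathsf{v}\,d\mu:\mathsf{v}\in L^1(T,\mathbb{R}^d),\ \mathsf{v}(t)\in A(t)\text{ a.e.}\}$. $\mathcal{S}_\varphi(x,y):=\{\mathsf{y}\in L^1(T,\mathbb{R}^n):\int_T\mathsf{y}\,d\mu=y,\ \mathsf{y}(t)\in\partial\varphi_t(x)\text{ for a.e. }t\in T\}$. Regular normal cone: $\hat N(\bar z;\Omega)=\{z^*:\limsup_{z\to\bar z,z\in\Omega}\langle z^*,z-\bar z\rangle/\|z-\bar z\|\le0\}$ for $\bar z\in\Omega$, $\emptyset$ otherwise. Limiting normal cone: $N(\bar z;\Omega)=\{z^*:\exists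 z_k\to\bar z,\ z_k^*\to z^*,\ z_k^*\in\hat N(z_k;\Omega)\}$. For $\psi:\mathbb{R}^n\to\overline{\mathbb{R}}$ finite at $x$: $\hat\partial\psi(x)=\{x^*:(x^*,-1)\in\hat N((x,\psi(x));\operatorname{epi}\psi)\}$, $\partial\psi(x)=\{x^*:(x^*,-1)\in N((x,\psi(x));\operatorname{epi}\psi)\}$ (both empty if $\psi(x)$ is not finite); $\psi$ is lower regular at $x$ if $\psi(x)$ is finite and $\hat\partial\psi(x)=\partial\psi(x)$. Coderivatives at $(x,y)\in\operatorname{gph}G$: $\hat D^*G(x,y)(y^* )=\{x^*:(x^*,-y^* )\in\hat N((x,y);\operatorname{gph}G)\}$, $D^*G(x,y)(y^* )=\{x^*:(x^*,-y^* )\in N((x,y);\operatorname{gph}G)\}$. For $x^*\in\partial\psi(x)$: basic second-order subdifferential $\partial^2\psi(x,x^* )(v^* ):=(D^*\partial\psi)(x,x^* )(v^* )$; combined second-order subdifferential $\breve\partial^2\psi(x,x^* )(v^* ):=(\hat D^*\partial\psi)(x,x^* )(v^* )$. $\varphi$ enjoys the second-order integrable quasi-Lipschitzian property around $(\bar x,\bar{\mathsf y})$ if there exist $\eta>0$ and $\ell\in L^1(T,\mathbb{R}_+)$ such that $\sup\{\|x^*\|:x^*\in\partial^2\varphi_t(\mathsf{x}(t),\mathsf{y}(t))(\mathsf{y}^*(t))\}\le\ell(t)\|\mathsf{y}^*(t)\|$ for a.e. $t\in T$ whenever $\mathsf{x}\in L^\infty(T,\mathbb{R}^n)$ with $\|\mathsf{x}-\bar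 x\|_\infty\le\eta$, $\mathsf{y}\in L^1(T,\mathbb{R}^n)$ with $\|\mathsf{y}-\bar{\mathsf y}\|_1\le\eta$ and $\mathsf{y}(t)\in\partial\varphi_t(\mathsf{x}(t))$ a.e., and $\mathsf{y}^*\in L^\infty(T,\mathbb{R}^n)$ (the inequality being regarded as satisfied when the set is empty). *)

theory Defs
  imports "HOL-Analysis.Analysis" "HOL-Probability.Essential_Supremum"
begin

section \<open>Generalized differentiation\<close>

text \<open>If \<open>z\<close> is isolated in \<open>\<Omega>\<close>, the filter \<open>at z within \<Omega>\<close> is \<open>bot\<close>, the upper limit is
  \<open>-\<infinity>\<close>, and every vector is a regular normal, as it should be.\<close>

definition regular_normal_cone :: "'a::euclidean_space \<Rightarrow> 'a set \<Rightarrow> 'a set" where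
  "regular_normal_cone z \<Omega> =
     (if z \<in> \<Omega>
      then {w. Limsup (at z within \<Omega>) (\<lambda>u. ereal (w \<bullet> (u - z) / norm (u - z))) \<le> 0}
      else {})"

definition limiting_normal_cone :: "'a::euclidean_space \<Rightarrow> 'a set \<Rightarrow> 'a set" where
  "limiting_normal_cone z \<Omega> =
     {w. \<exists>u v. u \<longlonglongrightarrow> z \<and> v \<longlonglongrightarrow> w \<and> (\<forall>k::nat. v k \<in> regular_normal_cone (u k) \<Omega>)}"

definition epi :: "('a \<Rightarrow> ereal) \<Rightarrow> ('a \<times> real) set" where
  "epi \<psi> = {(x, \<alpha>). \<psi> x \<le> ereal \<alpha>}"

definition edom :: "('a \<Rightarrow> ereal) \<Rightarrow> 'a set" where
  "edom \<psi> = {x. \<psi> x < \<infinity>}"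

definition regular_subdiff :: "('a::euclidean_space \<Rightarrow> ereal) \<Rightarrow> 'a \<Rightarrow> 'a set" where
  "regular_subdiff \<psi> x =
     (if \<bar>\<psi> x\<bar> \<noteq> \<infinity>
      then {w. (w, -1) \<in> regular_normal_cone (x, real_of_ereal (\<psi> x)) (epi \<psi>)}
      else {})"

definition subdiff :: "('a::euclidean_space \<Rightarrow> ereal) \<Rightarrow> 'a \<Rightarrow> 'a set" where
  "subdiff \<psi> x =
     (if \<bar>\<psi> x\<bar> \<noteq> \<infinity>
      then {w. (w, -1) \<in> limiting_normal_cone (x, real_of_ereal (\<psi> x)) (epi \<psi>)}
      else {})"

definition lower_regular_at :: "('a::euclidean_space \<Rightarrow> ereal) \<Rightarrow> 'a \<Rightarrow> bool" where
  "lower_regular_at \<psi> x \<longleftrightarrow> \<bar>\<psi> x\<bar> \<noteq> \<infinity> \<and> regular_subdiff \<psi> x = subdiff \<psi> x"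

definition gph :: "('a \<Rightarrow> 'b set) \<Rightarrow> ('a \<times> 'b) set" where
  "gph G = {(x, y). y \<in> G x}"

definition regular_coderivative ::
  "('a::euclidean_space \<Rightarrow> 'b::euclidean_space set) \<Rightarrow> 'a \<Rightarrow> 'b \<Rightarrow> 'b \<Rightarrow> 'a set" where
  "regular_coderivative G x y w = {v. (v, - w) \<in> regular_normal_cone (x, y) (gph G)}"

definition coderivative ::
  "('a::euclidean_space \<Rightarrow> 'b::euclidean_space set) \<Rightarrow> 'a \<Rightarrow> 'b \<Rightarrow> 'b \<Rightarrow> 'a set" where
  "coderivative G x y w = {v. (v, - w) \<in> limiting_normal_cone (x, y) (gph G)}"

definition combined_second_subdiff ::
  "('a::euclidean_space \<Rightarrow> ereal) \<Rightarrow> 'a \<Rightarrow> 'a \<Rightarrow> 'a \<Rightarrow> 'a set" where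
  "combined_second_subdiff \<psi> x y w = regular_coderivative (subdiff \<psi>) x y w"

definition basic_second_subdiff ::
  "('a::euclidean_space \<Rightarrow> ereal) \<Rightarrow> 'a \<Rightarrow> 'a \<Rightarrow> 'a \<Rightarrow> 'a set" where
  "basic_second_subdiff \<psi> x y w = coderivative (subdiff \<psi>) x y w"

section \<open>Atoms\<close>

definition measure_atom :: "'t measure \<Rightarrow> 't set \<Rightarrow> bool" where
  "measure_atom N A \<longleftrightarrow> A \<in> sets N \<and> emeasure N A > 0 \<and>
     (\<forall>B\<in>sets N. B \<subseteq> A \<longrightarrow> emeasure N B = 0 \<or> emeasure N B = emeasure N A)"

definition purely_atomic :: "'t measure \<Rightarrow> bool" where
  "purely_atomic N \<longleftrightarrow>
     (\<forall>A\<in>sets N. emeasure N A > 0 \<longrightarrow> (\<exists>B. B \<subseteq> A \<and> measure_atom N B))"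

definition nonatomic :: "'t measure \<Rightarrow> bool" where
  "nonatomic N \<longleftrightarrow> (\<nexists>A. measure_atom N A)"

text \<open>\<open>density M (indicator S)\<close> is the measure \<open>A \<mapsto> \<mu>(A \<inter> S)\<close> on the \<open>\<sigma>\<close>-algebra of \<open>M\<close>.\<close>

definition atomic_decomposition :: "'t measure \<Rightarrow> 't set \<Rightarrow> 't set \<Rightarrow> bool" where
  "atomic_decomposition M Tpa Tna \<longleftrightarrow>
     Tpa \<in> sets M \<and> Tna \<in> sets M \<and> Tpa \<inter> Tna = {} \<and> Tpa \<union> Tna = space M \<and>
     purely_atomic (density M (indicator Tpa)) \<and> nonatomic (density M (indicator Tna))"

section \<open>Integrands and integral functionals\<close>

definition lsc :: "('a::topological_space \<Rightarrow> ereal) \<Rightarrow> bool" where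
  "lsc \<psi> \<longleftrightarrow> (\<forall>x. \<psi> x \<le> Liminf (at x) \<psi>)"

definition proper :: "('a \<Rightarrow> ereal) \<Rightarrow> bool" where
  "proper \<psi> \<longleftrightarrow> (\<forall>x. \<psi> x \<noteq> -\<infinity>) \<and> edom \<psi> \<noteq> {}"

definition normal_integrand :: "'t measure \<Rightarrow> ('t \<Rightarrow> 'a::euclidean_space \<Rightarrow> ereal) \<Rightarrow> bool" where
  "normal_integrand M \<phi> \<longleftrightarrow>
     (\<lambda>(t, x). \<phi> t x) \<in> borel_measurable (M \<Otimes>\<^sub>M borel) \<and> (\<forall>t\<in>space M. lsc (\<phi> t))"

definition proper_normal_integrand ::
  "'t measure \<Rightarrow> ('t \<Rightarrow> 'a::euclidean_space \<Rightarrow> ereal) \<Rightarrow> bool" where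
  "proper_normal_integrand M \<phi> \<longleftrightarrow> normal_integrand M \<phi> \<and> (\<forall>t\<in>space M. proper (\<phi> t))"

text \<open>Integral of the positive part minus integral of the negative part. On \<^typ>\<open>ereal\<close> one has
  \<open>\<infinity> - \<infinity> = \<infinity>\<close>, which is the intended convention. The map \<^const>\<open>e2ennreal\<close> sends
  negative arguments to \<open>0\<close>.\<close>

definition ext_integral :: "'t measure \<Rightarrow> ('t \<Rightarrow> ereal) \<Rightarrow> ereal" where
  "ext_integral M f =
     enn2ereal (\<integral>\<^sup>+ t. e2ennreal (f t) \<partial>M) - enn2ereal (\<integral>\<^sup>+ t. e2ennreal (- f t) \<partial>M)"

definition expected_functional :: "'t measure \<Rightarrow> ('t \<Rightarrow> 'a \<Rightarrow> ereal) \<Rightarrow> 'a \<Rightarrow> ereal" where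
  "expected_functional M \<phi> x = ext_integral M (\<lambda>t. \<phi> t x)"

definition aumann_integral :: "'t measure \<Rightarrow> ('t \<Rightarrow> 'a::euclidean_space set) \<Rightarrow> 'a set" where
  "aumann_integral M A =
     {integral\<^sup>L M v | v. integrable M v \<and> (AE t in M. v t \<in> A t)}"

definition subgradient_selections ::
  "'t measure \<Rightarrow> ('t \<Rightarrow> 'a::euclidean_space \<Rightarrow> ereal) \<Rightarrow> 'a \<Rightarrow> 'a \<Rightarrow> ('t \<Rightarrow> 'a) set" where
  "subgradient_selections M \<phi> x y =
     {ys. integrable M ys \<and> integral\<^sup>L M ys = y \<and> (AE t in M. ys t \<in> subdiff (\<phi> t) x)}"

definition Linf_norm :: "'t measure \<Rightarrow> ('t \<Rightarrow> 'a::euclidean_space) \<Rightarrow> ennreal" where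
  "Linf_norm M f = esssup M (\<lambda>t. ennreal (norm (f t)))"

definition Linf :: "'t measure \<Rightarrow> ('t \<Rightarrow> 'a::euclidean_space) set" where
  "Linf M = {f \<in> borel_measurable M. Linf_norm M f < \<infinity>}"

definition L1_norm :: "'t measure \<Rightarrow> ('t \<Rightarrow> 'a::euclidean_space) \<Rightarrow> real" where
  "L1_norm M f = (\<integral>t. norm (f t) \<partial>M)"

text \<open>The supremum is taken in \<^typ>\<open>ereal\<close>: over an empty set it is \<open>-\<infinity>\<close>, so that the
  inequality then holds. The exceptional null set may depend on the functions \<open>xs, ys, ws\<close>.\<close>

definition second_order_quasi_Lipschitz ::
  "'t measure \<Rightarrow> ('t \<Rightarrow> 'a::euclidean_space \<Rightarrow> ereal) \<Rightarrow> 'a \<Rightarrow> ('t \<Rightarrow> 'a) \<Rightarrow> bool" where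
  "second_order_quasi_Lipschitz M \<phi> xbar ybar \<longleftrightarrow>
     (\<exists>\<eta>>0. \<exists>l. integrable M l \<and> (AE t in M. 0 < l t) \<and>
        (\<forall>xs ys ws.
           xs \<in> Linf M \<and> Linf_norm M (\<lambda>t. xs t - xbar) \<le> ennreal \<eta> \<and>
           integrable M ys \<and> L1_norm M (\<lambda>t. ys t - ybar t) \<le> \<eta> \<and>
           (AE t in M. ys t \<in> subdiff (\<phi> t) (xs t)) \<and>
           ws \<in> Linf M
           \<longrightarrow>
           (AE t in M.
              (SUP v\<in>basic_second_subdiff (\<phi> t) (xs t) (ys t) (ws t). ereal (norm v))
                \<le> ereal (l t * norm (ws t)))))"

end

theory Submission
  imports Defs "HOL-Library.Diagonal_Subsequence"
begin

text \<open>
  Let \<open>(v, -w)\<close> be a regular normal to the graph of the subdifferential of the integral functional. Give every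
  \<open>t\<close> its own point \<open>X t\<close> in place of the common \<open>x\<close>, and minimise, over \<open>x\<close> near \<open>xbar\<close> and over measurable
  selections \<open>(X, ys)\<close> of the graphs of the subdifferentials, the integral of
  \<open>w \<bullet> (ys - ysbar) + k |X - x|\<^sup>2\<close> plus a small smooth penalty in \<open>ys - ysbar\<close>, minus \<open>v \<bullet> (x - xbar)\<close>. For
  fixed \<open>x\<close> the problem decouples, so it is solved pointwise and no variational principle in a function space is
  needed. Optimality in \<open>(X t, ys t)\<close> makes \<open>2k (x - X t)\<close> an element of a pointwise coderivative, and optimality
  in \<open>x\<close> makes the integral of these vectors close to \<open>v\<close>. The quasi-Lipschitzian property dominates them, and an exact
  Fatou lemma for vector-valued functions (atoms by a diagonal subsequence, the nonatomic part by Lyapunov's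
  theorem) produces the required selection of the limiting coderivatives. The same Fatou lemma shows that the
  minimisers converge to \<open>(xbar, xbar, ysbar)\<close> as \<open>k\<close> grows.
\<close>

text \<open>The obstacle is that a regular normal to the graph of the integral functional controls
  only the mean of a selection, whereas pointwise normals at the right base points need the
  selection to be small in the L1 norm. Weak compactness in L1 does not bridge this gap, since the
  penalty is not linear in the selection. The Fatou lemma is therefore applied to the pair of a
  selection and a nonlinear function of it: in the limit both integrals belong to one actual
  selection. A limit of L1 norms is then again an L1 norm, and once it vanishes the convergence is
  strong. The point \<open>X t\<close> is freed because a coderivative at \<open>t\<close> tests the
  graph in both coordinates, while the graph of the integral functional offers only selections at a
  common \<open>x\<close>. The multipliers \<open>2k (x - X t)\<close> carry the growing factor
  \<open>k\<close>, so optimality alone does not bound them; the quasi-Lipschitzian property that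
  does is stated for bounded directions, which is why the penalty has a bounded slope although it
  must beat \<open>w \<bullet> (ys - ysbar)\<close> far out. Two limits are taken, in this order:
  \<open>k\<close> grows for a fixed tolerance \<open>e\<close>, then \<open>e\<close> tends to
  zero.\<close>

section \<open>Lyapunov's convexity theorem\<close>

text \<open>Exhaustion: every step of a chain in \<open>D\<close> gains at least half of what a
  larger member could still add, so no measure is left to gain above its union. Maximality is meant
  in measure, not in inclusion.\<close>

lemma (in finite_measure) exists_maximal_set:
  fixes D :: "'a set set"
  assumes D: "D \<subseteq> sets M" "D \<noteq> {}"
    and U: "\<And>A::nat \<Rightarrow> 'a set. incseq A \<Longrightarrow> range A \<subseteq> D \<Longrightarrow> (\<Union>n. A n) \<in> D"
  shows "\<exists>C\<in>D. \<forall>E\<in>D. C \<subseteq> E \<longrightarrow> measure M E = measure M C"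
proof -
  define s where "s C = (SUP E\<in>{E\<in>D. C \<subseteq> E}. measure M E)" for C
  have bdd: "bdd_above (measure M ` X)" for X
    by (rule bdd_aboveI2[of _ _ "measure M (space M)"]) (rule bounded_measure)
  have le: "measure M E \<le> s C" if "E \<in> D" "C \<subseteq> E" for C E
    unfolding s_def using that by (intro cSUP_upper bdd) auto
  have step: "\<exists>E. E \<in> D \<and> C \<subseteq> E \<and> (measure M C + s C) / 2 \<le> measure M E" if C: "C \<in> D" for C
  proof (cases "s C = measure M C")
    case True
    then show ?thesis using C by auto
  next
    case False
    then have "(measure M C + s C) / 2 < s C" using le[OF C order_refl] by simp
    then have "\<exists>E\<in>{E\<in>D. C \<subseteq> E}. (measure M C + s C) / 2 < measure M E"
      unfolding s_def using C by (subst (asm) less_cSUP_iff) (auto intro: bdd)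
    then show ?thesis by (auto intro: less_imp_le)
  qed
  obtain A0 where A0: "A0 \<in> D" using D by auto
  obtain A where A: "\<And>n::nat. A n \<in> D" "\<And>n. A n \<subseteq> A (Suc n) \<and> (measure M (A n) + s (A n)) / 2 \<le> measure M (A (Suc n))"
    using dependent_nat_choice[of "\<lambda>_ X. X \<in> D" "\<lambda>_ X Y. X \<subseteq> Y \<and> (measure M X + s X) / 2 \<le> measure M Y"] A0 step
    by metis
  have inc: "incseq A" using A(2) by (intro incseq_SucI) auto
  have conv: "(\<lambda>n. measure M (A n)) \<longlonglongrightarrow> measure M (\<Union>n. A n)"
    using A(1) D inc by (intro finite_Lim_measure_incseq) auto
  have C: "(\<Union>n. A n) \<in> D" using U[OF inc] A(1) by auto
  have "measure M E = measure M (\<Union>n. A n)" if E: "E \<in> D" "(\<Union>n. A n) \<subseteq> E" for E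
  proof (rule antisym)
    show "measure M (\<Union>n. A n) \<le> measure M E" using E C D by (intro finite_measure_mono) auto
    \<comment> \<open>\<open>E\<close> contains every \<open>A n\<close>, so its measure is at most
      \<open>s (A n)\<close>; the choice of \<open>A (Suc n)\<close> turns this into a bound whose
      limit is the measure of the union.\<close>
    have "measure M E \<le> 2 * measure M (A (Suc n)) - measure M (A n)" for n
      using le[of E "A n"] E A(2)[of n] by (force simp: field_simps)
    moreover have "(\<lambda>n. 2 * measure M (A (Suc n)) - measure M (A n))
        \<longlonglongrightarrow> 2 * measure M (\<Union>n. A n) - measure M (\<Union>n. A n)"
      by (intro tendsto_intros conv LIMSEQ_Suc[OF conv])
    ultimately show "measure M E \<le> measure M (\<Union>n. A n)"
      by (intro LIMSEQ_le_const) auto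
  qed
  then show ?thesis using C by blast
qed

text \<open>A set of positive measure that is not an atom splits into two parts of positive measure,
  one of which has at most half the measure; this is iterated.\<close>

lemma nonatomic_small_subset:
  assumes "finite_measure N" and na: "nonatomic N" and B: "B \<in> sets N" "measure N B > 0"
  shows "\<exists>C\<in>sets N. C \<subseteq> B \<and> 0 < measure N C \<and> measure N C \<le> measure N B / 2 ^ n"
proof (induction n)
  case 0
  then show ?case using B by auto
next
  case (Suc n)
  interpret finite_measure N by fact
  obtain C where C: "C \<in> sets N" "C \<subseteq> B" "0 < measure N C" "measure N C \<le> measure N B / 2 ^ n"
    using Suc by auto
  have "\<not> measure_atom N C" using na by (simp add: nonatomic_def)
  then obtain E where E: "E \<in> sets N" "E \<subseteq> C" "measure N E \<noteq> 0" "measure N E \<noteq> measure N C"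
    using C by (auto simp: measure_atom_def emeasure_eq_measure)
  have d: "measure N (C - E) = measure N C - measure N E"
    using C E by (intro finite_measure_Diff) auto
  have m: "measure N E \<le> measure N C" using C E by (intro finite_measure_mono) auto
  have "0 < measure N E" using E(3) measure_nonneg[of N E] by linarith
  with d m E(4) have *: "0 < measure N (C - E)" by linarith
  show ?case
  proof (cases "measure N E \<le> measure N C / 2")
    case True
    then have "measure N E \<le> measure N B / 2 ^ n / 2" using divide_right_mono[OF C(4), of 2] by simp
    then show ?thesis using E C \<open>0 < measure N E\<close> by (intro bexI[of _ E]) (auto simp: mult.commute)
  next
    case False
    then have "measure N (C - E) \<le> measure N C / 2" using d by simp
    then have "measure N (C - E) \<le> measure N B / 2 ^ n / 2" using divide_right_mono[OF C(4), of 2] by simp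
    then show ?thesis using E C * by (intro bexI[of _ "C - E"]) (auto simp: mult.commute)
  qed
qed

text \<open>A maximal subset among those with at most half the measure has exactly half, because a
  gap could be partly filled by a small piece of the complement. This is the base case for halving
  several integrals at once.\<close>

lemma nonatomic_half:
  assumes "finite_measure N" and na: "nonatomic N" and B: "B \<in> sets N"
  shows "\<exists>C\<in>sets N. C \<subseteq> B \<and> measure N C = measure N B / 2"
proof -
  interpret finite_measure N by fact
  define D where "D = {C\<in>sets N. C \<subseteq> B \<and> measure N C \<le> measure N B / 2}"
  have "\<exists>C\<in>D. \<forall>E\<in>D. C \<subseteq> E \<longrightarrow> measure N E = measure N C"
  proof (rule exists_maximal_set)
    show "D \<subseteq> sets N" by (auto simp: D_def)
    have "{} \<in> D" by (simp add: D_def)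
    then show "D \<noteq> {}" by blast
    fix A :: "nat \<Rightarrow> 'a set" assume A: "incseq A" "range A \<subseteq> D"
    have "(\<lambda>n. measure N (A n)) \<longlonglongrightarrow> measure N (\<Union>n. A n)"
      using A by (intro finite_Lim_measure_incseq) (auto simp: D_def)
    then have "measure N (\<Union>n. A n) \<le> measure N B / 2"
      by (rule LIMSEQ_le_const2) (use A in \<open>auto simp: D_def\<close>)
    then show "(\<Union>n. A n) \<in> D" using A by (auto simp: D_def)
  qed
  then obtain C where C: "C \<in> D" and max: "\<And>E. E \<in> D \<Longrightarrow> C \<subseteq> E \<Longrightarrow> measure N E = measure N C"
    by auto
  have "measure N C = measure N B / 2"
  proof (rule ccontr)
    assume "measure N C \<noteq> measure N B / 2"
    then have lt: "measure N C < measure N B / 2" using C by (simp add: D_def)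
    have CB: "C \<in> sets N" "C \<subseteq> B" using C by (auto simp: D_def)
    have d: "measure N (B - C) = measure N B - measure N C"
      using CB B by (intro finite_measure_Diff) auto
    have pos: "measure N (B - C) > 0" using d lt measure_nonneg[of N C] by linarith
    define g where "g = measure N B / 2 - measure N C"
    have "g > 0" using lt by (simp add: g_def)
    then obtain n where n: "measure N (B - C) / 2 ^ n < g"
      using real_arch_pow_inv[of "g / measure N (B - C)" "1/2"] pos
      by (auto simp: field_simps)
    obtain E where E: "E \<in> sets N" "E \<subseteq> B - C" "0 < measure N E" "measure N E \<le> measure N (B - C) / 2 ^ n"
      using nonatomic_small_subset[OF assms(1) na _ pos] CB B by blast
    have u: "measure N (C \<union> E) = measure N C + measure N E"
      using E CB by (intro finite_measure_Union) auto
    have "C \<union> E \<in> D" using u E n CB by (auto simp: D_def g_def)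
    then show False using max[of "C \<union> E"] u E by auto
  qed
  then show ?thesis using C by (auto simp: D_def)
qed

text \<open>Iterated halving cuts \<open>B\<close> into \<open>2 ^ n\<close> pieces that share the
  integral of every \<open>h\<close> in \<open>H\<close> equally. Initial runs of pieces give a
  nested family along which all these integrals are linear in \<open>s\<close>; it is the path along
  which one more function can be halved.\<close>

lemma halving_family:
  fixes N :: "'t measure" and H :: "('t \<Rightarrow> real) set"
  assumes int: "\<And>h. h \<in> H \<Longrightarrow> integrable N h"
    and half: "\<And>B. B \<in> sets N \<Longrightarrow>
      \<exists>C\<in>sets N. C \<subseteq> B \<and> (\<forall>h\<in>H. (LINT t:C|N. h t) = (LINT t:B|N. h t) / 2)"
    and B: "B \<in> sets N"
  shows "\<exists>A :: real \<Rightarrow> 't set. A 0 = {} \<and> A 1 = B \<and>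
     (\<forall>s u. 0 \<le> s \<longrightarrow> s \<le> u \<longrightarrow> A s \<subseteq> A u) \<and>
     (\<forall>s\<in>{0..1}. A s \<in> sets N \<and> A s \<subseteq> B \<and> (\<forall>h\<in>H. (LINT t:A s|N. h t) = s * (LINT t:B|N. h t)))"
proof -
  obtain hf where hf: "\<And>B. B \<in> sets N \<Longrightarrow> hf B \<in> sets N" "\<And>B. B \<in> sets N \<Longrightarrow> hf B \<subseteq> B"
      "\<And>B h. B \<in> sets N \<Longrightarrow> h \<in> H \<Longrightarrow> (LINT t:hf B|N. h t) = (LINT t:B|N. h t) / 2"
    using half by metis
  \<comment> \<open>Piece \<open>i\<close> has the children \<open>2 * i\<close> and
    \<open>Suc (2 * i)\<close>, hence \<open>i div 2\<close> for the parent. In generation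
    \<open>n\<close> all indices from \<open>2 ^ n\<close> on give the empty set.\<close>
  define D where "D = rec_nat (\<lambda>i::nat. if i = 0 then B else {})
     (\<lambda>_ D i. if even i then hf (D (i div 2)) else D (i div 2) - hf (D (i div 2)))"
  have D0: "D 0 i = (if i = 0 then B else {})" for i by (simp add: D_def)
  have DS: "D (Suc n) i = (if even i then hf (D n (i div 2)) else D n (i div 2) - hf (D n (i div 2)))" for n i
    by (simp add: D_def)
  have si: "set_integrable N X h" if "X \<in> sets N" "h \<in> H" for X h
    unfolding set_integrable_def using integrable_mult_indicator[OF that(1) int[OF that(2)]] by simp
  have Dm: "D n i \<in> sets N" for n i
    by (induction n arbitrary: i) (auto simp: D0 DS B intro!: hf)
  have DB: "D n i \<subseteq> B" for n i
  proof (induction n arbitrary: i)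
    case (Suc n) then show ?case using hf(2)[OF Dm[of n "i div 2"]] by (auto simp: DS)
  qed (auto simp: D0)
  have Dd: "disjoint_family (D n)" for n
  proof (induction n)
    case 0 then show ?case by (auto simp: D0 disjoint_family_on_def)
  next
    case (Suc n)
    have sub: "D (Suc n) i \<subseteq> D n (i div 2)" for i using hf(2)[OF Dm[of n "i div 2"]] by (auto simp: DS)
    show ?case unfolding disjoint_family_on_def
    proof (intro ballI impI)
      fix i j :: nat assume ij: "i \<noteq> j"
      show "D (Suc n) i \<inter> D (Suc n) j = {}"
      proof (cases "i div 2 = j div 2")
        case False
        then have "D n (i div 2) \<inter> D n (j div 2) = {}" using Suc by (auto simp: disjoint_family_on_def)
        then show ?thesis using sub[of i] sub[of j] by blast
      next
        case True
        then have "even i \<noteq> even j" using ij by presburger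
        then show ?thesis using True by (auto simp: DS)
      qed
    qed
  qed
  have Di: "(LINT t:D n i|N. h t) = (LINT t:B|N. h t) / 2 ^ n" if "h \<in> H" "i < 2 ^ n" for n i h
    using that(2)
  proof (induction n arbitrary: i)
    case 0 then show ?case by (simp add: D0)
  next
    case (Suc n)
    then have IH: "(LINT t:D n (i div 2)|N. h t) = (LINT t:B|N. h t) / 2 ^ n" by auto
    let ?E = "D n (i div 2)"
    have "(LINT t:?E|N. h t) = (LINT t:(?E - hf ?E) \<union> hf ?E|N. h t)"
      using hf(2)[OF Dm[of n "i div 2"]] by (simp add: Un_absorb2)
    also have "\<dots> = (LINT t:(?E - hf ?E)|N. h t) + (LINT t:hf ?E|N. h t)"
      by (intro set_integral_Un si that) (auto intro: Dm hf)
    finally have "(LINT t:(?E - hf ?E)|N. h t) = (LINT t:?E|N. h t) / 2"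
      using hf(3)[OF Dm[of n "i div 2"] that(1)] by simp
    then show ?case using IH hf(3)[OF Dm[of n "i div 2"] that(1)] by (simp add: DS)
  qed
  define S where "S n j = (\<Union>i<j. D n i)" for n j
  have Sm: "S n j \<in> sets N" for n j using Dm by (auto simp: S_def)
  have SB: "S n j \<subseteq> B" for n j using DB by (auto simp: S_def)
  have Si: "(LINT t:S n j|N. h t) = real j / 2 ^ n * (LINT t:B|N. h t)" if "h \<in> H" "j \<le> 2 ^ n" for n j h
    using that(2)
  proof (induction j)
    case 0 then show ?case by (simp add: S_def set_lebesgue_integral_def)
  next
    case (Suc j)
    have eq1: "S n (Suc j) = D n j \<union> S n j" by (auto simp: S_def lessThan_Suc)
    have eq2: "D n j \<inter> S n j = {}"
    proof -
      have "D n j \<inter> D n i = {}" if "i < j" for i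
        using Dd[of n] that by (intro disjoint_family_onD[where I=UNIV]) auto
      then show ?thesis by (auto simp: S_def)
    qed
    have "(LINT t:S n (Suc j)|N. h t) = (LINT t:D n j|N. h t) + (LINT t:S n j|N. h t)"
      unfolding eq1 by (rule set_integral_Un[OF eq2 si[OF Dm that(1)] si[OF Sm that(1)]])
    then show ?case using Suc Di[OF that(1), of j n] by (simp add: field_simps)
  qed
  have S2: "S n j \<subseteq> S (Suc n) (2 * j)" for n j
  proof
    fix t assume "t \<in> S n j"
    then obtain i where i: "i < j" "t \<in> D n i" by (auto simp: S_def)
    show "t \<in> S (Suc n) (2 * j)"
    proof (cases "t \<in> hf (D n i)")
      case True
      then have "t \<in> D (Suc n) (2 * i)" by (simp add: DS)
      then show ?thesis using i by (auto simp: S_def intro!: bexI[of _ "2 * i"])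
    next
      case False
      then have "t \<in> D (Suc n) (Suc (2 * i))" using i by (simp add: DS)
      then show ?thesis using i by (auto simp: S_def intro!: bexI[of _ "Suc (2 * i)"])
    qed
  qed
  have Smono: "S n i \<subseteq> S n j" if "i \<le> j" for n i j using that by (force simp: S_def)
  \<comment> \<open>\<open>A s\<close> is the increasing union over \<open>n\<close> of the first \<open>\<lfloor>s * 2 ^ n\<rfloor>\<close> of the \<open>2 ^ n\<close> pieces of generation \<open>n\<close>.\<close>
  define fl where "fl s n = nat \<lfloor>s * 2 ^ n\<rfloor>" for s :: real and n :: nat
  \<comment> \<open>Passing to the next generation doubles the number of pieces in a run; that the
    floor at least doubles too makes the unions increase, by \<open>S2\<close>.\<close>
  have fl2: "2 * fl s n \<le> fl s (Suc n)" if "0 \<le> s" for s n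
  proof -
    have "2 * \<lfloor>s * 2 ^ n\<rfloor> \<le> \<lfloor>s * 2 ^ Suc n\<rfloor>"
      using of_int_floor_le[of "s * 2 ^ n"] by (simp add: le_floor_iff)
    then show ?thesis unfolding fl_def by (simp add: nat_le_iff that)
  qed
  define A where "A s = (\<Union>n. S n (fl s n))" for s
  have inc: "incseq (\<lambda>n. S n (fl s n))" if "0 \<le> s" for s
    using S2 Smono[OF fl2[OF that]] by (intro incseq_SucI) blast
  have Am: "A s \<in> sets N" for s using Sm by (auto simp: A_def)
  have AB: "A s \<subseteq> B" for s using SB by (auto simp: A_def)
  have fl_lim: "(\<lambda>n. real (fl s n) / 2 ^ n) \<longlonglongrightarrow> s" if s: "0 \<le> s" for s
  proof (rule tendsto_sandwich)
    have eq: "real (fl s n) = of_int \<lfloor>s * 2 ^ n\<rfloor>" for n using s by (simp add: fl_def)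
    show "\<forall>\<^sub>F n in sequentially. s - (1/2) ^ n \<le> real (fl s n) / 2 ^ n"
    proof (intro always_eventually allI)
      fix n
      have "s - (1/2) ^ n = (s * 2 ^ n - 1) / 2 ^ n" by (simp add: field_simps power_divide)
      also have "\<dots> \<le> real (fl s n) / 2 ^ n" unfolding eq by (intro divide_right_mono) (linarith, simp)
      finally show "s - (1/2) ^ n \<le> real (fl s n) / 2 ^ n" .
    qed
    show "\<forall>\<^sub>F n in sequentially. real (fl s n) / 2 ^ n \<le> s"
      unfolding eq by (auto simp: field_simps intro!: always_eventually)
    show "(\<lambda>n. s - (1/2) ^ n) \<longlonglongrightarrow> s"
      using tendsto_diff[OF tendsto_const LIMSEQ_realpow_zero[of "1/2::real"], of s] by simp
  qed auto
  have Ai: "(LINT t:A s|N. h t) = s * (LINT t:B|N. h t)" if s: "s \<in> {0..1}" and h: "h \<in> H" for s h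
  proof (rule LIMSEQ_unique)
    show "(\<lambda>n. LINT t:S n (fl s n)|N. h t) \<longlonglongrightarrow> (LINT t:A s|N. h t)"
      unfolding A_def using s h by (intro set_integral_cont_up inc si) (auto intro: Sm)
    have "fl s n \<le> 2 ^ n" for n
    proof -
      have "s * 2 ^ n \<le> 2 ^ n" using s by (simp add: mult_left_le_one_le)
      then have "\<lfloor>s * 2 ^ n\<rfloor> \<le> \<lfloor>2 ^ n :: real\<rfloor>" by (rule floor_mono)
      also have "\<dots> = 2 ^ n" by (metis floor_of_int of_int_numeral of_int_power)
      finally have "\<lfloor>s * 2 ^ n\<rfloor> \<le> 2 ^ n" .
      then show ?thesis by (simp add: fl_def nat_le_iff)
    qed
    then have eq: "(LINT t:S n (fl s n)|N. h t) = real (fl s n) / 2 ^ n * (LINT t:B|N. h t)" for n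
      by (intro Si[OF h])
    then show "(\<lambda>n. LINT t:S n (fl s n)|N. h t) \<longlonglongrightarrow> s * (LINT t:B|N. h t)"
      unfolding eq using s by (intro tendsto_mult tendsto_const fl_lim) auto
  qed
  have "A s \<subseteq> A u" if "0 \<le> s" "s \<le> u" for s u
  proof -
    have "fl s n \<le> fl u n" for n using that unfolding fl_def
      by (intro nat_mono floor_mono mult_right_mono) auto
    then show ?thesis unfolding A_def using Smono by blast
  qed
  moreover have "A 0 = {}" by (simp add: A_def S_def fl_def)
  moreover have "A 1 = B"
  proof
    show "B \<subseteq> A 1" by (auto simp: A_def S_def fl_def D0 intro!: exI[of _ 0])
  qed (rule AB)
  ultimately show ?thesis using Am AB Ai by (intro exI[of _ A]) auto
qed

text \<open>Truncation of \<open>\<bar>h t\<bar>\<close> at a large level \<open>m\<close> leaves a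
  remainder with integral below \<open>e / 2\<close>, and the truncated part contributes at most
  \<open>m\<close> times the measure of \<open>A\<close>. The \<open>+ 1\<close> in the witness
  covers \<open>m = 0\<close>.\<close>

lemma small_set_integral:
  fixes h :: "'t \<Rightarrow> real"
  assumes "finite_measure N" and h: "integrable N h" and e: "e > 0"
  shows "\<exists>d>0. \<forall>A\<in>sets N. measure N A < d \<longrightarrow> (LINT t:A|N. \<bar>h t\<bar>) < e"
proof -
  interpret finite_measure N by fact
  have "(\<lambda>m. LINT t|N. \<bar>h t\<bar> - min \<bar>h t\<bar> (real m)) \<longlonglongrightarrow> (LINT t|N. 0)"
  proof (rule integral_dominated_convergence[where w="\<lambda>t. \<bar>h t\<bar>"])
    show "AE t in N. (\<lambda>m. \<bar>h t\<bar> - min \<bar>h t\<bar> (real m)) \<longlonglongrightarrow> 0"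
    proof (rule AE_I2, rule tendsto_eventually)
      fix t
      obtain m0 where "\<bar>h t\<bar> \<le> real m0" using real_arch_simple by blast
      then show "\<forall>\<^sub>F m in sequentially. \<bar>h t\<bar> - min \<bar>h t\<bar> (real m) = 0"
        by (auto simp: eventually_sequentially min_def intro!: exI[of _ m0])
    qed
  qed (use h in \<open>auto\<close>)
  then have "\<forall>\<^sub>F m in sequentially. (LINT t|N. \<bar>h t\<bar> - min \<bar>h t\<bar> (real m)) < e / 2"
    using e by (intro order_tendstoD) auto
  then obtain m where m: "(LINT t|N. \<bar>h t\<bar> - min \<bar>h t\<bar> (real m)) < e / 2"
    by (auto simp: eventually_sequentially)
  show ?thesis
  proof (intro exI conjI ballI impI)
    show "e / (2 * (real m + 1)) > 0" using e by simp
    fix A assume A: "A \<in> sets N" "measure N A < e / (2 * (real m + 1))"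
    have i1: "integrable N (\<lambda>t. \<bar>h t\<bar> - min \<bar>h t\<bar> (real m))"
      using h by (intro Bochner_Integration.integrable_diff integrable_min) auto
    have i2: "integrable N (\<lambda>t. indicator A t * real m)" using A by (intro integrable_mult_left integrable_real_indicator) (auto simp: emeasure_eq_measure)
    have "(LINT t:A|N. \<bar>h t\<bar>) \<le> (LINT t|N. (\<bar>h t\<bar> - min \<bar>h t\<bar> (real m)) + indicator A t * real m)"
      unfolding set_lebesgue_integral_def
      using integrable_mult_indicator[OF A(1), of "\<lambda>t. \<bar>h t\<bar>"] h
      by (intro integral_mono Bochner_Integration.integrable_add i1 i2) (auto split: split_indicator)
    also have "\<dots> = (LINT t|N. (\<bar>h t\<bar> - min \<bar>h t\<bar> (real m))) + measure N A * real m"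
      using A by (subst Bochner_Integration.integral_add[OF i1 i2]) (simp add: Int_absorb1 sets.sets_into_space)
    also have "measure N A * real m \<le> e / 2"
    proof -
      have "measure N A * real m \<le> measure N A * (real m + 1)" by (intro mult_left_mono) auto
      also have "\<dots> \<le> e / (2 * (real m + 1)) * (real m + 1)" using A by (intro mult_right_mono) auto
      also have "\<dots> = e / 2" by (simp add: field_simps)
      finally show ?thesis .
    qed
    finally show "(LINT t:A|N. \<bar>h t\<bar>) < e" using m by simp
  qed
qed

text \<open>For a further integrand \<open>g\<close>, the integrals of \<open>g\<close> over \<open>A (s + 1/2) - A s\<close> at \<open>s = 0\<close> and at
  \<open>s = 1/2\<close> add up to the integral over \<open>B\<close>, so by continuity some \<open>s\<close> gives exactly half of it.\<close>

lemma simultaneous_half: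
  fixes N :: "'t measure" and H :: "('t \<Rightarrow> real) set"
  assumes fin: "finite_measure N" and na: "nonatomic N"
    and H: "finite H" "\<And>h. h \<in> H \<Longrightarrow> integrable N h" and B: "B \<in> sets N"
  shows "\<exists>C\<in>sets N. C \<subseteq> B \<and> (\<forall>h\<in>insert (\<lambda>_. 1) H. (LINT t:C|N. h t) = (LINT t:B|N. h t) / 2)"
  using H B
proof (induction H arbitrary: B rule: finite_induct)
  case empty
  interpret finite_measure N by fact
  have "(LINT t:X|N. (1::real)) = measure N X" if "X \<in> sets N" for X
    using that by (simp add: set_lebesgue_integral_def Int_absorb1 sets.sets_into_space)
  then show ?case using nonatomic_half[OF fin na empty(2)] empty by auto
next
  case (insert g H)
  interpret finite_measure N by fact
  let ?H = "insert (\<lambda>_. 1) H"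
  have intH: "integrable N h" if "h \<in> ?H" for h using that insert.prems(1) by auto
  have g: "integrable N g" using insert by auto
  \<comment> \<open>The dyadic construction halves every piece again, so the induction hypothesis is
    needed at all measurable sets, not only at the given one.\<close>
  have half: "\<exists>C\<in>sets N. C \<subseteq> B \<and> (\<forall>h\<in>?H. (LINT t:C|N. h t) = (LINT t:B|N. h t) / 2)"
    if "B \<in> sets N" for B
    using insert.IH[OF _ that] insert.prems(1) by blast
  obtain A where A0: "A 0 = {} \<and> A 1 = B \<and>
     (\<forall>s u. 0 \<le> s \<longrightarrow> s \<le> u \<longrightarrow> A s \<subseteq> A u) \<and>
     (\<forall>s\<in>{0..1}. A s \<in> sets N \<and> A s \<subseteq> B \<and> (\<forall>h\<in>?H. (LINT t:A s|N. h t) = s * (LINT t:B|N. h t)))"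
    using halving_family[OF intH half insert.prems(2)] by (rule exE)
  have A: "A 0 = {}" "A 1 = B" "\<And>s u. 0 \<le> s \<Longrightarrow> s \<le> u \<Longrightarrow> A s \<subseteq> A u"
      "\<And>s. s \<in> {0..1} \<Longrightarrow> A s \<in> sets N"
      "\<And>s h. s \<in> {0..1} \<Longrightarrow> h \<in> ?H \<Longrightarrow> (LINT t:A s|N. h t) = s * (LINT t:B|N. h t)"
    using A0 by blast+
  have si: "set_integrable N X h" if "X \<in> sets N" "integrable N h" for X and h :: "'t \<Rightarrow> real"
    unfolding set_integrable_def using integrable_mult_indicator[OF that] by simp
  define G where "G s = (LINT t:A s|N. g t)" for s
  have diff: "(LINT t:A u - A s|N. h t) = (LINT t:A u|N. h t) - (LINT t:A s|N. h t)"
    if "0 \<le> s" "s \<le> u" "u \<le> 1" "integrable N h" for s u and h :: "'t \<Rightarrow> real"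
  proof -
    have "A u = (A u - A s) \<union> A s" using A(3)[of s u] that by auto
    then have "(LINT t:A u|N. h t) = (LINT t:(A u - A s) \<union> A s|N. h t)" by simp
    also have "\<dots> = (LINT t:A u - A s|N. h t) + (LINT t:A s|N. h t)"
      using A(4) that by (intro set_integral_Un si) auto
    finally show ?thesis by simp
  qed
  \<comment> \<open>This is what the constant function in \<open>?H\<close> is for: the increments
    of the path have small measure, so absolute continuity of the integral of \<open>g\<close> makes
    \<open>G\<close> continuous.\<close>
  have meas: "measure N (A u - A s) = (u - s) * measure N B" if su: "0 \<le> s" "s \<le> u" "u \<le> 1" for s u
  proof -
    have X: "(LINT t:X|N. (1::real)) = measure N X" if "X \<in> sets N" for X
      using that by (simp add: set_lebesgue_integral_def Int_absorb1 sets.sets_into_space)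
    have "measure N (A u - A s) = (LINT t:A u - A s|N. (1::real))" using su A(4) by (subst X) auto
    also have "\<dots> = u * (LINT t:B|N. (1::real)) - s * (LINT t:B|N. (1::real))"
      using diff[OF su, of "\<lambda>_. 1"] A(5)[of u "\<lambda>_. 1"] A(5)[of s "\<lambda>_. 1"] su by simp
    finally show ?thesis using X[of B] insert.prems by (simp add: algebra_simps)
  qed
  have cont: "continuous_on {0..1} G"
    unfolding continuous_on_iff
  proof (intro ballI allI impI)
    fix s e :: real assume s: "s \<in> {0..1}" and e: "0 < e"
    obtain d where d: "d > 0" "\<And>A. A \<in> sets N \<Longrightarrow> measure N A < d \<Longrightarrow> (LINT t:A|N. \<bar>g t\<bar>) < e"
      using small_set_integral[OF fin g e] by auto
    have key: "\<bar>G u - G s\<bar> < e" if "0 \<le> s" "s \<le> u" "u \<le> 1" "u - s < d / (measure N B + 1)" for s u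
    proof -
      have "(u - s) * measure N B \<le> (u - s) * (measure N B + 1)" using that by (intro mult_left_mono) auto
      also have "\<dots> < d" using that(4) measure_nonneg[of N B] by (simp add: field_simps)
      finally have m: "measure N (A u - A s) < d" using meas[OF that(1-3)] by simp
      have "\<bar>G u - G s\<bar> = \<bar>LINT t:A u - A s|N. g t\<bar>" using diff[OF that(1-3) g] by (simp add: G_def)
      also have "\<dots> \<le> (LINT t:A u - A s|N. \<bar>g t\<bar>)"
        using set_integral_norm_bound[OF si[OF _ g], of "A u - A s"] A(4) that by auto
      also have "\<dots> < e" using d(2)[OF _ m] A(4) that by auto
      finally show ?thesis .
    qed
    show "\<exists>d>0. \<forall>u\<in>{0..1}. dist u s < d \<longrightarrow> dist (G u) (G s) < e"
    proof (intro exI conjI ballI impI)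
      show "d / (measure N B + 1) > 0" using d measure_nonneg[of N B] by (intro divide_pos_pos) linarith+
      fix u assume "u \<in> {0..1::real}" "dist u s < d / (measure N B + 1)"
      then show "dist (G u) (G s) < e"
        using key[of s u] key[of u s] s by (cases "s \<le> u") (auto simp: dist_real_def abs_minus_commute)
    qed
  qed
  define K where "K s = G (s + 1/2) - G s" for s
  have "continuous_on {0..1/2} K" unfolding K_def
    by (intro continuous_intros continuous_on_compose2[OF cont] continuous_on_subset[OF cont]) auto
  moreover have "K 0 + K (1/2) = (LINT t:B|N. g t)"
    by (simp add: K_def G_def A set_lebesgue_integral_def)
  ultimately have "\<exists>s\<ge>0. s \<le> 1/2 \<and> K s = (LINT t:B|N. g t) / 2"
    using IVT'[of K 0 "(LINT t:B|N. g t) / 2" "1/2"] IVT2'[of K "1/2" "(LINT t:B|N. g t) / 2" 0]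
    by (cases "K 0 \<le> K (1/2)") auto
  then obtain s where s: "0 \<le> s" "s \<le> 1/2" "K s = (LINT t:B|N. g t) / 2" by auto
  have "(LINT t:A (s + 1/2) - A s|N. h t) = (LINT t:B|N. h t) / 2" if "h \<in> insert (\<lambda>_. 1) (insert g H)" for h
  proof (cases "h = g")
    case True
    then show ?thesis using diff[of s "s + 1/2" g] g s by (simp add: K_def G_def)
  next
    case False
    then have h: "h \<in> ?H" using that by auto
    have "(LINT t:A (s + 1/2) - A s|N. h t) = (s + 1/2) * (LINT t:B|N. h t) - s * (LINT t:B|N. h t)"
      using diff[of s "s + 1/2" h] intH[OF h] A(5)[OF _ h] s by simp
    then show ?thesis by (simp add: algebra_simps)
  qed
  moreover have "A (s + 1/2) - A s \<subseteq> B" using A(3)[of "s + 1/2" 1] A(2) s by auto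
  ultimately show ?case using s A(4) by (intro bexI[of _ "A (s + 1/2) - A s"]) auto
qed

text \<open>The coordinates of \<open>h\<close> form a finite family, so
  \<open>halving_family\<close> provides a path through the whole space for them, and the set at
  parameter \<open>l\<close> is the one sought. This segment of the range of the vector measure is
  all that convexity of the Aumann integral uses.\<close>

lemma Lyapunov_scaling:
  fixes h :: "'t \<Rightarrow> 'a::euclidean_space"
  assumes fin: "finite_measure N" and na: "nonatomic N" and h: "integrable N h" and l: "0 \<le> l" "l \<le> 1"
  shows "\<exists>A\<in>sets N. (LINT t:A|N. h t) = l *\<^sub>R integral\<^sup>L N h"
proof -
  let ?H = "insert (\<lambda>_. 1) ((\<lambda>b t. h t \<bullet> b) ` Basis)"
  interpret finite_measure N by fact
  have int: "integrable N g" if "g \<in> ?H" for g using that h by auto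
  have half: "\<exists>C\<in>sets N. C \<subseteq> B \<and> (\<forall>h\<in>?H. (LINT t:C|N. h t) = (LINT t:B|N. h t) / 2)"
    if "B \<in> sets N" for B
    using int by (intro simultaneous_half[OF fin na] that) auto
  obtain A where "A 0 = {} \<and> A 1 = space N \<and>
     (\<forall>s u. 0 \<le> s \<longrightarrow> s \<le> u \<longrightarrow> A s \<subseteq> A u) \<and>
     (\<forall>s\<in>{0..1}. A s \<in> sets N \<and> A s \<subseteq> space N \<and>
       (\<forall>g\<in>?H. (LINT t:A s|N. g t) = s * (LINT t:space N|N. g t)))"
    using halving_family[OF int half sets.top] by (rule exE)
  then have A: "\<forall>s\<in>{0..1}. A s \<in> sets N \<and> (\<forall>g\<in>?H. (LINT t:A s|N. g t) = s * (LINT t:space N|N. g t))"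
    by blast
  have A': "A l \<in> sets N" using A l by auto
  have "(LINT t:A l|N. h t) = l *\<^sub>R integral\<^sup>L N h"
  proof (rule euclidean_eqI)
    fix b :: 'a assume b: "b \<in> Basis"
    have ih: "integrable N (\<lambda>t. indicator (A l) t *\<^sub>R h t)" by (intro integrable_mult_indicator A' h)
    have "(LINT t:A l|N. h t) \<bullet> b = (LINT t:A l|N. h t \<bullet> b)"
      using integral_inner_left[OF ih, of b] by (simp add: set_lebesgue_integral_def)
    also have "\<dots> = l * (LINT t:space N|N. h t \<bullet> b)" using A l b by auto
    also have "(LINT t:space N|N. h t \<bullet> b) = (LINT t|N. h t \<bullet> b)"
      by (simp add: set_integral_space h)
    also have "\<dots> = integral\<^sup>L N h \<bullet> b" by (rule integral_inner_left[OF h])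
    finally show "(LINT t:A l|N. h t) \<bullet> b = (l *\<^sub>R integral\<^sup>L N h) \<bullet> b" by simp
  qed
  then show ?thesis using A' by blast
qed

section \<open>Compact-valued measurable multifunctions and their Aumann integrals\<close>

text \<open>Hitting of closed sets is the form of measurability that passes, by compactness and
  countable set operations alone, to argmax sets and to sets of cluster points.\<close>

definition compact_multifunction :: "'t measure \<Rightarrow> ('t \<Rightarrow> 'a::euclidean_space set) \<Rightarrow> bool" where
  "compact_multifunction N K \<longleftrightarrow> (\<forall>t\<in>space N. compact (K t) \<and> K t \<noteq> {}) \<and>
     (\<forall>C. closed C \<longrightarrow> {t\<in>space N. K t \<inter> C \<noteq> {}} \<in> sets N)"

text \<open>For \<open>h = (\<bullet>) p\<close> this is the support function of \<open>S\<close> at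
  \<open>p\<close>, and \<open>argmax_set\<close> is the face of \<open>S\<close> exposed by
  \<open>p\<close>.\<close>

definition max_value :: "('a \<Rightarrow> real) \<Rightarrow> 'a set \<Rightarrow> real" where
  "max_value h S = (SUP z\<in>S. h z)"

definition argmax_set :: "('a \<Rightarrow> real) \<Rightarrow> 'a set \<Rightarrow> 'a set" where
  "argmax_set h S = {z\<in>S. h z = max_value h S}"

lemma max_value_attained:
  fixes h :: "'a::topological_space \<Rightarrow> real"
  assumes "compact S" "S \<noteq> {}" "continuous_on UNIV h"
  shows "\<exists>z\<in>S. h z = max_value h S"
proof -
  obtain z where z: "z \<in> S" "\<And>y. y \<in> S \<Longrightarrow> h y \<le> h z"
    using continuous_attains_sup[OF assms(1,2) continuous_on_subset[OF assms(3)]] by auto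
  then have "max_value h S = h z" unfolding max_value_def by (intro cSup_eq_maximum) auto
  then show ?thesis using z by force
qed

lemma max_value_ge:
  fixes h :: "'a::topological_space \<Rightarrow> real"
  assumes "compact S" "continuous_on UNIV h" "z \<in> S"
  shows "h z \<le> max_value h S"
proof -
  have "bounded (h ` S)"
    by (intro compact_imp_bounded compact_continuous_image continuous_on_subset[OF assms(2)] assms) auto
  then show ?thesis unfolding max_value_def
    by (intro cSUP_upper assms bounded_imp_bdd_above)
qed

lemma argmax_set_compact:
  fixes h :: "'a::euclidean_space \<Rightarrow> real"
  assumes "compact S" "S \<noteq> {}" "continuous_on UNIV h"
  shows "compact (argmax_set h S)" "argmax_set h S \<noteq> {}"
proof -
  have "argmax_set h S = S \<inter> h -` {max_value h S}" by (auto simp: argmax_set_def)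
  then show "compact (argmax_set h S)"
    using assms by (auto intro!: compact_Int_closed closed_vimage)
  show "argmax_set h S \<noteq> {}" using max_value_attained[OF assms] by (auto simp: argmax_set_def)
qed

lemma closed_superlevel:
  fixes h :: "'a::topological_space \<Rightarrow> real"
  assumes "continuous_on UNIV h"
  shows "closed {z. c \<le> h z}"
  using assms by (intro closed_Collect_le continuous_on_const)

text \<open>The maximum is attained, so it reaches a level \<open>c\<close> exactly when
  \<open>K t\<close> hits the closed set where \<open>h\<close> is at least
  \<open>c\<close>.\<close>

lemma max_value_measurable:
  fixes h :: "'a::euclidean_space \<Rightarrow> real"
  assumes K: "compact_multifunction N K" and h: "continuous_on UNIV h"
  shows "(\<lambda>t. max_value h (K t)) \<in> borel_measurable N"
  unfolding borel_measurable_iff_ge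
proof
  fix c
  have "c \<le> max_value h (K t) \<longleftrightarrow> K t \<inter> {z. c \<le> h z} \<noteq> {}" if t: "t \<in> space N" for t
  proof -
    have cK: "compact (K t)" "K t \<noteq> {}" using K t by (auto simp: compact_multifunction_def)
    obtain z where "z \<in> K t" "h z = max_value h (K t)" using max_value_attained[OF cK h] by blast
    then show ?thesis using max_value_ge[OF cK(1) h] order_trans[of c "h _" "max_value h (K t)"]
      by (metis (mono_tags, lifting) IntI Int_Collect disjoint_iff mem_Collect_eq)
  qed
  then have "{t\<in>space N. c \<le> max_value h (K t)} = {t\<in>space N. K t \<inter> {z. c \<le> h z} \<noteq> {}}"
    by blast
  also have "\<dots> \<in> sets N"
    using K closed_superlevel[OF h] by (auto simp: compact_multifunction_def)
  finally show "{t\<in>space N. c \<le> max_value h (K t)} \<in> sets N" .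
qed

text \<open>By compactness of \<open>K t \<inter> C\<close>, a maximiser lies in \<open>C\<close> as
  soon as, for every rational below the maximum, \<open>C\<close> contains a point of
  \<open>K t\<close> with at least that value. Countably many hitting conditions remain.\<close>

lemma compact_multifunction_argmax_set:
  fixes h :: "'a::euclidean_space \<Rightarrow> real"
  assumes K: "compact_multifunction N K" and h: "continuous_on UNIV h"
  shows "compact_multifunction N (\<lambda>t. argmax_set h (K t))"
proof -
  have cK: "compact (K t)" "K t \<noteq> {}" if "t \<in> space N" for t
    using K that by (auto simp: compact_multifunction_def)
  have "{t\<in>space N. argmax_set h (K t) \<inter> C \<noteq> {}} \<in> sets N" if C: "closed C" for C
  proof -
    have "argmax_set h (K t) \<inter> C \<noteq> {} \<longleftrightarrow>
        (\<forall>q\<in>\<rat>. q < max_value h (K t) \<longrightarrow> K t \<inter> (C \<inter> {z. q \<le> h z}) \<noteq> {})" if t: "t \<in> space N" for t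
    proof
      assume "argmax_set h (K t) \<inter> C \<noteq> {}"
      then show "\<forall>q\<in>\<rat>. q < max_value h (K t) \<longrightarrow> K t \<inter> (C \<inter> {z. q \<le> h z}) \<noteq> {}"
        by (force simp: argmax_set_def)
    next
      assume R: "\<forall>q\<in>\<rat>. q < max_value h (K t) \<longrightarrow> K t \<inter> (C \<inter> {z. q \<le> h z}) \<noteq> {}"
      obtain q0 where "q0 \<in> \<rat>" "q0 < max_value h (K t)"
        using Rats_dense_in_real[of "max_value h (K t) - 1" "max_value h (K t)"] by auto
      then have "K t \<inter> C \<noteq> {}" using R by blast
      moreover have "compact (K t \<inter> C)" using cK[OF t] C by auto
      ultimately obtain z where z: "z \<in> K t \<inter> C" "\<And>y. y \<in> K t \<inter> C \<Longrightarrow> h y \<le> h z"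
        using continuous_attains_sup[OF _ _ continuous_on_subset[OF h], of "K t \<inter> C"] by auto
      have "max_value h (K t) \<le> h z"
      proof (rule ccontr)
        assume "\<not> max_value h (K t) \<le> h z"
        then obtain q where q: "q \<in> \<rat>" "h z < q" "q < max_value h (K t)"
          using Rats_dense_in_real[of "h z" "max_value h (K t)"] by auto
        then obtain y where "y \<in> K t \<inter> C" "q \<le> h y" using R by blast
        then show False using z(2)[of y] q by simp
      qed
      then have "h z = max_value h (K t)" using max_value_ge[OF cK(1)[OF t] h, of z] z by auto
      then show "argmax_set h (K t) \<inter> C \<noteq> {}" using z by (auto simp: argmax_set_def)
    qed
    then have "{t\<in>space N. argmax_set h (K t) \<inter> C \<noteq> {}} =
        {t\<in>space N. \<forall>q\<in>\<rat>. q < max_value h (K t) \<longrightarrow> K t \<inter> (C \<inter> {z. q \<le> h z}) \<noteq> {}}"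
      by blast
    also have "\<dots> \<in> sets N"
    proof (intro sets.sets_Collect_countable_All' sets.sets_Collect_imp countable_rat)
      fix q
      have "closed (C \<inter> {z. q \<le> h z})" using C closed_superlevel[OF h] by (intro closed_Int)
      then show "{t\<in>space N. K t \<inter> (C \<inter> {z. q \<le> h z}) \<noteq> {}} \<in> sets N"
        using K unfolding compact_multifunction_def by blast
      show "{t\<in>space N. q < max_value h (K t)} \<in> sets N"
        using max_value_measurable[OF K h] by measurable
    qed
    finally show ?thesis .
  qed
  then show ?thesis using argmax_set_compact[OF cK h] by (auto simp: compact_multifunction_def)
qed

text \<open>Lexicographic maximisation: maximising one coordinate after the other shrinks
  \<open>K t\<close> to a single point and keeps measurability at each stage.\<close>

lemma measurable_selection:
  fixes K :: "'t \<Rightarrow> 'a::euclidean_space set"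
  assumes K: "compact_multifunction N K"
  shows "\<exists>f\<in>borel_measurable N. \<forall>t\<in>space N. f t \<in> K t"
proof -
  have "\<exists>K'. compact_multifunction N K' \<and> (\<forall>t. K' t \<subseteq> K t) \<and>
      (\<forall>b\<in>B. \<exists>m\<in>borel_measurable N. \<forall>t\<in>space N. \<forall>z\<in>K' t. z \<bullet> b = m t)" if "finite B" for B :: "'a set"
    using that
  proof induction
    case empty
    then show ?case using K by auto
  next
    case (insert b B)
    then obtain K' where K': "compact_multifunction N K'" "\<And>t. K' t \<subseteq> K t"
      "\<forall>b\<in>B. \<exists>m\<in>borel_measurable N. \<forall>t\<in>space N. \<forall>z\<in>K' t. z \<bullet> b = m t" by blast
    have c: "continuous_on UNIV (\<lambda>z. z \<bullet> b)" by (intro continuous_intros)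
    let ?K = "\<lambda>t. argmax_set (\<lambda>z. z \<bullet> b) (K' t)"
    have sub: "?K t \<subseteq> K' t" for t by (auto simp: argmax_set_def)
    have "\<forall>c\<in>insert b B. \<exists>m\<in>borel_measurable N. \<forall>t\<in>space N. \<forall>z\<in>?K t. z \<bullet> c = m t"
    proof
      fix c assume "c \<in> insert b B"
      then show "\<exists>m\<in>borel_measurable N. \<forall>t\<in>space N. \<forall>z\<in>?K t. z \<bullet> c = m t"
      proof
        assume "c = b"
        then show ?thesis using max_value_measurable[OF K'(1) c]
          by (intro bexI[of _ "\<lambda>t. max_value (\<lambda>z. z \<bullet> b) (K' t)"]) (auto simp: argmax_set_def)
      next
        assume "c \<in> B"
        then show ?thesis using K'(3) sub by (meson subsetD)
      qed
    qed
    then show ?case using compact_multifunction_argmax_set[OF K'(1) c] sub K'(2) by (intro exI[of _ ?K]) blast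
  qed
  from this[OF finite_Basis] obtain K' where *: "compact_multifunction N K' \<and> (\<forall>t. K' t \<subseteq> K t) \<and>
      (\<forall>b\<in>Basis. \<exists>m\<in>borel_measurable N. \<forall>t\<in>space N. \<forall>z\<in>K' t. z \<bullet> b = m t)" by (rule exE)
  note K' = conjunct1[OF *] spec[OF conjunct1[OF conjunct2[OF *]]] conjunct2[OF conjunct2[OF *]]
  \<comment> \<open>All coordinates are constant on \<open>K' t\<close>, so the choice picks its
    only point, whose coordinates are the measurable functions already found.\<close>
  define f where "f t = (SOME z. z \<in> K' t)" for t
  have f: "f t \<in> K' t" if "t \<in> space N" for t
  proof -
    have "K' t \<noteq> {}" using K'(1) that unfolding compact_multifunction_def by blast
    then show ?thesis unfolding f_def by (simp add: some_in_eq)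
  qed
  have "f \<in> borel_measurable N"
    unfolding borel_measurable_euclidean_space[where f=f]
  proof
    fix b :: 'a assume "b \<in> Basis"
    then obtain m where m: "m \<in> borel_measurable N" "\<forall>t\<in>space N. \<forall>z\<in>K' t. z \<bullet> b = m t" using K'(3) by blast
    have "(\<lambda>t. f t \<bullet> b) \<in> borel_measurable N \<longleftrightarrow> m \<in> borel_measurable N"
      using m f by (intro measurable_cong) auto
    then show "(\<lambda>t. f t \<bullet> b) \<in> borel_measurable N" using m by simp
  qed
  then show ?thesis using f K'(2) by (intro bexI[of _ f]) auto
qed

section \<open>Support functions, exposed faces and convexity of the Aumann integral\<close>

lemma argmax_selection:
  fixes K :: "'t \<Rightarrow> 'a::euclidean_space set"
  assumes K: "compact_multifunction N K" and h: "continuous_on UNIV h"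
  shows "\<exists>f\<in>borel_measurable N. \<forall>t\<in>space N. f t \<in> K t \<and> h (f t) = max_value h (K t)"
  using measurable_selection[OF compact_multifunction_argmax_set[OF assms]] by (auto simp: argmax_set_def)

text \<open>This is the directional derivative of the support function. A maximiser of
  \<open>p\<close> on the face exposed by \<open>q\<close> bounds the difference quotients from
  below; maximisers for the perturbed functionals accumulate on that face, which bounds them from
  above.\<close>

lemma max_value_directional_limit:
  fixes S :: "'a::euclidean_space set"
  assumes S: "compact S" "S \<noteq> {}"
  shows "(\<lambda>n. real (Suc n) * (max_value ((\<bullet>) (q + p /\<^sub>R real (Suc n))) S - max_value ((\<bullet>) q) S))
     \<longlonglongrightarrow> max_value ((\<bullet>) p) (argmax_set ((\<bullet>) q) S)" (is "?a \<longlonglongrightarrow> ?D")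
proof -
  have c: "continuous_on UNIV ((\<bullet>) r)" for r :: 'a by (intro continuous_intros)
  note F = argmax_set_compact[OF S c[of q]]
  obtain z0 where z0: "z0 \<in> argmax_set ((\<bullet>) q) S" "p \<bullet> z0 = ?D"
    using max_value_attained[OF F c[of p]] by auto
  have ge: "?D \<le> ?a n" for n
  proof -
    have "(q + p /\<^sub>R real (Suc n)) \<bullet> z0 \<le> max_value ((\<bullet>) (q + p /\<^sub>R real (Suc n))) S"
      using z0 by (intro max_value_ge S c) (auto simp: argmax_set_def)
    moreover have "q \<bullet> z0 = max_value ((\<bullet>) q) S" using z0 by (auto simp: argmax_set_def)
    ultimately show ?thesis using z0(2) by (auto simp: field_simps inner_add_left)
  qed
  obtain b where b: "\<And>z. z \<in> S \<Longrightarrow> norm z \<le> b"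
    using compact_imp_bounded[OF S(1)] by (auto simp: bounded_iff)
  have lt: "\<forall>\<^sub>F n in sequentially. ?a n < ?D + e" if e: "e > 0" for e
  proof (rule ccontr)
    assume "\<not> ?thesis"
    then have inf: "\<exists>\<^sub>F n in sequentially. ?D + e \<le> ?a n" by (simp add: not_eventually not_less)
    have "\<exists>z\<in>S. (q + p /\<^sub>R real (Suc n)) \<bullet> z = max_value ((\<bullet>) (q + p /\<^sub>R real (Suc n))) S" for n
      using max_value_attained[OF S c] by auto
    then obtain z where z: "\<And>n. z n \<in> S"
      "\<And>n. (q + p /\<^sub>R real (Suc n)) \<bullet> z n = max_value ((\<bullet>) (q + p /\<^sub>R real (Suc n))) S" by metis
    have qz: "q \<bullet> z n \<le> max_value ((\<bullet>) q) S" for n using max_value_ge[OF S(1) c z(1)] by auto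
    have a: "?a n = real (Suc n) * (q \<bullet> z n - max_value ((\<bullet>) q) S) + p \<bullet> z n" for n
      unfolding z(2)[symmetric] by (simp add: field_simps inner_add_left)
    have a1: "?a n \<le> p \<bullet> z n" for n
      using qz[of n] mult_nonneg_nonpos[of "real (Suc n)" "q \<bullet> z n - max_value ((\<bullet>) q) S"] unfolding a by simp
    have pz: "\<bar>p \<bullet> z n\<bar> \<le> norm p * b" for n
      using Cauchy_Schwarz_ineq2[of p "z n"] mult_left_mono[OF b[OF z(1)[of n]], of "norm p"] by simp
    \<comment> \<open>The lower bound \<open>ge\<close> keeps \<open>q \<bullet> z n\<close> within
      a multiple of \<open>1 / Suc n\<close> of the maximum, so every limit of the
      \<open>z n\<close> lies on the face exposed by \<open>q\<close>.\<close>
    have a2: "max_value ((\<bullet>) q) S - (norm p * b - ?D) / real (Suc n) \<le> q \<bullet> z n" for n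
    proof -
      have "?D - p \<bullet> z n \<le> real (Suc n) * (q \<bullet> z n - max_value ((\<bullet>) q) S)"
        using ge[of n] unfolding a by simp
      then have "?D - norm p * b \<le> real (Suc n) * (q \<bullet> z n - max_value ((\<bullet>) q) S)" using pz[of n] by linarith
      then have "(?D - norm p * b) / real (Suc n) \<le> q \<bullet> z n - max_value ((\<bullet>) q) S"
        by (simp add: divide_le_eq mult.commute)
      then show ?thesis by (simp add: diff_divide_distrib)
    qed
    obtain r0 where r0: "strict_mono (r0::nat\<Rightarrow>nat)" "\<And>n. ?D + e \<le> ?a (r0 n)"
    proof -
      have "infinite {n. ?D + e \<le> ?a n}" using inf by (simp add: frequently_cofinite cofinite_eq_sequentially[symmetric])
      from infinite_enumerate[OF this] show ?thesis using that by auto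
    qed
    obtain l r1 where l: "l \<in> S" "strict_mono r1" "((z \<circ> r0) \<circ> r1) \<longlonglongrightarrow> l"
      using S(1)[unfolded compact_def, rule_format, of "z \<circ> r0"] z(1) by auto
    let ?r = "r0 \<circ> r1"
    have r: "strict_mono ?r" using r0 l by (simp add: strict_mono_o)
    have zl: "(\<lambda>n. z (?r n)) \<longlonglongrightarrow> l" using l(3) by (simp add: o_def)
    have "(\<lambda>n. (norm p * b - ?D) / real (Suc n)) \<longlonglongrightarrow> 0"
      using LIMSEQ_Suc[OF lim_const_over_n] by simp
    from LIMSEQ_subseq_LIMSEQ[OF this r]
    have "(\<lambda>n. max_value ((\<bullet>) q) S - (norm p * b - ?D) / real (Suc (?r n))) \<longlonglongrightarrow> max_value ((\<bullet>) q) S - 0"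
      by (intro tendsto_intros) (simp add: o_def)
    moreover have "(\<lambda>n. q \<bullet> z (?r n)) \<longlonglongrightarrow> q \<bullet> l" by (intro tendsto_intros zl)
    ultimately have "max_value ((\<bullet>) q) S - 0 \<le> q \<bullet> l"
      by (rule LIMSEQ_le) (use a2 in auto)
    then have "l \<in> argmax_set ((\<bullet>) q) S" using max_value_ge[OF S(1) c l(1), of q] l(1) by (auto simp: argmax_set_def)
    then have "p \<bullet> l \<le> ?D" by (intro max_value_ge[OF F(1) c])
    moreover have "?D + e \<le> p \<bullet> l"
    proof (rule LIMSEQ_le_const)
      show "(\<lambda>n. p \<bullet> z (?r n)) \<longlonglongrightarrow> p \<bullet> l" by (intro tendsto_intros zl)
      show "\<exists>N. \<forall>n\<ge>N. ?D + e \<le> p \<bullet> z (?r n)" using order_trans[OF r0(2) a1] by auto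
    qed
    ultimately show False using e by simp
  qed
  show ?thesis
  proof (rule order_tendstoI)
    fix a assume "a < ?D"
    then show "\<forall>\<^sub>F n in sequentially. a < ?a n" by (intro always_eventually allI less_le_trans[OF _ ge])
  next
    fix a assume "?D < a"
    then show "\<forall>\<^sub>F n in sequentially. ?a n < a" using lt[of "a - ?D"] by simp
  qed
qed

text \<open>Switching from \<open>f\<close> to \<open>g\<close> on a set that carries the fraction
  \<open>u\<close> of the integral of \<open>g - f\<close> realises the convex combination by a
  selection.\<close>

lemma convex_aumann_integral:
  fixes K :: "'t \<Rightarrow> 'a::euclidean_space set"
  assumes fin: "finite_measure N" and na: "nonatomic N"
  shows "convex (aumann_integral N K)"
  unfolding convex_alt
proof (intro ballI allI impI)
  fix x y :: 'a and u :: real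
  assume xy: "x \<in> aumann_integral N K" "y \<in> aumann_integral N K" and u: "0 \<le> u \<and> u \<le> 1"
  obtain f where f: "integrable N f" "AE t in N. f t \<in> K t" "x = integral\<^sup>L N f"
    using xy by (auto simp: aumann_integral_def)
  obtain g where g: "integrable N g" "AE t in N. g t \<in> K t" "y = integral\<^sup>L N g"
    using xy by (auto simp: aumann_integral_def)
  obtain A where A: "A \<in> sets N" "(LINT t:A|N. g t - f t) = u *\<^sub>R (LINT t|N. g t - f t)"
    using Lyapunov_scaling[OF fin na Bochner_Integration.integrable_diff[OF g(1) f(1)], of u] u by auto
  define h where "h t = f t + indicator A t *\<^sub>R (g t - f t)" for t
  have i: "integrable N (\<lambda>t. indicator A t *\<^sub>R (g t - f t))"
    using A f g by (intro integrable_mult_indicator) auto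
  have "integrable N h" unfolding h_def by (intro Bochner_Integration.integrable_add f i)
  moreover have "integral\<^sup>L N h = (1 - u) *\<^sub>R x + u *\<^sub>R y"
  proof -
    have "integral\<^sup>L N h = integral\<^sup>L N f + (LINT t:A|N. g t - f t)"
      unfolding h_def set_lebesgue_integral_def by (rule Bochner_Integration.integral_add[OF f(1) i])
    also have "\<dots> = x + u *\<^sub>R (y - x)"
      using A(2) Bochner_Integration.integral_diff[OF g(1) f(1)] f(3) g(3) by simp
    finally show ?thesis by (simp add: algebra_simps)
  qed
  moreover have "AE t in N. h t \<in> K t"
    using f(2) g(2) by eventually_elim (auto simp: h_def split: split_indicator)
  ultimately show "(1 - u) *\<^sub>R x + u *\<^sub>R y \<in> aumann_integral N K"
    by (auto simp: aumann_integral_def intro!: exI[of _ h])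
qed

lemma compact_multifunction_integrable_selection:
  fixes K :: "'t \<Rightarrow> 'a::euclidean_space set"
  assumes K: "compact_multifunction N K" and g: "integrable N g"
    and bd: "\<And>t z. t \<in> space N \<Longrightarrow> z \<in> K t \<Longrightarrow> norm z \<le> g t"
  shows "\<exists>f. integrable N f \<and> (\<forall>t\<in>space N. f t \<in> K t \<and> q \<bullet> f t = max_value ((\<bullet>) q) (K t))"
proof -
  have c: "continuous_on UNIV ((\<bullet>) q)" by (intro continuous_intros)
  obtain f where f: "f \<in> borel_measurable N" "\<And>t. t\<in>space N \<Longrightarrow> f t \<in> K t \<and> q \<bullet> f t = max_value ((\<bullet>) q) (K t)"
    using argmax_selection[OF K c] by auto
  have "norm (f t) \<le> norm (g t)" if "t \<in> space N" for t
    using bd[OF that, of "f t"] f(2)[OF that] by simp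
  then have "integrable N f" by (intro Bochner_Integration.integrable_bound[OF g f(1)]) auto
  then show ?thesis using f by auto
qed

text \<open>The inequality \<open>le\<close> is an equality at \<open>q\<close>, so its difference
  quotients at \<open>q\<close> in the direction \<open>p\<close> inherit it. In the limit they
  become the support function of the exposed face under the integral.\<close>

lemma integral_argmax_support:
  fixes K :: "'t \<Rightarrow> 'a::euclidean_space set"
  assumes K: "compact_multifunction N K" and g: "integrable N g"
    and bd: "\<And>t z. t \<in> space N \<Longrightarrow> z \<in> K t \<Longrightarrow> norm z \<le> g t"
    and le: "\<And>p. p \<bullet> y \<le> (LINT t|N. max_value ((\<bullet>) p) (K t))"
    and eq: "q \<bullet> y = (LINT t|N. max_value ((\<bullet>) q) (K t))"
  shows "p \<bullet> y \<le> (LINT t|N. max_value ((\<bullet>) p) (argmax_set ((\<bullet>) q) (K t)))"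
proof -
  have c: "continuous_on UNIV ((\<bullet>) r)" for r :: 'a by (intro continuous_intros)
  have cK: "compact (K t)" "K t \<noteq> {}" if "t \<in> space N" for t
    using K that by (auto simp: compact_multifunction_def)
  note sel = compact_multifunction_integrable_selection[OF K g bd]
  have mi: "integrable N (\<lambda>t. max_value ((\<bullet>) r) (K t))" for r
  proof -
    obtain f where "integrable N f" "\<forall>t\<in>space N. r \<bullet> f t = max_value ((\<bullet>) r) (K t)"
      using sel[of r] by auto
    moreover from this have "integrable N (\<lambda>t. r \<bullet> f t) \<longleftrightarrow> integrable N (\<lambda>t. max_value ((\<bullet>) r) (K t))"
      by (intro Bochner_Integration.integrable_cong) auto
    ultimately show ?thesis by auto
  qed
  let ?a = "\<lambda>n t. real (Suc n) * (max_value ((\<bullet>) (q + p /\<^sub>R real (Suc n))) (K t) - max_value ((\<bullet>) q) (K t))"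
  have "(\<lambda>n. LINT t|N. ?a n t) \<longlonglongrightarrow> (LINT t|N. max_value ((\<bullet>) p) (argmax_set ((\<bullet>) q) (K t)))"
  proof (rule integral_dominated_convergence[where w="\<lambda>t. norm p * g t"])
    show "AE t in N. (\<lambda>n. ?a n t) \<longlonglongrightarrow> max_value ((\<bullet>) p) (argmax_set ((\<bullet>) q) (K t))"
      using cK by (intro AE_I2 max_value_directional_limit) auto
    show "(\<lambda>t. max_value ((\<bullet>) p) (argmax_set ((\<bullet>) q) (K t))) \<in> borel_measurable N"
      by (intro max_value_measurable compact_multifunction_argmax_set K c)
    show "?a n \<in> borel_measurable N" for n using max_value_measurable[OF K c] by measurable
    show "integrable N (\<lambda>t. norm p * g t)" using g by simp
    \<comment> \<open>The quotient lies between \<open>p \<bullet> u\<close> and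
      \<open>p \<bullet> z\<close> for maximisers \<open>u\<close> of \<open>q\<close> and
      \<open>z\<close> of the perturbed functional, so the factor \<open>Suc n\<close> cancels and
      the bound is uniform in \<open>n\<close>.\<close>
    show "AE t in N. norm (?a n t) \<le> norm p * g t" for n
    proof (rule AE_I2)
      fix t assume t: "t \<in> space N"
      let ?q = "q + p /\<^sub>R real (Suc n)"
      obtain z where z: "z \<in> K t" "?q \<bullet> z = max_value ((\<bullet>) ?q) (K t)" using max_value_attained[OF cK[OF t] c] by blast
      obtain u where u: "u \<in> K t" "q \<bullet> u = max_value ((\<bullet>) q) (K t)" using max_value_attained[OF cK[OF t] c] by blast
      have 1: "q \<bullet> z \<le> max_value ((\<bullet>) q) (K t)" "?q \<bullet> u \<le> max_value ((\<bullet>) ?q) (K t)"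
        using max_value_ge[OF cK(1)[OF t] c] z(1) u(1) by blast+
      have cs: "\<bar>p \<bullet> x\<bar> \<le> norm p * g t" if "x \<in> K t" for x
        using Cauchy_Schwarz_ineq2[of p x] mult_left_mono[OF bd[OF t that], of "norm p"] by simp
      have "?a n t \<le> real (Suc n) * (?q \<bullet> z - q \<bullet> z)"
        using 1 z by (intro mult_left_mono) auto
      also have "\<dots> = p \<bullet> z" by (simp add: inner_add_left)
      finally have "?a n t \<le> norm p * g t" using cs[OF z(1)] by linarith
      moreover have "real (Suc n) * (?q \<bullet> u - q \<bullet> u) \<le> ?a n t"
        using 1 u by (intro mult_left_mono) auto
      moreover have "real (Suc n) * (?q \<bullet> u - q \<bullet> u) = p \<bullet> u" by (simp add: inner_add_left)
      ultimately show "norm (?a n t) \<le> norm p * g t" using cs[OF u(1)] by (simp add: abs_le_iff del: of_nat_Suc)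
    qed
  qed
  moreover have "p \<bullet> y \<le> (LINT t|N. ?a n t)" for n
  proof -
    have "real (Suc n) * ((q + p /\<^sub>R real (Suc n)) \<bullet> y - q \<bullet> y) \<le>
        real (Suc n) * ((LINT t|N. max_value ((\<bullet>) (q + p /\<^sub>R real (Suc n))) (K t)) - (LINT t|N. max_value ((\<bullet>) q) (K t)))"
      using le[of "q + p /\<^sub>R real (Suc n)"] eq by (intro mult_left_mono) auto
    also have "\<dots> = (LINT t|N. ?a n t)" using mi by (simp add: Bochner_Integration.integral_diff del: of_nat_Suc)
    finally have "real (Suc n) * ((q + p /\<^sub>R real (Suc n)) \<bullet> y - q \<bullet> y) \<le> (LINT t|N. ?a n t)" .
    moreover have "real (Suc n) * ((q + p /\<^sub>R real (Suc n)) \<bullet> y - q \<bullet> y) = p \<bullet> y" by (simp add: inner_add_left)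
    ultimately show ?thesis by (simp only:)
  qed
  ultimately show ?thesis by (intro LIMSEQ_le_const) auto
qed

text \<open>If \<open>y\<close> were not attained, a hyperplane through \<open>y\<close> would support the convex Aumann integral, \<open>y\<close> would
  satisfy the same hypothesis for the exposed face of \<open>K\<close>, and the span of the translated integral would have smaller
  dimension for that face.\<close>

lemma aumann_integral_support:
  fixes K :: "'t \<Rightarrow> 'a::euclidean_space set"
  assumes fin: "finite_measure N" and na: "nonatomic N" and g: "integrable N g"
    and K: "compact_multifunction N K"
    and bd: "\<And>t z. t \<in> space N \<Longrightarrow> z \<in> K t \<Longrightarrow> norm z \<le> g t"
    and le: "\<And>p. p \<bullet> y \<le> (LINT t|N. max_value ((\<bullet>) p) (K t))"
  shows "y \<in> aumann_integral N K"
  using K bd le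
proof (induction "dim ((\<lambda>z. z - y) ` aumann_integral N K)" arbitrary: K rule: less_induct)
  case less
  note K = less.prems(1) and bd = less.prems(2) and le = less.prems(3)
  let ?I = "aumann_integral N K"
  show ?case
  proof (rule ccontr)
    assume "y \<notin> ?I"
    then have "0 \<notin> (\<lambda>z. z - y) ` ?I" by auto
    moreover have "convex ((\<lambda>z. z - y) ` ?I)"
      by (intro convex_translation_subtract convex_aumann_integral fin na)
    moreover have "?I \<noteq> {}"
      using compact_multifunction_integrable_selection[OF K g bd] by (fastforce simp: aumann_integral_def)
    \<comment> \<open>The separating normal is taken inside the span. The translated integral of the
      face is orthogonal to it, so \<open>a\<close> drops out of the smaller span and the dimension
      decreases strictly.\<close>
    ultimately obtain a where a: "a \<in> span ((\<lambda>z. z - y) ` ?I)" "a \<noteq> 0"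
        "\<And>x. x \<in> (\<lambda>z. z - y) ` ?I \<Longrightarrow> 0 \<le> a \<bullet> x"
      using separating_hyperplane_set_0_inspan[of "(\<lambda>z. z - y) ` ?I"] by blast
    define q where "q = - a"
    have q: "q \<bullet> z \<le> q \<bullet> y" if "z \<in> ?I" for z
      using a(3)[of "z - y"] that by (auto simp: q_def inner_diff_right)
    have c: "continuous_on UNIV ((\<bullet>) q)" by (intro continuous_intros)
    let ?K = "\<lambda>t. argmax_set ((\<bullet>) q) (K t)"
    have sub: "?K t \<subseteq> K t" for t by (auto simp: argmax_set_def)
    have eq: "q \<bullet> y = (LINT t|N. max_value ((\<bullet>) q) (K t))"
    proof (rule antisym)
      obtain f where f: "integrable N f" "\<forall>t\<in>space N. f t \<in> K t \<and> q \<bullet> f t = max_value ((\<bullet>) q) (K t)"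
        using compact_multifunction_integrable_selection[OF K g bd, of q] by auto
      then have "integral\<^sup>L N f \<in> ?I" by (auto simp: aumann_integral_def)
      then have "q \<bullet> integral\<^sup>L N f \<le> q \<bullet> y" by (rule q)
      also have "q \<bullet> integral\<^sup>L N f = (LINT t|N. q \<bullet> f t)" using f by simp
      also have "\<dots> = (LINT t|N. max_value ((\<bullet>) q) (K t))" using f by (intro Bochner_Integration.integral_cong) auto
      finally show "(LINT t|N. max_value ((\<bullet>) q) (K t)) \<le> q \<bullet> y" .
    qed (rule le)
    have K': "compact_multifunction N ?K" by (intro compact_multifunction_argmax_set K c)
    have in_hyp: "q \<bullet> z = q \<bullet> y" if z: "z \<in> aumann_integral N ?K" for z
    proof -
      obtain f where f: "integrable N f" "AE t in N. f t \<in> ?K t" "z = integral\<^sup>L N f"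
        using z by (auto simp: aumann_integral_def)
      have "q \<bullet> z = (LINT t|N. q \<bullet> f t)" using f by simp
      also have "\<dots> = (LINT t|N. max_value ((\<bullet>) q) (K t))"
        using f max_value_measurable[OF K c] by (intro integral_cong_AE) (auto simp: argmax_set_def)
      finally show ?thesis using eq by simp
    qed
    have mono: "aumann_integral N ?K \<subseteq> ?I" using sub by (auto simp: aumann_integral_def) (metis (mono_tags, lifting) AE_mp AE_I2 subsetD)
    have "dim ((\<lambda>z. z - y) ` aumann_integral N ?K) < dim ((\<lambda>z. z - y) ` ?I)"
    proof -
      have s1: "span ((\<lambda>z. z - y) ` aumann_integral N ?K) \<subseteq> span ((\<lambda>z. z - y) ` ?I)"
        using mono by (intro span_mono) auto
      have "a \<notin> span ((\<lambda>z. z - y) ` aumann_integral N ?K)"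
      proof
        assume "a \<in> span ((\<lambda>z. z - y) ` aumann_integral N ?K)"
        moreover have "subspace {x. q \<bullet> x = 0}" by (rule subspace_hyperplane)
        moreover have "(\<lambda>z. z - y) ` aumann_integral N ?K \<subseteq> {x. q \<bullet> x = 0}"
          using in_hyp by (auto simp: inner_diff_right)
        ultimately have "q \<bullet> a = 0" using span_minimal by blast
        then show False using a(2) by (simp add: q_def)
      qed
      then have "span ((\<lambda>z. z - y) ` aumann_integral N ?K) \<subset> span ((\<lambda>z. z - y) ` ?I)" using s1 a(1) by blast
      then show ?thesis by (rule dim_psubset)
    qed
    then have "y \<in> aumann_integral N ?K"
    proof (rule less.hyps[OF _ K'])
      show "norm z \<le> g t" if "t \<in> space N" "z \<in> ?K t" for t z using bd that sub by blast
      show "p \<bullet> y \<le> (LINT t|N. max_value ((\<bullet>) p) (?K t))" for p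
        by (rule integral_argmax_support[OF K g bd le eq])
    qed
    then show False using mono \<open>y \<notin> ?I\<close> by blast
  qed
qed

section \<open>An exact Fatou lemma\<close>

definition cluster_points :: "(nat \<Rightarrow> 'a::topological_space) \<Rightarrow> 'a set" where
  "cluster_points s = {z. \<exists>r. strict_mono r \<and> (\<lambda>k. s (r k)) \<longlonglongrightarrow> z}"

lemma cluster_points_subseq:
  assumes "strict_mono r"
  shows "cluster_points (\<lambda>k. s (r k)) \<subseteq> cluster_points s"
proof
  fix z assume "z \<in> cluster_points (\<lambda>k. s (r k))"
  then obtain r' where r': "strict_mono r'" "(\<lambda>k. s (r (r' k))) \<longlonglongrightarrow> z" by (auto simp: cluster_points_def)
  then show "z \<in> cluster_points s"
    using strict_mono_o[OF assms r'(1)] by (auto simp: cluster_points_def intro!: exI[of _ "r \<circ> r'"])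
qed

text \<open>The tolerances \<open>1 / Suc m\<close> reduce the existence of a cluster point in
  \<open>C\<close> to countably many conditions on the distances of the \<open>s k\<close> from
  \<open>C\<close>, each measurable in a parameter.\<close>

lemma cluster_points_hit:
  fixes s :: "nat \<Rightarrow> 'a::euclidean_space"
  assumes bd: "\<And>k. norm (s k) \<le> b" and C: "closed C" "C \<noteq> {}"
    and fr: "\<And>m. \<exists>\<^sub>F k in sequentially. infdist (s k) C < 1 / real (Suc m)"
  shows "\<exists>z\<in>C. z \<in> cluster_points s"
proof -
  have "\<exists>k>n. infdist (s k) C < 1 / real (Suc m)" for n m
    using fr[of m] unfolding frequently_sequentially by (meson Suc_le_lessD)
  then obtain r where r: "\<And>m. infdist (s (r m)) C < 1 / real (Suc m)" "\<And>m. r m < r (Suc m)"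
    using dependent_nat_choice[of "\<lambda>m k. infdist (s k) C < 1 / real (Suc m)" "\<lambda>_ k k'. k < k'"] by metis
  have sm: "strict_mono r" using r(2) by (simp add: strict_mono_Suc_iff)
  have "bounded (range (s \<circ> r))" using bd by (auto simp: bounded_iff)
  then obtain z r' where z: "strict_mono r'" "((s \<circ> r) \<circ> r') \<longlonglongrightarrow> z"
    using bounded_imp_convergent_subsequence by blast
  then have lim: "(\<lambda>k. s ((r \<circ> r') k)) \<longlonglongrightarrow> z" by (simp add: o_def)
  have "(\<lambda>m. 1 / real (Suc m)) \<longlonglongrightarrow> 0" using LIMSEQ_Suc[OF lim_const_over_n[of 1]] by simp
  from LIMSEQ_subseq_LIMSEQ[OF this z(1)] have l0: "(\<lambda>m. 1 / real (Suc (r' m))) \<longlonglongrightarrow> 0" by (simp add: o_def)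
  have "(\<lambda>k. infdist (s ((r \<circ> r') k)) C) \<longlonglongrightarrow> infdist z C" by (intro tendsto_infdist lim)
  then have "infdist z C \<le> 0"
    by (rule LIMSEQ_le[OF _ l0]) (use r(1) in \<open>auto intro: less_imp_le\<close>)
  then have "infdist z C = 0" using infdist_nonneg[of z C] by linarith
  then have "z \<in> C" using in_closed_iff_infdist_zero[OF C] by blast
  moreover have "z \<in> cluster_points s"
    using lim strict_mono_o[OF sm z(1)] by (auto simp: cluster_points_def)
  ultimately show ?thesis by auto
qed

lemma cluster_points_frequently:
  fixes s :: "nat \<Rightarrow> 'a::euclidean_space"
  assumes "z \<in> cluster_points s" "e > 0"
  shows "\<exists>\<^sub>F k in sequentially. dist (s k) z < e"
proof -
  obtain r where r: "strict_mono r" "(\<lambda>k. s (r k)) \<longlonglongrightarrow> z"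
    using assms by (auto simp: cluster_points_def)
  have "\<forall>\<^sub>F k in sequentially. dist (s (r k)) z < e" using r(2) assms(2) by (rule tendstoD)
  then obtain K where K: "\<And>k. k \<ge> K \<Longrightarrow> dist (s (r k)) z < e" by (auto simp: eventually_sequentially)
  show ?thesis unfolding frequently_sequentially
  proof
    fix n
    have "n \<le> r (max n K)" using seq_suble[OF r(1), of "max n K"] by simp
    then show "\<exists>k\<ge>n. dist (s k) z < e" using K[of "max n K"] by auto
  qed
qed

text \<open>The hitting criterion with \<open>C = {z}\<close> yields closedness, and with
  \<open>C = UNIV\<close> it yields a cluster point.\<close>

lemma compact_cluster_points:
  fixes s :: "nat \<Rightarrow> 'a::euclidean_space"
  assumes bd: "\<And>k. norm (s k) \<le> b"
  shows "compact (cluster_points s)" "cluster_points s \<noteq> {}"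
proof -
  have "cluster_points s \<subseteq> cball 0 b"
  proof
    fix z assume "z \<in> cluster_points s"
    then obtain r where "(\<lambda>k. s (r k)) \<longlonglongrightarrow> z" by (auto simp: cluster_points_def)
    from LIMSEQ_le_const2[OF tendsto_norm[OF this]] bd show "z \<in> cball 0 b" by auto
  qed
  then have "bounded (cluster_points s)" by (rule bounded_subset[OF bounded_cball])
  moreover have "closed (cluster_points s)"
    unfolding closure_subset_eq[symmetric]
  proof
    fix z assume "z \<in> closure (cluster_points s)"
    then have z: "\<forall>e>0. \<exists>y\<in>cluster_points s. dist y z < e" by (simp add: closure_approachable)
    have "\<exists>\<^sub>F k in sequentially. infdist (s k) {z} < 1 / real (Suc m)" for m
    proof -
      obtain y where y: "y \<in> cluster_points s" "dist y z < 1 / real (Suc m) / 2"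
        using z[rule_format, of "1 / real (Suc m) / 2"] by auto
      have "\<exists>\<^sub>F k in sequentially. dist (s k) y < 1 / real (Suc m) / 2"
        by (rule cluster_points_frequently[OF y(1)]) simp
      then show ?thesis
      proof (rule frequently_elim1)
        fix k assume "dist (s k) y < 1 / real (Suc m) / 2"
        then have "dist (s k) z < 1 / real (Suc m)" using y(2) dist_triangle[of "s k" z y] by linarith
        then show "infdist (s k) {z} < 1 / real (Suc m)" by simp
      qed
    qed
    from cluster_points_hit[OF bd _ _ this] show "z \<in> cluster_points s" by auto
  qed
  ultimately show "compact (cluster_points s)" by (simp add: compact_eq_bounded_closed)
  have "\<exists>\<^sub>F k in sequentially. infdist (s k) UNIV < 1 / real (Suc m)" for m
    by (auto intro!: eventually_frequently simp del: of_nat_Suc)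
  from cluster_points_hit[OF bd _ _ this] show "cluster_points s \<noteq> {}" by auto
qed

lemma compact_multifunction_cluster_points:
  fixes f :: "nat \<Rightarrow> 't \<Rightarrow> 'a::euclidean_space"
  assumes f: "\<And>k. f k \<in> borel_measurable N" and bd: "\<And>k t. t \<in> space N \<Longrightarrow> norm (f k t) \<le> g t"
  shows "compact_multifunction N (\<lambda>t. cluster_points (\<lambda>k. f k t))"
proof -
  have "{t\<in>space N. cluster_points (\<lambda>k. f k t) \<inter> C \<noteq> {}} \<in> sets N" if C: "closed C" for C
  proof (cases "C = {}")
    case False
    have "cluster_points (\<lambda>k. f k t) \<inter> C \<noteq> {} \<longleftrightarrow>
       (\<forall>m. \<forall>n. \<exists>k. n \<le> k \<and> infdist (f k t) C < 1 / real (Suc m))" if t: "t \<in> space N" for t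
    proof
      assume "cluster_points (\<lambda>k. f k t) \<inter> C \<noteq> {}"
      then obtain z where z: "z \<in> cluster_points (\<lambda>k. f k t)" "z \<in> C" by auto
      show "\<forall>m. \<forall>n. \<exists>k. n \<le> k \<and> infdist (f k t) C < 1 / real (Suc m)"
      proof (intro allI)
        fix m n
        have "\<exists>\<^sub>F k in sequentially. dist (f k t) z < 1 / real (Suc m)"
          by (rule cluster_points_frequently[OF z(1)]) simp
        then obtain k where "k \<ge> n" "dist (f k t) z < 1 / real (Suc m)" unfolding frequently_sequentially by blast
        then show "\<exists>k. n \<le> k \<and> infdist (f k t) C < 1 / real (Suc m)"
          using infdist_le[OF z(2), of "f k t"] by (intro exI[of _ k]) auto
      qed
    next
      assume R: "\<forall>m. \<forall>n. \<exists>k. n \<le> k \<and> infdist (f k t) C < 1 / real (Suc m)"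
      then have "\<exists>\<^sub>F k in sequentially. infdist (f k t) C < 1 / real (Suc m)" for m
        unfolding frequently_sequentially by blast
      from cluster_points_hit[OF bd[OF t] C False this]
      show "cluster_points (\<lambda>k. f k t) \<inter> C \<noteq> {}" by auto
    qed
    then have "{t\<in>space N. cluster_points (\<lambda>k. f k t) \<inter> C \<noteq> {}} =
       {t\<in>space N. \<forall>m. \<forall>n. \<exists>k. n \<le> k \<and> infdist (f k t) C < 1 / real (Suc m)}" by blast
    also have "\<dots> \<in> sets N"
    proof (intro sets.sets_Collect_countable_All sets.sets_Collect_countable_Ex sets.sets_Collect_conj sets.sets_Collect_const)
      fix m n k
      have [measurable]: "(\<lambda>t. infdist (f k t) C) \<in> borel_measurable N"
        by (rule measurable_compose[OF f borel_measurable_continuous_onI])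
           (intro continuous_on_infdist continuous_on_id)
      show "{t\<in>space N. infdist (f k t) C < 1 / real (Suc m)} \<in> sets N" by measurable
    qed
    finally show ?thesis .
  qed simp
  then show ?thesis using compact_cluster_points[OF bd] by (auto simp: compact_multifunction_def)
qed

text \<open>By \<open>aumann_integral_support\<close> a comparison of support functions suffices.
  For every \<open>t\<close> the excess of \<open>p \<bullet> f k t\<close> over the support
  function of the cluster set tends to zero, and dominated convergence integrates this.\<close>

lemma Fatou_nonatomic:
  fixes f :: "nat \<Rightarrow> 't \<Rightarrow> 'a::euclidean_space"
  assumes fin: "finite_measure N" and na: "nonatomic N"
    and f: "\<And>k. f k \<in> borel_measurable N" and bd: "\<And>k t. t \<in> space N \<Longrightarrow> norm (f k t) \<le> g t"
    and g: "integrable N g" and lim: "(\<lambda>k. integral\<^sup>L N (f k)) \<longlonglongrightarrow> y"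
  shows "y \<in> aumann_integral N (\<lambda>t. cluster_points (\<lambda>k. f k t))"
proof -
  let ?K = "\<lambda>t. cluster_points (\<lambda>k. f k t)"
  have c: "continuous_on UNIV ((\<bullet>) r)" for r :: 'a by (intro continuous_intros)
  have K: "compact_multifunction N ?K" by (rule compact_multifunction_cluster_points[OF f bd])
  have bdK: "norm z \<le> g t" if t: "t \<in> space N" "z \<in> ?K t" for t z
  proof -
    obtain r where "(\<lambda>k. f (r k) t) \<longlonglongrightarrow> z" using t(2) by (auto simp: cluster_points_def)
    from LIMSEQ_le_const2[OF tendsto_norm[OF this]] bd[OF t(1)] show ?thesis by auto
  qed
  have fi: "integrable N (f k)" for k
    using bd by (intro Bochner_Integration.integrable_bound[OF g f] AE_I2) (auto intro: order_trans[OF _ abs_ge_self])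
  have "p \<bullet> y \<le> (LINT t|N. max_value ((\<bullet>) p) (?K t))" for p
  proof -
    obtain u where u: "integrable N u" "\<And>t. t\<in>space N \<Longrightarrow> u t \<in> ?K t \<and> p \<bullet> u t = max_value ((\<bullet>) p) (?K t)"
      using compact_multifunction_integrable_selection[OF K g bdK, of p] by auto
    have mi: "integrable N (\<lambda>t. max_value ((\<bullet>) p) (?K t))"
    proof -
      have "integrable N (\<lambda>t. p \<bullet> u t) \<longleftrightarrow> integrable N (\<lambda>t. max_value ((\<bullet>) p) (?K t))"
        using u by (intro Bochner_Integration.integrable_cong) auto
      then show ?thesis using u by auto
    qed
    have mb: "\<bar>max_value ((\<bullet>) p) (?K t)\<bar> \<le> norm p * g t" if t: "t \<in> space N" for t
      using Cauchy_Schwarz_ineq2[of p "u t"] mult_left_mono[OF bdK[OF t, of "u t"], of "norm p"] u(2)[OF t] by simp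
    have pb: "\<bar>p \<bullet> f k t\<bar> \<le> norm p * g t" if t: "t \<in> space N" for t k
      using Cauchy_Schwarz_ineq2[of p "f k t"] mult_left_mono[OF bd[OF t, of k], of "norm p"] by simp
    let ?h = "\<lambda>k t. max 0 (p \<bullet> f k t - max_value ((\<bullet>) p) (?K t))"
    have "(\<lambda>k. LINT t|N. ?h k t) \<longlonglongrightarrow> (LINT t|N. 0)"
    proof (rule integral_dominated_convergence[where w="\<lambda>t. 2 * (norm p * g t)"])
      show "?h k \<in> borel_measurable N" for k using f max_value_measurable[OF K c] by measurable
      show "integrable N (\<lambda>t. 2 * (norm p * g t))" using g by simp
      show "AE t in N. norm (?h k t) \<le> 2 * (norm p * g t)" for k
      proof (rule AE_I2)
        fix t assume t: "t \<in> space N"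
        show "norm (?h k t) \<le> 2 * (norm p * g t)" using mb[OF t] pb[OF t, of k] by (auto simp: max_def)
      qed
      show "AE t in N. (\<lambda>k. ?h k t) \<longlonglongrightarrow> 0"
      proof (rule AE_I2, rule order_tendstoI)
        fix t a assume t: "t \<in> space N"
        show "\<forall>\<^sub>F k in sequentially. a < ?h k t" if "a < 0" using that by (intro always_eventually) auto
        show "\<forall>\<^sub>F k in sequentially. ?h k t < a" if a: "0 < a"
        proof (rule ccontr)
          \<comment> \<open>A subsequence with excess at least \<open>a\<close> would be bounded and
            so have a limit in the cluster set that exceeds the support function of this very
            set.\<close>
          assume "\<not> ?thesis"
          then have "\<exists>\<^sub>F k in sequentially. a \<le> ?h k t" by (simp only: not_eventually not_less)
          then have "infinite {k. a \<le> ?h k t}" by (simp add: frequently_cofinite cofinite_eq_sequentially[symmetric])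
          from infinite_enumerate[OF this] obtain r :: "nat \<Rightarrow> nat" where r: "strict_mono r" "\<And>k. a \<le> ?h (r k) t" by auto
          have "bounded (range (\<lambda>k. f (r k) t))" using bd[OF t] by (auto simp: bounded_iff)
          then obtain z r' where z: "strict_mono r'" "((\<lambda>k. f (r k) t) \<circ> r') \<longlonglongrightarrow> z"
            using bounded_imp_convergent_subsequence by blast
          have zl: "(\<lambda>k. f (r (r' k)) t) \<longlonglongrightarrow> z" using z(2) by (simp add: o_def)
          then have "z \<in> ?K t" using strict_mono_o[OF r(1) z(1)] by (auto simp: cluster_points_def o_def intro!: exI[of _ "\<lambda>k. r (r' k)"])
          then have "p \<bullet> z \<le> max_value ((\<bullet>) p) (?K t)"
            using K t by (intro max_value_ge c) (auto simp: compact_multifunction_def)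
          moreover have "a \<le> max 0 (p \<bullet> z - max_value ((\<bullet>) p) (?K t))"
            by (rule LIMSEQ_le_const[OF tendsto_max[OF tendsto_const tendsto_diff[OF tendsto_inner[OF tendsto_const zl] tendsto_const]]])
               (use r(2) in auto)
          ultimately show False using a by simp
        qed
      qed
    qed simp
    then have "(\<lambda>k. (LINT t|N. max_value ((\<bullet>) p) (?K t)) + (LINT t|N. ?h k t)) \<longlonglongrightarrow> (LINT t|N. max_value ((\<bullet>) p) (?K t)) + 0"
      by (intro tendsto_intros) simp
    moreover have "(\<lambda>k. p \<bullet> integral\<^sup>L N (f k)) \<longlonglongrightarrow> p \<bullet> y" by (intro tendsto_intros lim)
    moreover have "p \<bullet> integral\<^sup>L N (f k) \<le> (LINT t|N. max_value ((\<bullet>) p) (?K t)) + (LINT t|N. ?h k t)" for k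
    proof -
      have hi: "integrable N (?h k)" using mi fi by (intro integrable_max Bochner_Integration.integrable_diff) auto
      have "p \<bullet> integral\<^sup>L N (f k) = (LINT t|N. p \<bullet> f k t)" using fi by simp
      also have "\<dots> \<le> (LINT t|N. max_value ((\<bullet>) p) (?K t) + ?h k t)"
        using fi mi hi by (intro integral_mono Bochner_Integration.integrable_add) auto
      finally show ?thesis using Bochner_Integration.integral_add[OF mi hi] by simp
    qed
    ultimately have "p \<bullet> y \<le> (LINT t|N. max_value ((\<bullet>) p) (?K t)) + 0" by (intro LIMSEQ_le) auto
    then show ?thesis by simp
  qed
  from aumann_integral_support[OF fin na g K bdK this] show ?thesis .
qed

text \<open>Basic open sets whose preimage in the atom is null are discarded, countably many in all.
  Two distinct values outside the discarded part would have disjoint preimages, each of the full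
  measure of the atom.\<close>

lemma measure_atom_constant:
  fixes f :: "'t \<Rightarrow> 'a::euclidean_space"
  assumes f: "f \<in> borel_measurable N" and A: "measure_atom N A" and fin: "finite_measure N"
  shows "\<exists>c. AE t in N. t \<in> A \<longrightarrow> f t = c"
proof -
  interpret finite_measure N by fact
  have As: "A \<in> sets N" "measure N A > 0"
    and Ad: "\<And>B. B \<in> sets N \<Longrightarrow> B \<subseteq> A \<Longrightarrow> measure N B = 0 \<or> measure N B = measure N A"
    using A by (auto simp: measure_atom_def emeasure_eq_measure)
  obtain BB :: "'a set set" where BB: "countable BB" "topological_basis BB" using ex_countable_basis by auto
  let ?P = "\<lambda>B. f -` B \<inter> A"
  have Pm: "?P B \<in> sets N" if "open B" for B
  proof -
    have "?P B = (f -` B \<inter> space N) \<inter> A" using sets.sets_into_space[OF As(1)] by auto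
    then show ?thesis using measurable_sets[OF f, of B] that As by auto
  qed
  have Bo: "open B" if "B \<in> BB" for B using BB(2) that by (rule topological_basis_open)
  define U where "U = (\<Union>B\<in>{B\<in>BB. measure N (?P B) = 0}. ?P B)"
  have U: "U \<in> null_sets N" unfolding U_def
    using BB(1) Pm Bo by (intro null_sets_UN') (auto simp: null_sets_def emeasure_eq_measure)
  then have "measure N (A - U) = measure N A"
    using As by (intro measure_Diff_null_set) auto
  then have "A - U \<noteq> {}" using As by (metis measure_empty less_irrefl)
  then obtain t0 where t0: "t0 \<in> A" "t0 \<notin> U" by auto
  have "f t = f t0" if t: "t \<in> A" "t \<notin> U" for t
  proof (rule ccontr)
    assume ne: "f t \<noteq> f t0"
    obtain V W where VW: "open V" "open W" "f t \<in> V" "f t0 \<in> W" "V \<inter> W = {}" using hausdorff[OF ne] by blast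
    obtain V' where V': "V' \<in> BB" "f t \<in> V'" "V' \<subseteq> V" using topological_basisE[OF BB(2) VW(1,3)] .
    obtain W' where W': "W' \<in> BB" "f t0 \<in> W'" "W' \<subseteq> W" using topological_basisE[OF BB(2) VW(2,4)] .
    have "measure N (?P V') \<noteq> 0" using t V' by (auto simp: U_def)
    then have 1: "measure N (?P V') = measure N A" using Ad[OF Pm[OF Bo[OF V'(1)]]] by auto
    have "measure N (?P W') \<noteq> 0" using t0 W' by (auto simp: U_def)
    then have 2: "measure N (?P W') = measure N A" using Ad[OF Pm[OF Bo[OF W'(1)]]] by auto
    have "measure N (?P V' \<union> ?P W') = measure N (?P V') + measure N (?P W')"
      using V' W' VW(5) Pm Bo by (intro finite_measure_Union) auto
    moreover have "measure N (?P V' \<union> ?P W') \<le> measure N A"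
      using As by (intro finite_measure_mono) auto
    ultimately show False using 1 2 As by simp
  qed
  then show ?thesis using AE_not_in[OF U] by (intro exI[of _ "f t0"]) (auto elim: eventually_mono)
qed

text \<open>Exhaustion among countable unions of atoms: if the complement of a maximal one had
  positive measure, it would contain a further atom.\<close>

lemma purely_atomic_countable_atoms:
  assumes fin: "finite_measure N" and pa: "purely_atomic N"
  shows "\<exists>AA. countable AA \<and> (\<forall>A\<in>AA. measure_atom N A) \<and> (AE t in N. t \<in> \<Union>AA)"
proof -
  interpret finite_measure N by fact
  define D where "D = {U. \<exists>AA. countable AA \<and> (\<forall>A\<in>AA. measure_atom N A) \<and> U = \<Union>AA}"
  have Ds: "D \<subseteq> sets N"
  proof
    fix U assume "U \<in> D"
    then show "U \<in> sets N" unfolding D_def by (auto simp: measure_atom_def intro!: sets.countable_Union)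
  qed
  have "\<exists>C\<in>D. \<forall>E\<in>D. C \<subseteq> E \<longrightarrow> measure N E = measure N C"
  proof (rule exists_maximal_set[OF Ds])
    have "{} \<in> D" by (auto simp: D_def intro!: exI[of _ "{}"])
    then show "D \<noteq> {}" by blast
    fix A :: "nat \<Rightarrow> 'a set" assume R: "range A \<subseteq> D"
    have "\<forall>n. \<exists>AA. countable AA \<and> (\<forall>A\<in>AA. measure_atom N A) \<and> A n = \<Union>AA"
    proof
      fix n
      have "A n \<in> D" using R by blast
      then show "\<exists>AA. countable AA \<and> (\<forall>A\<in>AA. measure_atom N A) \<and> A n = \<Union>AA"
        by (simp only: D_def mem_Collect_eq)
    qed
    from choice[OF this] obtain AA where
      "\<forall>n. countable (AA n) \<and> (\<forall>A\<in>AA n. measure_atom N A) \<and> A n = \<Union>(AA n)" by (rule exE)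
    then have AA: "\<And>n. countable (AA n)" "\<And>n B. B \<in> AA n \<Longrightarrow> measure_atom N B" "\<And>n. A n = \<Union>(AA n)"
      by blast+
    then have "(\<Union>n. A n) = \<Union>(\<Union>n. AA n)" by auto
    moreover have "countable (\<Union>n. AA n)" using AA(1) by (intro countable_UN) auto
    moreover have "\<forall>A\<in>(\<Union>n. AA n). measure_atom N A" using AA(2) by blast
    ultimately show "(\<Union>n. A n) \<in> D" unfolding D_def mem_Collect_eq by (intro exI[of _ "\<Union>n. AA n"] conjI)
  qed
  then obtain C where C: "C \<in> D" and max: "\<And>E. E \<in> D \<Longrightarrow> C \<subseteq> E \<Longrightarrow> measure N E = measure N C" by auto
  obtain AA where AA: "countable AA" "\<forall>A\<in>AA. measure_atom N A" "C = \<Union>AA" using C by (auto simp: D_def)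
  have Cs: "C \<in> sets N" using C Ds by auto
  have "emeasure N (space N - C) = 0"
  proof (rule ccontr)
    assume "emeasure N (space N - C) \<noteq> 0"
    then have "emeasure N (space N - C) > 0" by (simp add: zero_less_iff_neq_zero)
    then obtain B where B: "B \<subseteq> space N - C" "measure_atom N B" using pa Cs by (auto simp: purely_atomic_def)
    have "C \<union> B = \<Union>(insert B AA)" using AA by auto
    then have "C \<union> B \<in> D" using AA B by (auto simp: D_def intro!: exI[of _ "insert B AA"])
    then have "measure N (C \<union> B) = measure N C" using max by auto
    moreover have "measure N (C \<union> B) = measure N C + measure N B"
      using B Cs by (intro finite_measure_Union) (auto simp: measure_atom_def)
    ultimately show False using B by (auto simp: measure_atom_def emeasure_eq_measure)
  qed
  then have "space N - C \<in> null_sets N" using Cs by (auto simp: null_sets_def)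
  from AE_not_in[OF this] have "AE t in N. t \<in> \<Union>AA" using AE_space by eventually_elim (auto simp: AA)
  then show ?thesis using AA by blast
qed

lemma diagonal_convergent_subsequence:
  fixes c :: "nat \<Rightarrow> nat \<Rightarrow> 'a::euclidean_space"
  assumes bd: "\<And>k i. norm (c k i) \<le> b i"
  shows "\<exists>r. strict_mono r \<and> (\<forall>i. \<exists>l. (\<lambda>k. c (r k) i) \<longlonglongrightarrow> l)"
proof -
  interpret subseqs "\<lambda>i s. \<exists>l. (\<lambda>k. c (s k) i) \<longlonglongrightarrow> l"
  proof
    fix i and s :: "nat \<Rightarrow> nat"
    have "bounded (range (\<lambda>k. c (s k) i))" using bd by (auto simp: bounded_iff)
    then obtain z r' where z: "strict_mono r'" "((\<lambda>k. c (s k) i) \<circ> r') \<longlonglongrightarrow> z"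
      using bounded_imp_convergent_subsequence by blast
    then show "\<exists>r'. strict_mono r' \<and> (\<exists>l. (\<lambda>k. c ((s \<circ> r') k) i) \<longlonglongrightarrow> l)" by (auto simp: o_def)
  qed
  have "\<exists>l. (\<lambda>k. c (diagseq k) i) \<longlonglongrightarrow> l" for i
  proof -
    have "\<exists>l. (\<lambda>k. c ((diagseq \<circ> ((+) (Suc i))) k) i) \<longlonglongrightarrow> l"
    proof (rule diagseq_holds)
      fix r s n assume "strict_mono (r::nat\<Rightarrow>nat)" "\<exists>l. (\<lambda>k. c (s k) n) \<longlonglongrightarrow> l"
      then show "\<exists>l. (\<lambda>k. c ((s \<circ> r) k) n) \<longlonglongrightarrow> l"
        using LIMSEQ_subseq_LIMSEQ[of "\<lambda>k. c (s k) n"] by (auto simp: o_def)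
    qed
    then obtain l where "(\<lambda>k. c (diagseq (k + Suc i)) i) \<longlonglongrightarrow> l" by (auto simp: o_def add.commute)
    then show ?thesis using LIMSEQ_offset[of "\<lambda>k. c (diagseq k) i"] by blast
  qed
  then show ?thesis using subseq_diagseq by blast
qed

text \<open>Almost everywhere on each of countably many atoms every \<open>f k\<close> is a
  constant, so convergence almost everywhere is convergence of countably many sequences of vectors,
  which a diagonal argument achieves.\<close>

lemma purely_atomic_convergent_subsequence:
  fixes f :: "nat \<Rightarrow> 't \<Rightarrow> 'a::euclidean_space"
  assumes fin: "finite_measure N" and pa: "purely_atomic N"
    and f: "\<And>k. f k \<in> borel_measurable N" and bd: "\<And>k t. t \<in> space N \<Longrightarrow> norm (f k t) \<le> g t"
  shows "\<exists>r. strict_mono r \<and> (AE t in N. convergent (\<lambda>k. f (r k) t))"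
proof -
  interpret finite_measure N by fact
  obtain AA where AA: "countable AA" "\<And>A. A \<in> AA \<Longrightarrow> measure_atom N A" "AE t in N. t \<in> \<Union>AA"
    using purely_atomic_countable_atoms[OF fin pa] by blast
  show ?thesis
  proof (cases "AA = {}")
    case True
    then have "AE t in N. False" using AA(3) by simp
    then show ?thesis using strict_mono_id by (intro exI[of _ id]) auto
  next
    case False
    define A where "A = from_nat_into AA"
    have A: "range A = AA" using AA(1) False by (simp add: A_def range_from_nat_into)
    have atom: "measure_atom N (A i)" for i using A AA(2) by auto
    have ex: "\<exists>c. AE t in N. t \<in> A i \<longrightarrow> f k t = c" for i k by (rule measure_atom_constant[OF f atom fin])
    define c where "c k i = (SOME c. AE t in N. t \<in> A i \<longrightarrow> f k t = c)" for k i
    have c: "AE t in N. t \<in> A i \<longrightarrow> f k t = c k i" for i k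
      unfolding c_def by (rule someI_ex[OF ex])
    have c': "AE t in N. \<forall>k. t \<in> A i \<longrightarrow> f k t = c k i" for i
      by (subst AE_all_countable) (use c in blast)
    \<comment> \<open>A point at which all \<open>f k\<close> take their constants on
      \<open>A i\<close> turns the bound \<open>g\<close> into a bound on these constants that is
      independent of \<open>k\<close>.\<close>
    have "\<exists>t\<in>space N. \<forall>k. f k t = c k i" for i
    proof (rule ccontr)
      assume neg: "\<not> ?thesis"
      have "AE t in N. t \<notin> A i" using c'[of i] AE_space by eventually_elim (use neg in blast)
      moreover have "A i \<in> sets N" "emeasure N (A i) > 0" using atom[of i] by (auto simp: measure_atom_def)
      ultimately show False using AE_E2[of "\<lambda>t. t \<notin> A i" N] sets.sets_into_space[of "A i" N]
        by (simp add: Int_def[symmetric] Int_absorb1 Collect_conj_eq)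
    qed
    then obtain t where t: "\<And>i. t i \<in> space N" "\<And>i k. f k (t i) = c k i" by metis
    have "norm (c k i) \<le> g (t i)" for k i using bd[OF t(1)] t(2) by metis
    from diagonal_convergent_subsequence[of c, OF this]
    obtain r where r: "strict_mono r" "\<And>i. \<exists>l. (\<lambda>k. c (r k) i) \<longlonglongrightarrow> l" by blast
    have "AE t in N. \<forall>i. \<forall>k. t \<in> A i \<longrightarrow> f k t = c k i" using c' by (simp add: AE_all_countable)
    then have "AE t in N. convergent (\<lambda>k. f (r k) t)"
      using AA(3)
    proof eventually_elim
      case (elim t)
      then obtain i where "t \<in> A i" using A by blast
      then show ?case using elim r(2)[of i] by (simp add: convergent_def)
    qed
    then show ?thesis using r by blast
  qed
qed

text \<open>The atomic part comes first: on a subsequence the functions converge there, and the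
  limit is a cluster point. The nonatomic lemma is then applied along the same subsequence, so that
  the two selections fit together.\<close>

lemma Fatou_pointwise_bounded:
  fixes f :: "nat \<Rightarrow> 't \<Rightarrow> 'a::euclidean_space"
  assumes fin: "finite_measure M" and dec: "atomic_decomposition M Tpa Tna"
    and f: "\<And>k. f k \<in> borel_measurable M" and bd: "\<And>k t. t \<in> space M \<Longrightarrow> norm (f k t) \<le> g t"
    and g: "integrable M g" and lim: "(\<lambda>k. integral\<^sup>L M (f k)) \<longlonglongrightarrow> y"
  shows "y \<in> aumann_integral M (\<lambda>t. cluster_points (\<lambda>k. f k t))"
proof -
  interpret finite_measure M by fact
  define P where "P = density M (indicator Tpa :: 't \<Rightarrow> ennreal)"
  define Q where "Q = density M (indicator Tna :: 't \<Rightarrow> ennreal)"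
  have T: "Tpa \<in> sets M" "Tna \<in> sets M" "Tpa \<inter> Tna = {}" "Tpa \<union> Tna = space M"
    and pa: "purely_atomic P" and na: "nonatomic Q"
    using dec by (auto simp: atomic_decomposition_def P_def Q_def)
  have finPQ: "finite_measure (density M (indicator T :: 't \<Rightarrow> ennreal))" if "T \<in> sets M" for T
  proof
    have "emeasure (density M (indicator T)) (space M) = emeasure M T"
    proof -
      have "emeasure (density M (indicator T)) (space M) = (\<integral>\<^sup>+ t. indicator T t * indicator (space M) t \<partial>M)"
        using that by (intro emeasure_density) auto
      also have "\<dots> = (\<integral>\<^sup>+ t. indicator T t \<partial>M)" by (intro nn_integral_cong) simp
      finally show ?thesis using that by simp
    qed
    then show "emeasure (density M (indicator T)) (space (density M (indicator T))) \<noteq> \<infinity>"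
      using emeasure_finite by simp
  qed
  have ae: "(AE t in density M (indicator T :: 't \<Rightarrow> ennreal). R t) \<longleftrightarrow> (AE t in M. t \<in> T \<longrightarrow> R t)"
    if "T \<in> sets M" for T R
    using that by (subst AE_density) (auto simp: indicator_def)
  have dens: "density M (indicator T :: 't \<Rightarrow> ennreal) = density M (\<lambda>t. ennreal (indicator T t))" for T
    by (intro arg_cong[of _ _ "density M"]) (auto split: split_indicator)
  have int: "integrable (density M (indicator T :: 't \<Rightarrow> ennreal)) h \<longleftrightarrow> integrable M (\<lambda>t. indicator T t *\<^sub>R h t)"
    "integral\<^sup>L (density M (indicator T :: 't \<Rightarrow> ennreal)) h = (LINT t|M. indicator T t *\<^sub>R h t)"
    if "T \<in> sets M" "h \<in> borel_measurable M" for T and h :: "'t \<Rightarrow> 'b::euclidean_space"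
    unfolding dens using that by (intro integrable_density integral_density; auto)+
  have fi: "integrable M (f k)" for k
    using bd by (intro Bochner_Integration.integrable_bound[OF g f] AE_I2) (auto intro: order_trans[OF _ abs_ge_self])
  obtain r where r: "strict_mono r" "AE t in P. convergent (\<lambda>k. f (r k) t)"
    using purely_atomic_convergent_subsequence[of P f g] finPQ[OF T(1)] pa f bd by (auto simp: P_def)
  define u where "u t = lim (\<lambda>k. f (r k) t)" for t
  have um: "u \<in> borel_measurable M" unfolding u_def using f by measurable
  have cv: "AE t in M. t \<in> Tpa \<longrightarrow> (\<lambda>k. f (r k) t) \<longlonglongrightarrow> u t"
    using r(2) unfolding P_def ae[OF T(1)] by eventually_elim (auto simp: u_def convergent_LIMSEQ_iff)
  have ug: "AE t in M. t \<in> Tpa \<longrightarrow> norm (u t) \<le> g t"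
    using cv AE_space
  proof eventually_elim
    case (elim t)
    then show ?case using LIMSEQ_le_const2[OF tendsto_norm, of "\<lambda>k. f (r k) t" "u t" "g t"] bd[of t] by auto
  qed
  have ui: "integrable M (\<lambda>t. indicator Tpa t *\<^sub>R u t)"
    using um T ug by (intro Bochner_Integration.integrable_bound[OF g])
      (auto split: split_indicator elim!: eventually_mono intro: order_trans[OF _ abs_ge_self])
  have l1: "(\<lambda>k. LINT t|M. indicator Tpa t *\<^sub>R f (r k) t) \<longlonglongrightarrow> (LINT t|M. indicator Tpa t *\<^sub>R u t)"
  proof (rule integral_dominated_convergence[where w="\<lambda>t. \<bar>g t\<bar>"])
    show "AE t in M. (\<lambda>k. indicator Tpa t *\<^sub>R f (r k) t) \<longlonglongrightarrow> indicator Tpa t *\<^sub>R u t"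
      using cv by eventually_elim (auto split: split_indicator)
    show "AE t in M. norm (indicator Tpa t *\<^sub>R f (r k) t) \<le> \<bar>g t\<bar>" for k
      using bd by (auto split: split_indicator intro!: AE_I2 intro: order_trans[OF _ abs_ge_self])
  qed (use T f um g in auto)
  have l2: "(\<lambda>k. LINT t|M. f (r k) t) \<longlonglongrightarrow> y" using LIMSEQ_subseq_LIMSEQ[OF lim r(1)] by (simp add: o_def)
  have split: "(LINT t|M. indicator Tna t *\<^sub>R h t) = (LINT t|M. h t) - (LINT t|M. indicator Tpa t *\<^sub>R h t)"
    if "integrable M h" for h :: "'t \<Rightarrow> 'a"
  proof -
    have "(LINT t|M. h t) = (LINT t|M. indicator Tpa t *\<^sub>R h t + indicator Tna t *\<^sub>R h t)"
      using T by (intro Bochner_Integration.integral_cong) (auto split: split_indicator)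
    also have "\<dots> = (LINT t|M. indicator Tpa t *\<^sub>R h t) + (LINT t|M. indicator Tna t *\<^sub>R h t)"
      using that T by (intro Bochner_Integration.integral_add integrable_mult_indicator) auto
    finally show ?thesis by simp
  qed
  \<comment> \<open>What the nonatomic part must contribute: the limit of the full integrals minus
    that of the integrals over \<open>Tpa\<close>.\<close>
  define y' where "y' = y - (LINT t|M. indicator Tpa t *\<^sub>R u t)"
  have "(\<lambda>k. integral\<^sup>L Q (f (r k))) \<longlonglongrightarrow> y'"
    unfolding Q_def int(2)[OF T(2) f] split[OF fi] y'_def by (intro tendsto_diff l1 l2)
  then have "y' \<in> aumann_integral Q (\<lambda>t. cluster_points (\<lambda>k. f (r k) t))"
    using finPQ[OF T(2)] na f bd g integrable_mult_indicator[OF T(2) g] T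
    by (intro Fatou_nonatomic[where g=g]) (auto simp: Q_def int)
  then obtain v where v: "integrable Q v" "AE t in Q. v t \<in> cluster_points (\<lambda>k. f (r k) t)" "y' = integral\<^sup>L Q v"
    by (auto simp: aumann_integral_def)
  have vm: "v \<in> borel_measurable M" using borel_measurable_integrable[OF v(1)] by (simp add: Q_def)
  have vi: "integrable M (\<lambda>t. indicator Tna t *\<^sub>R v t)" using v(1) int(1)[OF T(2) vm] by (simp add: Q_def)
  define w where "w t = indicator Tpa t *\<^sub>R u t + indicator Tna t *\<^sub>R v t" for t
  have "integrable M w" unfolding w_def by (intro Bochner_Integration.integrable_add ui vi)
  moreover have "integral\<^sup>L M w = y"
    unfolding w_def Bochner_Integration.integral_add[OF ui vi]
    using v(3) int(2)[OF T(2) vm] by (simp add: Q_def y'_def diff_eq_eq add.commute)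
  moreover have "AE t in M. w t \<in> cluster_points (\<lambda>k. f k t)"
    using v(2) cv AE_space unfolding Q_def ae[OF T(2)]
  proof eventually_elim
    case (elim t)
    show ?case
    proof (cases "t \<in> Tpa")
      case True
      then have "t \<notin> Tna" using T(3) by auto
      then have "w t = u t" using True by (simp add: w_def)
      then show ?thesis using elim True r(1) by (auto simp: cluster_points_def)
    next
      case False
      then have "t \<in> Tna" using T elim by auto
      then have "w t = v t" using T False by (auto simp: w_def)
      then show ?thesis using elim \<open>t \<in> Tna\<close> cluster_points_subseq[OF r(1), of "\<lambda>k. f k t"] by auto
    qed
  qed
  ultimately show ?thesis by (auto simp: aumann_integral_def)
qed

text \<open>One null set serves all \<open>k\<close>. Setting the functions to zero there makes the
  bound hold everywhere and changes neither the integrals nor, almost everywhere, the cluster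
  points.\<close>

lemma Fatou_multivalued:
  fixes f :: "nat \<Rightarrow> 't \<Rightarrow> 'a::euclidean_space"
  assumes fin: "finite_measure M" and dec: "atomic_decomposition M Tpa Tna"
    and f: "\<And>k. f k \<in> borel_measurable M" and bd: "\<And>k. AE t in M. norm (f k t) \<le> g t"
    and g: "integrable M g" and lim: "(\<lambda>k. integral\<^sup>L M (f k)) \<longlonglongrightarrow> y"
  shows "y \<in> aumann_integral M (\<lambda>t. cluster_points (\<lambda>k. f k t))"
proof -
  have "AE t in M. \<forall>k. norm (f k t) \<le> g t" using bd by (simp add: AE_all_countable)
  from AE_E3[OF this] obtain Z where Z: "\<And>t. t \<in> space M - Z \<Longrightarrow> \<forall>k. norm (f k t) \<le> g t" "Z \<in> null_sets M"
    by blast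
  define f' where "f' k t = indicator (space M - Z) t *\<^sub>R f k t" for k t
  have Zs: "space M - Z \<in> sets M" using Z by auto
  have eq: "AE t in M. \<forall>k. f' k t = f k t"
    using AE_not_in[OF Z(2)] AE_space by eventually_elim (auto simp: f'_def)
  have f'm: "f' k \<in> borel_measurable M" for k
    unfolding f'_def by (intro borel_measurable_scaleR borel_measurable_indicator Zs f)
  have "integral\<^sup>L M (f' k) = integral\<^sup>L M (f k)" for k
    using eq by (intro integral_cong_AE f'm f) (auto elim: eventually_mono)
  then have lim': "(\<lambda>k. integral\<^sup>L M (f' k)) \<longlonglongrightarrow> y" using lim by simp
  have "norm (f' k t) \<le> indicator (space M - Z) t *\<^sub>R g t" if "t \<in> space M" for k t
    using Z(1)[of t] that by (auto simp: f'_def split: split_indicator)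
  then have "y \<in> aumann_integral M (\<lambda>t. cluster_points (\<lambda>k. f' k t))"
    by (intro Fatou_pointwise_bounded[OF fin dec f'm _ integrable_mult_indicator[OF Zs g] lim']) auto
  then obtain v where v: "integrable M v" "AE t in M. v t \<in> cluster_points (\<lambda>k. f' k t)" "y = integral\<^sup>L M v"
    by (auto simp: aumann_integral_def)
  have "AE t in M. v t \<in> cluster_points (\<lambda>k. f k t)" using v(2) eq by eventually_elim simp
  then show ?thesis using v by (auto simp: aumann_integral_def)
qed

section \<open>Normals and subgradients\<close>

text \<open>Division and punctured filter disappear because the inequality is trivial at
  \<open>u = z\<close>; isolated points are thereby included. Strictness is recovered by starting
  from \<open>e / 2\<close>.\<close>

lemma regular_normal_cone_iff:
  fixes z :: "'a::euclidean_space"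
  shows "w \<in> regular_normal_cone z \<Omega> \<longleftrightarrow>
    z \<in> \<Omega> \<and> (\<forall>e>0. \<exists>d>0. \<forall>u\<in>\<Omega>. norm (u - z) < d \<longrightarrow> w \<bullet> (u - z) \<le> e * norm (u - z))"
proof (cases "z \<in> \<Omega>")
  case True
  let ?f = "\<lambda>u. w \<bullet> (u - z) / norm (u - z)"
  have "w \<in> regular_normal_cone z \<Omega> \<longleftrightarrow> (\<forall>y>0. \<forall>\<^sub>F u in at z within \<Omega>. ereal (?f u) < y)"
    using True by (simp add: regular_normal_cone_def Limsup_le_iff)
  also have "\<dots> \<longleftrightarrow> (\<forall>e>0. \<forall>\<^sub>F u in at z within \<Omega>. ?f u < e)"
  proof (intro iffI allI impI)
    fix e :: real assume A: "\<forall>y>0. \<forall>\<^sub>F u in at z within \<Omega>. ereal (?f u) < y" and "e > 0"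
    show "\<forall>\<^sub>F u in at z within \<Omega>. ?f u < e" using A[rule_format, of "ereal e"] \<open>e > 0\<close> by simp
  next
    fix y :: ereal assume A: "\<forall>e>0. \<forall>\<^sub>F u in at z within \<Omega>. ?f u < e" and y: "y > 0"
    obtain e :: real where e: "0 < ereal e" "ereal e < y" using ereal_dense2[OF y] by auto
    have "\<forall>\<^sub>F u in at z within \<Omega>. ?f u < e" using A e by simp
    then show "\<forall>\<^sub>F u in at z within \<Omega>. ereal (?f u) < y"
      by eventually_elim (use e(2) in \<open>metis ereal_less(2) less_ereal.simps(1) less_trans\<close>)
  qed
  also have "\<dots> \<longleftrightarrow> (\<forall>e>0. \<exists>d>0. \<forall>u\<in>\<Omega>. norm (u - z) < d \<longrightarrow> w \<bullet> (u - z) \<le> e * norm (u - z))"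
  proof (intro iffI allI impI)
    fix e :: real assume A: "\<forall>e>0. \<forall>\<^sub>F u in at z within \<Omega>. ?f u < e" and e: "e > 0"
    obtain d where d: "d > 0" "\<And>u. u \<in> \<Omega> \<Longrightarrow> u \<noteq> z \<Longrightarrow> dist u z < d \<Longrightarrow> ?f u < e"
      using A[rule_format, OF e] unfolding eventually_at by auto
    show "\<exists>d>0. \<forall>u\<in>\<Omega>. norm (u - z) < d \<longrightarrow> w \<bullet> (u - z) \<le> e * norm (u - z)"
    proof (intro exI conjI ballI impI)
      fix u assume u: "u \<in> \<Omega>" "norm (u - z) < d"
      show "w \<bullet> (u - z) \<le> e * norm (u - z)"
      proof (cases "u = z")
        case False
        then have "?f u < e" using d(2)[OF u(1)] u(2) by (simp add: dist_norm)
        then show ?thesis using False by (simp add: divide_less_eq)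
      qed simp
    qed (rule d)
  next
    fix e :: real
    assume A: "\<forall>e>0. \<exists>d>0. \<forall>u\<in>\<Omega>. norm (u - z) < d \<longrightarrow> w \<bullet> (u - z) \<le> e * norm (u - z)" and e: "e > 0"
    obtain d where d: "d > 0" "\<And>u. u \<in> \<Omega> \<Longrightarrow> norm (u - z) < d \<Longrightarrow> w \<bullet> (u - z) \<le> (e/2) * norm (u - z)"
      using A[rule_format, of "e/2"] e by auto
    show "\<forall>\<^sub>F u in at z within \<Omega>. ?f u < e" unfolding eventually_at
    proof (intro exI conjI ballI impI)
      fix u assume u: "u \<in> \<Omega>" "u \<noteq> z \<and> dist u z < d"
      then have "w \<bullet> (u - z) \<le> e / 2 * norm (u - z)" using d(2)[of u] by (simp add: dist_norm)
      also have "\<dots> < e * norm (u - z)" using e u by (intro mult_strict_right_mono) auto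
      finally show "?f u < e" using u by (simp add: divide_less_eq)
    qed (rule d)
  qed
  finally show ?thesis using True by simp
qed (simp add: regular_normal_cone_def)

lemma regular_subset_limiting_normal_cone: "regular_normal_cone z \<Omega> \<subseteq> limiting_normal_cone z \<Omega>"
proof
  fix w assume "w \<in> regular_normal_cone z \<Omega>"
  then show "w \<in> limiting_normal_cone z \<Omega>" unfolding limiting_normal_cone_def
    by (intro CollectI exI[of _ "\<lambda>_. z"] exI[of _ "\<lambda>_. w"]) auto
qed

text \<open>For each \<open>k\<close> a regular normal within \<open>1 / Suc k\<close> of the given
  pair is chosen, in base point and in direction; this diagonal sequence has the same
  limits.\<close>

lemma limiting_normal_cone_closed:
  fixes z :: "'a::euclidean_space"
  assumes u: "u \<longlonglongrightarrow> z" and w: "v \<longlonglongrightarrow> w" and n: "\<And>k. v k \<in> limiting_normal_cone (u k) \<Omega>"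
  shows "w \<in> limiting_normal_cone z \<Omega>"
proof -
  have "\<exists>a b. dist a (u k) < 1 / real (Suc k) \<and> dist b (v k) < 1 / real (Suc k) \<and> b \<in> regular_normal_cone a \<Omega>" for k
  proof -
    obtain a b where ab: "a \<longlonglongrightarrow> u k" "b \<longlonglongrightarrow> v k" "\<And>j::nat. b j \<in> regular_normal_cone (a j) \<Omega>"
      using n[of k] by (auto simp: limiting_normal_cone_def)
    have "\<forall>\<^sub>F j in sequentially. dist (a j) (u k) < 1 / real (Suc k) \<and> dist (b j) (v k) < 1 / real (Suc k)"
      by (intro eventually_conj tendstoD[OF ab(1)] tendstoD[OF ab(2)]) auto
    then obtain j where "dist (a j) (u k) < 1 / real (Suc k) \<and> dist (b j) (v k) < 1 / real (Suc k)"
      by (auto simp: eventually_sequentially)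
    then show ?thesis using ab(3) by blast
  qed
  then obtain a b where ab: "\<And>k. dist (a k) (u k) < 1 / real (Suc k)" "\<And>k. dist (b k) (v k) < 1 / real (Suc k)"
    "\<And>k. b k \<in> regular_normal_cone (a k) \<Omega>" by metis
  have l0: "(\<lambda>k. 1 / real (Suc k)) \<longlonglongrightarrow> 0" using LIMSEQ_Suc[OF lim_const_over_n[of 1]] by simp
  have "a \<longlonglongrightarrow> z"
  proof (rule Lim_transform[OF u])
    show "(\<lambda>k. a k - u k) \<longlonglongrightarrow> 0"
      by (rule Lim_null_comparison[OF _ l0])
         (use ab(1) in \<open>auto simp: dist_norm norm_minus_commute intro!: always_eventually less_imp_le\<close>)
  qed
  moreover have "b \<longlonglongrightarrow> w"
  proof (rule Lim_transform[OF w])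
    show "(\<lambda>k. b k - v k) \<longlonglongrightarrow> 0"
      by (rule Lim_null_comparison[OF _ l0])
         (use ab(2) in \<open>auto simp: dist_norm norm_minus_commute intro!: always_eventually less_imp_le\<close>)
  qed
  ultimately show ?thesis using ab(3) by (auto simp: limiting_normal_cone_def)
qed

text \<open>Fermat rule over a set: minimality removes the difference of the values of
  \<open>h\<close>, and the remainder of the first-order expansion is exactly the error allowed to a
  regular normal.\<close>

lemma minimum_regular_normal:
  fixes z :: "'a::euclidean_space" and h :: "'a \<Rightarrow> real"
  assumes z: "z \<in> \<Omega>" and der: "(h has_derivative (\<lambda>d. g \<bullet> d)) (at z)"
    and d0: "d0 > 0" and min: "\<And>u. u \<in> \<Omega> \<Longrightarrow> norm (u - z) < d0 \<Longrightarrow> h z \<le> h u"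
  shows "- g \<in> regular_normal_cone z \<Omega>"
  unfolding regular_normal_cone_iff
proof (intro conjI allI impI z)
  fix e :: real assume "e > 0"
  then obtain d where d: "d > 0" "\<And>u. norm (u - z) < d \<Longrightarrow> norm (h u - h z - g \<bullet> (u - z)) \<le> e * norm (u - z)"
    using der unfolding has_derivative_at_alt by blast
  show "\<exists>d>0. \<forall>u\<in>\<Omega>. norm (u - z) < d \<longrightarrow> - g \<bullet> (u - z) \<le> e * norm (u - z)"
  proof (intro exI[of _ "min d d0"] conjI ballI impI)
    fix u assume u: "u \<in> \<Omega>" "norm (u - z) < min d d0"
    then have "h z \<le> h u" "\<bar>h u - h z - g \<bullet> (u - z)\<bar> \<le> e * norm (u - z)" using min d(2) by auto
    then show "- g \<bullet> (u - z) \<le> e * norm (u - z)" by simp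
  qed (use d d0 in auto)
qed

section \<open>Lower semicontinuous functions and their subgradients\<close>

lemma lsc_open_superlevel:
  assumes "lsc \<psi>" shows "open {x. c < \<psi> x}"
  unfolding open_subopen[of "{x. c < \<psi> x}"]
proof
  fix x assume "x \<in> {x. c < \<psi> x}"
  then have x: "c < \<psi> x" by simp
  then have "\<forall>\<^sub>F y in at x. c < \<psi> y" using assms unfolding lsc_def le_Liminf_iff by blast
  then have "\<forall>\<^sub>F y in nhds x. c < \<psi> y" using x unfolding eventually_at_filter by (auto elim: eventually_mono)
  then show "\<exists>T. open T \<and> x \<in> T \<and> T \<subseteq> {x. c < \<psi> x}" unfolding eventually_nhds by auto
qed

text \<open>Sublevel sets at the levels reached on \<open>K\<close> are closed and nested, so
  compactness gives a point in all of them. The separate summand \<open>h\<close> carries the smooth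
  penalties of later uses.\<close>

lemma lsc_attains_minimum:
  fixes \<psi> :: "'a::euclidean_space \<Rightarrow> ereal" and h :: "'a \<Rightarrow> real"
  assumes lsc: "lsc \<psi>" and nm: "\<And>x. \<psi> x \<noteq> -\<infinity>" and h: "continuous_on UNIV h" and K: "compact K" "K \<noteq> {}"
  shows "\<exists>x\<in>K. \<forall>u\<in>K. \<psi> x + ereal (h x) \<le> \<psi> u + ereal (h u)"
proof -
  let ?f = "\<lambda>x. \<psi> x + ereal (h x)"
  have op: "open {x. ereal c < ?f x}" for c
  proof -
    have "{x. ereal c < ?f x} = (\<Union>q::real. {x. ereal q < \<psi> x} \<inter> {x. c - h x < q})"
    proof (intro set_eqI iffI)
      fix x assume "x \<in> {x. ereal c < ?f x}"
      then have "ereal (c - h x) < \<psi> x" using nm[of x] by (cases "\<psi> x") auto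
      then obtain q where "ereal (c - h x) < ereal q" "ereal q < \<psi> x" using ereal_dense2 by blast
      then show "x \<in> (\<Union>q::real. {x. ereal q < \<psi> x} \<inter> {x. c - h x < q})" by auto
    next
      fix x assume "x \<in> (\<Union>q::real. {x. ereal q < \<psi> x} \<inter> {x. c - h x < q})"
      then show "x \<in> {x. ereal c < ?f x}" using nm[of x] by (cases "\<psi> x") auto
    qed
    also have "open \<dots>"
      by (intro open_UN ballI open_Int lsc_open_superlevel lsc open_Collect_less continuous_intros h)
    finally show ?thesis .
  qed
  have cl: "closed {x. ?f x \<le> ereal c}" for c
    using op[of c] by (simp add: closed_def Collect_neg_eq[symmetric] not_le)
  show ?thesis
  proof (cases "\<forall>u\<in>K. ?f u = \<infinity>")
    case True
    then show ?thesis using K by auto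
  next
    case False
    define C where "C = {c::real. \<exists>u\<in>K. ?f u \<le> ereal c}"
    have real: "\<exists>c. ?f u = ereal c" if "?f u \<noteq> \<infinity>" for u using that nm[of u] by (cases "\<psi> u") auto
    have "K \<inter> (\<Inter>c\<in>C. {x. ?f x \<le> ereal c}) \<noteq> {}"
    proof (rule compact_imp_fip_image[OF K(1)])
      fix I' assume I': "finite I'" "I' \<subseteq> C"
      show "K \<inter> (\<Inter>c\<in>I'. {x. ?f x \<le> ereal c}) \<noteq> {}"
      proof (cases "I' = {}")
        case True then show ?thesis using K by auto
      next
        case False
        then have "Min I' \<in> C" using I' Min_in by blast
        then obtain u where u: "u \<in> K" "?f u \<le> ereal (Min I')" by (auto simp: C_def)
        then have "?f u \<le> ereal c" if "c \<in> I'" for c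
          using Min_le[OF I'(1) that] by (meson ereal_less_eq(3) order_trans)
        then show ?thesis using u by blast
      qed
    qed (rule cl)
    then obtain x where x: "x \<in> K" "\<And>c. c \<in> C \<Longrightarrow> ?f x \<le> ereal c" by auto
    have "?f x \<le> ?f u" if u: "u \<in> K" for u
    proof (cases "?f u = \<infinity>")
      case False
      then obtain c where "?f u = ereal c" using real by blast
      moreover from this have "c \<in> C" unfolding C_def using u by (auto intro!: bexI[of _ u])
      ultimately show ?thesis using x(2)[of c] by simp
    qed simp
    then show ?thesis using x(1) by blast
  qed
qed

text \<open>Fermat rule on the epigraph: the minimum of \<open>\<psi> + h\<close> becomes a minimum
  of \<open>h (fst z) + snd z\<close>, which is differentiable, over
  \<open>epi \<psi>\<close>.\<close>

lemma minimum_subgradient: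
  fixes \<psi> :: "'a::euclidean_space \<Rightarrow> ereal" and h :: "'a \<Rightarrow> real"
  assumes fin: "\<bar>\<psi> x\<bar> \<noteq> \<infinity>" and der: "(h has_derivative (\<lambda>d. g \<bullet> d)) (at x)" and d: "d > 0"
    and min: "\<And>u. norm (u - x) < d \<Longrightarrow> \<psi> x + ereal (h x) \<le> \<psi> u + ereal (h u)"
  shows "- g \<in> subdiff \<psi> x"
proof -
  obtain r where r: "\<psi> x = ereal r" using fin by (cases "\<psi> x") auto
  let ?H = "\<lambda>z::'a \<times> real. h (fst z) + snd z"
  have der': "(h has_derivative (\<lambda>d. g \<bullet> d)) (at (fst (x, r)))" using der by simp
  have "(?H has_derivative (\<lambda>d. g \<bullet> fst d + snd d)) (at (x, r))"
    by (intro derivative_intros has_derivative_compose[OF has_derivative_fst[OF has_derivative_ident] der', unfolded fst_conv])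
  then have derH: "(?H has_derivative (\<lambda>d. (g, 1) \<bullet> d)) (at (x, r))" by (simp add: inner_prod_def)
  have "- (g, 1::real) \<in> regular_normal_cone (x, r) (epi \<psi>)"
  proof (rule minimum_regular_normal[OF _ derH d])
    show "(x, r) \<in> epi \<psi>" by (simp add: epi_def r)
    fix z assume z: "z \<in> epi \<psi>" "norm (z - (x, r)) < d"
    obtain u a where ua: "z = (u, a)" by (cases z)
    have "norm (u - x) \<le> norm (z - (x, r))" using norm_fst_le[of "u - x" "a - r"] by (simp add: ua)
    then have "ereal (r + h x) \<le> \<psi> u + ereal (h u)" using min[of u] z(2) by (simp add: r)
    also have "\<dots> \<le> ereal a + ereal (h u)" using z(1) by (intro add_right_mono) (auto simp: epi_def ua)
    finally show "?H (x, r) \<le> ?H z" by (simp add: ua)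
  qed
  then have "(- g, -1) \<in> limiting_normal_cone (x, r) (epi \<psi>)"
    using regular_subset_limiting_normal_cone[of "(x, r)" "epi \<psi>"] by auto
  then show ?thesis by (simp add: subdiff_def r)
qed

text \<open>Exact penalisation: a minimiser of \<open>\<psi>\<close> plus a steep cone with vertex
  \<open>u\<close> must be \<open>u\<close> itself, since anywhere else in the open ball the penalty
  would force a subgradient longer than \<open>\<kappa>\<close>. Comparing values bounds
  \<open>\<psi>\<close> at \<open>u\<close> by its other values plus a term that vanishes at
  \<open>u\<close>.\<close>

lemma bounded_subgradients_continuous:
  fixes \<psi> :: "'a::euclidean_space \<Rightarrow> ereal"
  assumes lsc: "lsc \<psi>" and nm: "\<And>x. \<psi> x \<noteq> -\<infinity>" and fin: "\<bar>\<psi> x0\<bar> \<noteq> \<infinity>" and rho: "\<rho> > 0"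
    and bd: "\<And>x. x \<in> cball x0 \<rho> \<Longrightarrow> subdiff \<psi> x \<subseteq> cball 0 \<kappa>"
  shows "\<forall>x\<in>ball x0 (\<rho>/4). \<bar>\<psi> x\<bar> \<noteq> \<infinity>" "continuous_on (ball x0 (\<rho>/4)) (\<lambda>x. real_of_ereal (\<psi> x))"
proof -
  obtain r0 where r0: "\<psi> x0 = ereal r0" using fin by (cases "\<psi> x0") auto
  obtain xm where xm: "xm \<in> cball x0 \<rho>" "\<And>u. u \<in> cball x0 \<rho> \<Longrightarrow> \<psi> xm \<le> \<psi> u"
    using lsc_attains_minimum[OF lsc nm, of "\<lambda>_. 0" "cball x0 \<rho>"] rho by auto
  obtain m where m: "\<And>u. u \<in> cball x0 \<rho> \<Longrightarrow> ereal m \<le> \<psi> u"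
  proof -
    have "\<psi> xm \<le> ereal r0" using xm(2)[of x0] rho by (simp add: r0)
    then obtain m where "\<psi> xm = ereal m" using nm[of xm] by (cases "\<psi> xm") auto
    then show ?thesis using xm(2) that by auto
  qed
  \<comment> \<open>The slope \<open>k\<close> exceeds the length of all subgradients. The quadratic
    coefficient \<open>c\<close> is so large that a point at distance at least
    \<open>3 * \<rho> / 4\<close> from \<open>u\<close> costs more than \<open>x0\<close>, at
    distance below \<open>\<rho> / 4\<close>, whatever \<open>\<psi>\<close> gains between
    \<open>r0\<close> and \<open>m\<close>; the minimiser is then interior.\<close>
  define k where "k = \<bar>\<kappa>\<bar> + 1"
  define c where "c = (\<bar>r0 - m\<bar> + 1 + k * (\<rho>/4)) / (\<rho>^2 / 4)"
  have k0: "k > 0" by (simp add: k_def)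
  then have "0 < \<bar>r0 - m\<bar> + 1 + k * (\<rho>/4)" using mult_pos_pos[of k "\<rho>/4"] rho by linarith
  then have kc: "k > 0" "c > 0" using rho k0 by (auto simp: c_def)
  let ?h = "\<lambda>u x. k * norm (x - u) + c * (norm (x - u))^2"
  have key: "\<psi> u \<le> \<psi> x + ereal (?h u x)" if u: "u \<in> ball x0 (\<rho>/4)" and x: "x \<in> cball x0 \<rho>" for u x
  proof -
    have cont: "continuous_on UNIV (?h u)" by (intro continuous_intros)
    obtain y where y: "y \<in> cball x0 \<rho>" "\<And>v. v \<in> cball x0 \<rho> \<Longrightarrow> \<psi> y + ereal (?h u y) \<le> \<psi> v + ereal (?h u v)"
      using lsc_attains_minimum[OF lsc nm cont, of "cball x0 \<rho>"] rho by auto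
    have u0: "norm (x0 - u) < \<rho> / 4" using u by (simp add: dist_norm)
    have "\<psi> y + ereal (?h u y) \<le> ereal (r0 + ?h u x0)" using y(2)[of x0] rho r0 by simp
    then obtain ry where ry: "\<psi> y = ereal ry" "ry + ?h u y \<le> r0 + ?h u x0" using nm[of y] by (cases "\<psi> y") auto
    have my: "m \<le> ry" using m[OF y(1)] ry by simp
    have "y \<in> ball x0 \<rho>"
    proof (rule ccontr)
      assume "y \<notin> ball x0 \<rho>"
      then have "\<rho> \<le> norm (y - x0)" by (simp add: dist_norm norm_minus_commute)
      also have "\<dots> \<le> norm (y - u) + norm (x0 - u)" using norm_triangle_ineq4[of "y - u" "x0 - u"] by simp
      finally have yu: "3 * \<rho> / 4 \<le> norm (y - u)" using u0 by simp
      have "(3 * \<rho> / 4)^2 \<le> (norm (y - u))^2" using yu rho by (intro power_mono) auto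
      then have 1: "c * (9 * \<rho>^2 / 16) \<le> c * (norm (y - u))^2" using kc by (intro mult_left_mono) (auto simp: power2_eq_square)
      have "(norm (x0 - u))^2 \<le> (\<rho> / 4)^2" using u0 by (intro power_mono) auto
      then have 2: "c * (norm (x0 - u))^2 \<le> c * (\<rho>^2 / 16)" using kc by (intro mult_left_mono) (auto simp: power2_eq_square)
      have 3: "k * norm (x0 - u) \<le> k * (\<rho> / 4)" using u0 kc by (intro mult_left_mono) auto
      have 4: "0 \<le> k * norm (y - u)" using kc by simp
      have "ry + c * (9 * \<rho>^2 / 16) \<le> r0 + (k * (\<rho> / 4) + c * (\<rho>^2 / 16))"
        using 1 2 3 4 ry(2) by linarith
      then have "c * (\<rho>^2 / 4) \<le> \<bar>r0 - m\<bar> + k * (\<rho> / 4) - c * (\<rho>^2 / 4)"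
      proof -
        have "c * (9 * \<rho>^2 / 16) = 9 / 4 * (c * (\<rho>^2 / 4))" "c * (\<rho>^2 / 16) = 1 / 4 * (c * (\<rho>^2 / 4))" by simp_all
        with \<open>ry + c * (9 * \<rho>^2 / 16) \<le> r0 + (k * (\<rho> / 4) + c * (\<rho>^2 / 16))\<close>
        show ?thesis using my by linarith
      qed
      moreover have "c * (\<rho>^2 / 4) = \<bar>r0 - m\<bar> + 1 + k * (\<rho>/4)" using rho by (simp add: c_def)
      moreover have "0 \<le> c * (\<rho>^2 / 4)" using kc by simp
      ultimately show False by linarith
    qed
    then obtain d where d: "d > 0" "\<And>v. norm (v - y) < d \<Longrightarrow> v \<in> cball x0 \<rho>"
      using open_ball[of x0 \<rho>] unfolding open_dist
      by (metis ball_subset_cball dist_norm subsetD)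
    have "y = u"
    proof (rule ccontr)
      assume ne: "y \<noteq> u"
      let ?g = "k *\<^sub>R sgn (y - u) + (2 * c) *\<^sub>R (y - u)"
      have "((\<lambda>x. norm (x - u)) has_derivative (\<lambda>d. sgn (y - u) \<bullet> d)) (at y)"
      proof -
        have "(norm has_derivative (\<lambda>d. d \<bullet> sgn (y - u))) (at (y - u))" using has_derivative_norm[of "y - u"] ne by simp
        from has_derivative_compose[OF has_derivative_diff[OF has_derivative_ident has_derivative_const] this]
        show ?thesis by (simp add: inner_commute)
      qed
      from has_derivative_add[OF has_derivative_mult_right[OF this, of k]]
      have "(?h u has_derivative (\<lambda>d. ?g \<bullet> d)) (at y)"
        unfolding power2_norm_eq_inner
        by (rule has_derivative_eq_rhs) (auto intro!: derivative_eq_intros simp: inner_add_left inner_commute algebra_simps fun_eq_iff)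
      then have "- ?g \<in> subdiff \<psi> y"
        using ry y(2) d by (intro minimum_subgradient[OF _ _ d(1)]) auto
      then have "- ?g \<in> cball 0 \<kappa>" using bd[OF y(1)] by (rule rev_subsetD)
      then have "norm ?g \<le> \<kappa>" by (simp only: mem_cball_0 norm_minus_cancel)
      moreover have geq: "?g = (k / norm (y - u) + 2 * c) *\<^sub>R (y - u)"
        by (simp add: sgn_div_norm algebra_simps divide_inverse)
      have "norm ?g = k + 2 * c * norm (y - u)"
      proof -
        have "norm ?g = (k / norm (y - u) + 2 * c) * norm (y - u)"
          unfolding geq norm_scaleR using kc by (simp add: abs_of_nonneg add_nonneg_nonneg)
        also have "\<dots> = k + 2 * c * norm (y - u)" using ne by (simp add: distrib_right)
        finally show ?thesis .
      qed
      moreover have "0 \<le> 2 * c * norm (y - u)" using kc by simp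
      ultimately show False by (simp add: k_def)
    qed
    then show ?thesis using y(2)[OF x] by simp
  qed
  have xb: "ball x0 (\<rho>/4) \<subseteq> cball x0 \<rho>" using rho by auto
  show fin': "\<forall>x\<in>ball x0 (\<rho>/4). \<bar>\<psi> x\<bar> \<noteq> \<infinity>"
  proof
    fix u assume "u \<in> ball x0 (\<rho>/4)"
    then have "\<psi> u \<le> ereal (r0 + ?h u x0)" using key[of u x0] rho by (simp add: r0)
    then show "\<bar>\<psi> u\<bar> \<noteq> \<infinity>" using nm[of u] by (cases "\<psi> u") auto
  qed
  let ?r = "\<lambda>x. real_of_ereal (\<psi> x)"
  have le: "?r u \<le> ?r x + ?h u x" if "u \<in> ball x0 (\<rho>/4)" "x \<in> ball x0 (\<rho>/4)" for u x
  proof -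
    have "\<psi> u = ereal (?r u)" "\<psi> x = ereal (?r x)" using fin' that by (simp_all add: ereal_real')
    moreover have "\<psi> u \<le> \<psi> x + ereal (?h u x)" using key[OF that(1)] that(2) xb by blast
    ultimately have "ereal (?r u) \<le> ereal (?r x + ?h u x)" by (metis plus_ereal.simps(1))
    then show ?thesis by simp
  qed
  show "continuous_on (ball x0 (\<rho>/4)) ?r"
    unfolding continuous_on_def
  proof
    fix x assume x: "x \<in> ball x0 (\<rho>/4)"
    have "((\<lambda>u. ?r u - ?r x) \<longlongrightarrow> 0) (at x within ball x0 (\<rho>/4))"
    proof (rule Lim_null_comparison)
      show "\<forall>\<^sub>F u in at x within ball x0 (\<rho>/4). norm (?r u - ?r x) \<le> ?h u x"
        unfolding eventually_at_filter
      proof (intro always_eventually allI impI)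
        fix u assume "u \<in> ball x0 (\<rho>/4)"
        then show "norm (?r u - ?r x) \<le> ?h u x" using le[of u x] le[of x u] x by (simp add: norm_minus_commute abs_le_iff)
      qed
      have "((\<lambda>u. ?h u x) \<longlongrightarrow> ?h x x) (at x within ball x0 (\<rho>/4))" by (intro tendsto_intros)
      then show "((\<lambda>u. ?h u x) \<longlongrightarrow> 0) (at x within ball x0 (\<rho>/4))" by simp
    qed
    then show "(?r \<longlongrightarrow> ?r x) (at x within ball x0 (\<rho>/4))" using Lim_null[of ?r] by blast
  qed
qed

text \<open>Limits of normals to the epigraph require the heights of the base points to converge as
  well, hence the condition \<open>c\<close>; continuity near \<open>xbar\<close> will supply
  it.\<close>

lemma subdiff_closed_graph:
  fixes \<psi> :: "'a::euclidean_space \<Rightarrow> ereal"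
  assumes fin: "\<bar>\<psi> x\<bar> \<noteq> \<infinity>" and x: "X \<longlonglongrightarrow> x" and y: "Y \<longlonglongrightarrow> y" and Y: "\<And>k. Y k \<in> subdiff \<psi> (X k)"
    and c: "(\<lambda>k. real_of_ereal (\<psi> (X k))) \<longlonglongrightarrow> real_of_ereal (\<psi> x)"
  shows "y \<in> subdiff \<psi> x"
proof -
  have "(Y k, -1) \<in> limiting_normal_cone (X k, real_of_ereal (\<psi> (X k))) (epi \<psi>)" for k
    using Y[of k] by (simp add: subdiff_def split: if_splits)
  then have "(y, -1) \<in> limiting_normal_cone (x, real_of_ereal (\<psi> x)) (epi \<psi>)"
    by (intro limiting_normal_cone_closed[OF tendsto_Pair[OF x c] tendsto_Pair[OF y tendsto_const]])
  then show ?thesis using fin by (simp add: subdiff_def)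
qed

text \<open>A negative last component forces the base point down to the graph of \<open>g\<close>,
  and division by \<open>l\<close> turns the normal inequality into a first-order minorant of
  \<open>g\<close>. The difficulty is that the error term contains the increment of \<open>g\<close>
  itself.\<close>

lemma regular_normal_epi_inequality:
  fixes \<psi> :: "'a::euclidean_space \<Rightarrow> ereal"
  assumes U: "open U" "x \<in> U" and g: "\<And>u. u \<in> U \<Longrightarrow> \<psi> u = ereal (g u)" and cont: "continuous_on U g"
    and n: "(y, - l) \<in> regular_normal_cone (x, a) (epi \<psi>)" and l: "l > 0"
  shows "\<forall>e>0. \<exists>d>0. \<forall>u. norm (u - x) < d \<longrightarrow> u \<in> U \<and> g u \<ge> g x + (y /\<^sub>R l) \<bullet> (u - x) - e * norm (u - x)"
proof -
  have reg: "(x, a) \<in> epi \<psi>" "\<And>e. e > 0 \<Longrightarrow> \<exists>d>0. \<forall>z\<in>epi \<psi>. norm (z - (x, a)) < d \<longrightarrow>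
      (y, - l) \<bullet> (z - (x, a)) \<le> e * norm (z - (x, a))"
    using n unfolding regular_normal_cone_iff by blast+
  have gx: "g x \<le> a" using reg(1) g[OF U(2)] by (simp add: epi_def)
  have a: "a = g x"
  proof (rule ccontr)
    assume "a \<noteq> g x"
    then have lt: "g x < a" using gx by simp
    obtain d where d: "d > 0" "\<forall>z\<in>epi \<psi>. norm (z - (x, a)) < d \<longrightarrow>
      (y, - l) \<bullet> (z - (x, a)) \<le> (l/2) * norm (z - (x, a))" using reg(2)[of "l/2"] l by auto
    \<comment> \<open>Descending by \<open>s\<close> stays in the epigraph and increases the product
      with the normal by \<open>l * s\<close>, twice the error allowed with tolerance
      \<open>l / 2\<close>.\<close>
    define s where "s = min (d/2) (a - g x)"
    have s: "s > 0" "s < d" "g x \<le> a - s" using d lt by (auto simp: s_def)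
    have "(x, a - s) \<in> epi \<psi>" using s g[OF U(2)] by (simp add: epi_def)
    moreover have "norm ((x, a - s) - (x, a)) = s" using s by (simp add: norm_Pair)
    ultimately have "(y, - l) \<bullet> ((x, a - s) - (x, a)) \<le> (l/2) * s" using d(2) s by metis
    then show False using l s by (simp add: inner_prod_def)
  qed
  show ?thesis
  proof (intro allI impI)
    fix e :: real assume e: "e > 0"
    \<comment> \<open>With tolerance at most \<open>l / 2\<close> the increment \<open>D\<close> is
      bounded by \<open>(2 / l) * (l + norm y) * norm (u - x)\<close> in the case that matters, so
      the total error is at most \<open>e1 * c * norm (u - x)\<close>.\<close>
    define c where "c = 1 + (2 / l) * (l + norm y)"
    have c: "c > 0" using l by (auto simp: c_def intro!: add_pos_nonneg)
    define e1 where "e1 = min (l/2) (e * l / c)"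
    have e1: "e1 > 0" "e1 \<le> l / 2" "e1 * c \<le> e * l" using l e c by (auto simp: e1_def min_def field_simps)
    obtain d1 where d1: "d1 > 0" "\<forall>z\<in>epi \<psi>. norm (z - (x, a)) < d1 \<longrightarrow>
      (y, - l) \<bullet> (z - (x, a)) \<le> e1 * norm (z - (x, a))" using reg(2)[OF e1(1)] by auto
    obtain d2 where d2: "d2 > 0" "ball x d2 \<subseteq> U" using U openE by blast
    have "isCont g x" using cont U by (simp add: continuous_on_eq_continuous_at)
    then obtain d3 where d3: "d3 > 0" "\<And>u. dist u x < d3 \<Longrightarrow> dist (g u) (g x) < d1 / 2"
      using d1(1) unfolding continuous_at_eps_delta by (metis half_gt_zero)
    show "\<exists>d>0. \<forall>u. norm (u - x) < d \<longrightarrow> u \<in> U \<and> g u \<ge> g x + (y /\<^sub>R l) \<bullet> (u - x) - e * norm (u - x)"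
    proof (intro exI[of _ "min (d1/2) (min d2 d3)"] conjI allI impI)
      fix u assume u: "norm (u - x) < min (d1/2) (min d2 d3)"
      then show uU: "u \<in> U" using d2 by (auto simp: dist_norm norm_minus_commute)
      define D where "D = g u - g x"
      have Dd: "\<bar>D\<bar> < d1 / 2" using d3(2)[of u] u by (simp add: dist_norm D_def)
      have nle: "norm ((u, g u) - (x, a)) \<le> norm (u - x) + \<bar>D\<bar>"
        using norm_Pair_le[of "u - x" "g u - g x"] by (simp add: a D_def)
      have "(u, g u) \<in> epi \<psi>" using g[OF uU] by (simp add: epi_def)
      then have "(y, - l) \<bullet> ((u, g u) - (x, a)) \<le> e1 * norm ((u, g u) - (x, a))"
        using d1(2) nle Dd u by auto
      also have "\<dots> \<le> e1 * (norm (u - x) + \<bar>D\<bar>)" using nle e1 by (intro mult_left_mono) auto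
      finally have main: "y \<bullet> (u - x) - l * D \<le> e1 * norm (u - x) + e1 * \<bar>D\<bar>"
        by (simp add: inner_prod_def a D_def algebra_simps)
      have cs: "\<bar>y \<bullet> (u - x)\<bar> \<le> norm y * norm (u - x)" by (rule Cauchy_Schwarz_ineq2)
      have "y \<bullet> (u - x) - e * l * norm (u - x) \<le> l * D"
      proof (cases "y \<bullet> (u - x) \<le> l * D")
        case True
        moreover have "0 \<le> e * l * norm (u - x)" using e l by simp
        ultimately show ?thesis by linarith
      next
        case False
        have "\<bar>D\<bar> \<le> (2 / l) * (l + norm y) * norm (u - x)"
        proof (cases "D \<ge> 0")
          case True
          have "l * D \<le> norm y * norm (u - x)" using False cs by linarith
          then have "D \<le> norm y * norm (u - x) / l" using l by (simp add: field_simps)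
          also have "\<dots> = (1 / l) * (norm y * norm (u - x))" by simp
          also have "\<dots> \<le> (2 / l) * ((l + norm y) * norm (u - x))"
            using l by (intro mult_mono divide_right_mono mult_right_mono) auto
          finally show ?thesis using True by (simp only: abs_of_nonneg mult.assoc)
        next
          case False
          have "e1 * (- D) \<le> l / 2 * (- D)" using False e1 by (intro mult_right_mono) auto
          moreover have "- (norm y * norm (u - x)) - l * D \<le> e1 * norm (u - x) + e1 * (- D)"
            using main cs False by simp
          moreover have "e1 * norm (u - x) \<le> l * norm (u - x)" using e1 l by (intro mult_right_mono) auto
          ultimately have "(l / 2) * (- D) \<le> (l + norm y) * norm (u - x)" by (simp add: algebra_simps)
          then have "- D \<le> (l + norm y) * norm (u - x) / (l / 2)" using l by (simp add: field_simps)
          also have "\<dots> = (2 / l) * (l + norm y) * norm (u - x)" by simp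
          finally show ?thesis using False by simp
        qed
        then have "e1 * \<bar>D\<bar> \<le> e1 * ((2 / l) * (l + norm y) * norm (u - x))" using e1 by (intro mult_left_mono) auto
        then have "y \<bullet> (u - x) - l * D \<le> e1 * c * norm (u - x)" using main by (simp add: c_def algebra_simps)
        also have "\<dots> \<le> e * l * norm (u - x)" using e1 by (intro mult_right_mono) auto
        finally show ?thesis by simp
      qed
      then have "(y \<bullet> (u - x) - e * l * norm (u - x)) / l \<le> D" using l by (simp add: divide_le_eq mult.commute)
      moreover have "(y \<bullet> (u - x) - e * l * norm (u - x)) / l = (y /\<^sub>R l) \<bullet> (u - x) - e * norm (u - x)"
      proof -
        have "(y \<bullet> (u - x) - e * l * norm (u - x)) / l = (y \<bullet> (u - x)) / l - e * norm (u - x)"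
          using l by (simp add: diff_divide_distrib)
        then show ?thesis by (simp add: divide_inverse mult.commute)
      qed
      ultimately show "g u \<ge> g x + (y /\<^sub>R l) \<bullet> (u - x) - e * norm (u - x)"
        unfolding D_def by linarith
    qed (use d1 d2 d3 in auto)
  qed
qed

text \<open>Countable description, forward half: near a limiting subgradient there is a regular one,
  whose minorant holds on a small ball. Continuity of \<open>g\<close> leaves room to move the base
  point into \<open>D\<close> and the slope by \<open>e / 8\<close>, at a total error of
  \<open>e\<close> times the radius \<open>1 / n\<close>.\<close>

lemma subgradient_approximation:
  fixes \<psi> :: "'a::euclidean_space \<Rightarrow> ereal"
  assumes U: "open U" "x \<in> U" and g: "\<And>u. u \<in> U \<Longrightarrow> \<psi> u = ereal (g u)" and cont: "continuous_on U g"
    and y: "y \<in> subdiff \<psi> x" and e: "e > 0"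
    and D: "\<And>S :: 'a set. open S \<Longrightarrow> S \<noteq> {} \<Longrightarrow> \<exists>d\<in>D. d \<in> S"
  shows "\<exists>x'\<in>D. \<exists>y1. \<exists>n::nat. dist x' x < e \<and> dist y1 y < e \<and> n > 0 \<and> 1 / real n < e \<and>
     (\<forall>y'. dist y' y1 < e/8 \<longrightarrow> (\<forall>u\<in>ball x' (1 / real n). u \<in> U \<and> g u \<ge> g x' + y' \<bullet> (u - x') - e / real n))"
proof -
  have "(y, -1) \<in> limiting_normal_cone (x, real_of_ereal (\<psi> x)) (epi \<psi>)"
    using y by (simp add: subdiff_def split: if_splits)
  then obtain a b where ab: "a \<longlonglongrightarrow> (x, real_of_ereal (\<psi> x))" "b \<longlonglongrightarrow> (y, -1)"
      "\<And>k::nat. b k \<in> regular_normal_cone (a k) (epi \<psi>)"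
    by (auto simp: limiting_normal_cone_def)
  have fa: "(\<lambda>k. fst (a k)) \<longlonglongrightarrow> x" using tendsto_fst[OF ab(1)] by simp
  have fb: "(\<lambda>k. fst (b k)) \<longlonglongrightarrow> y" "(\<lambda>k. - snd (b k)) \<longlonglongrightarrow> 1"
    using tendsto_fst[OF ab(2)] tendsto_minus[OF tendsto_snd[OF ab(2)]] by simp_all
  have fc: "(\<lambda>k. fst (b k) /\<^sub>R (- snd (b k))) \<longlonglongrightarrow> y /\<^sub>R 1"
    by (intro tendsto_scaleR tendsto_inverse fb) simp
  have "\<forall>\<^sub>F k in sequentially. fst (a k) \<in> U \<and> dist (fst (a k)) x < e / 2 \<and> 0 < - snd (b k) \<and>
      dist (fst (b k) /\<^sub>R (- snd (b k))) (y /\<^sub>R 1) < e"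
    by (intro eventually_conj topological_tendstoD[OF fa] U tendstoD[OF fa] order_tendstoD(1)[OF fb(2)] tendstoD[OF fc])
       (use e in auto)
  then obtain k where k: "fst (a k) \<in> U" "dist (fst (a k)) x < e / 2" "0 < - snd (b k)"
      "dist (fst (b k) /\<^sub>R (- snd (b k))) y < e"
    by (auto simp: eventually_sequentially)
  define x0 where "x0 = fst (a k)"
  define y1 where "y1 = fst (b k) /\<^sub>R (- snd (b k))"
  have "(fst (b k), - (- snd (b k))) \<in> regular_normal_cone (x0, snd (a k)) (epi \<psi>)"
    using ab(3)[of k] by (simp add: x0_def)
  from regular_normal_epi_inequality[OF U(1) _ g cont this k(3)] k(1) e
  obtain d where d: "d > 0" "\<And>u. norm (u - x0) < d \<Longrightarrow> u \<in> U \<and> g u \<ge> g x0 + y1 \<bullet> (u - x0) - e/4 * norm (u - x0)"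
    unfolding x0_def y1_def by (metis zero_less_divide_iff zero_less_numeral)
  obtain n :: nat where n: "n > 0" "1 / real n < min e (d/2)"
    using real_arch_inverse[of "min e (d/2)"] e d by (auto simp: inverse_eq_divide)
  define s where "s = 1 / real n"
  have s: "s > 0" "s < e" "2 * s < d" using n by (auto simp: s_def)
  \<comment> \<open>The error budget is \<open>e * s\<close>. The regular minorant on distance
    \<open>2 * s\<close> uses half of it; the changes of value, of base point in the linear term,
    and of slope use one eighth each.\<close>
  define t where "t = min (min (e/2) s) (e * s / (8 * (norm y1 + 1)))"
  have t: "t > 0" "t \<le> e / 2" "t \<le> s" "norm y1 * t \<le> e * s / 8"
  proof -
    have n1: "norm y1 + 1 > 0" using norm_ge_zero[of y1] by linarith
    show "t > 0" using e s n1 by (auto simp: t_def intro!: divide_pos_pos mult_pos_pos)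
    show "t \<le> e / 2" "t \<le> s" unfolding t_def by linarith+
    have "norm y1 * t \<le> (norm y1 + 1) * (e * s / (8 * (norm y1 + 1)))"
      using e s n1 \<open>t > 0\<close> by (intro mult_mono) (auto simp: t_def)
    also have "\<dots> = e * s / 8"
    proof -
      have "a * (b / (8 * a)) = b / 8" if "a > 0" for a b :: real using that by simp
      then show ?thesis using n1 .
    qed
    finally show "norm y1 * t \<le> e * s / 8" .
  qed
  have "isCont g x0" using cont U(1) k(1) by (simp add: continuous_on_eq_continuous_at x0_def)
  then obtain d3 where d3: "d3 > 0" "\<And>u. dist u x0 < d3 \<Longrightarrow> dist (g u) (g x0) < e * s / 8"
    using e s unfolding continuous_at_eps_delta by (metis mult_pos_pos zero_less_divide_iff zero_less_numeral)
  have "ball x0 (min t d3) \<noteq> {}" using t(1) d3(1) by simp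
  from D[OF open_ball this] obtain x' where x': "x' \<in> D" "x' \<in> ball x0 (min t d3)" by blast
  have xx: "norm (x' - x0) < t" "norm (x' - x0) < d3" using x' by (auto simp: dist_norm norm_minus_commute)
  show ?thesis
  proof (intro bexI[OF _ x'(1)] exI[of _ y1] exI[of _ n] conjI allI impI ballI)
    show "dist x' x < e" using dist_triangle[of x' x x0] xx t k(2) by (simp add: x0_def dist_norm)
    show "dist y1 y < e" using k(4) by (simp add: y1_def)
    show "0 < n" "1 / real n < e" using n by auto
    fix y' u assume y': "dist y' y1 < e / 8" and u: "u \<in> ball x' (1 / real n)"
    have ux: "norm (u - x') < s" using u by (simp add: s_def dist_norm norm_minus_commute)
    have ux0: "norm (u - x0) < 2 * s" using norm_triangle_ineq[of "u - x'" "x' - x0"] ux xx(1) t by simp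
    then show "u \<in> U" using d(2)[of u] s by auto
    have 1: "g u \<ge> g x0 + y1 \<bullet> (u - x0) - e/4 * norm (u - x0)" using d(2)[of u] ux0 s by auto
    have 2: "e/4 * norm (u - x0) \<le> e * s / 2" using ux0 e by (simp add: field_simps mult_left_mono)
    have 3: "g x' - g x0 < e * s / 8"
    proof -
      have "dist (g x') (g x0) < e * s / 8" using d3(2)[of x'] xx(2) by (simp add: dist_norm)
      then show ?thesis unfolding dist_real_def by linarith
    qed
    have 4: "\<bar>y1 \<bullet> (x' - x0)\<bar> \<le> e * s / 8"
      using Cauchy_Schwarz_ineq2[of y1 "x' - x0"] mult_left_mono[of "norm (x' - x0)" t "norm y1"] xx t(4) by simp
    have 5: "\<bar>(y' - y1) \<bullet> (u - x')\<bar> \<le> e / 8 * s"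
    proof -
      have "\<bar>(y' - y1) \<bullet> (u - x')\<bar> \<le> norm (y' - y1) * norm (u - x')" by (rule Cauchy_Schwarz_ineq2)
      also have "\<dots> \<le> e / 8 * s" using y' ux e by (intro mult_mono) (auto simp: dist_norm)
      finally show ?thesis .
    qed
    have "y1 \<bullet> (u - x0) = y' \<bullet> (u - x') - (y' - y1) \<bullet> (u - x') + y1 \<bullet> (x' - x0)"
      by (simp add: algebra_simps inner_diff_left inner_diff_right)
    then have "g u \<ge> g x' + y' \<bullet> (u - x') - e * s" using 1 2 3 4 5 mult_pos_pos[OF e s(1)] by linarith
    then show "g u \<ge> g x' + y' \<bullet> (u - x') - e / real n" by (simp add: s_def)
  qed
qed

text \<open>Countable description, converse half: adding a quadratic to \<open>\<psi>\<close> minus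
  the linear form makes an approximate minorant produce an interior minimum, hence a true
  subgradient nearby. Compactness of balls makes this quadratic version of a variational principle
  elementary.\<close>

lemma approximate_subgradient_nearby:
  fixes \<psi> :: "'a::euclidean_space \<Rightarrow> ereal"
  assumes lsc: "lsc \<psi>" and nm: "\<And>x. \<psi> x \<noteq> -\<infinity>"
    and g: "\<And>u. u \<in> ball x d \<Longrightarrow> \<psi> u = ereal (g u)" and d: "d > 0" and e: "e > 0"
    and ineq: "\<And>u. u \<in> ball x d \<Longrightarrow> g u \<ge> g x + y \<bullet> (u - x) - e * d"
  shows "\<exists>x' y'. dist x' x < d \<and> dist y' y \<le> 8 * e \<and> y' \<in> subdiff \<psi> x'"
proof -
  \<comment> \<open>The error \<open>e * d\<close> then confines the minimiser to
    \<open>d^2 / 8\<close> in squared distance, strictly inside the ball of radius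
    \<open>d / 2\<close>, and the gradient of the quadratic is at most
    \<open>2 * ?c * (d / 2) = 8 * e\<close>.\<close>
  let ?c = "8 * e / d"
  let ?h = "\<lambda>u. ?c * ((u - x) \<bullet> (u - x)) - y \<bullet> (u - x)"
  have cont: "continuous_on UNIV ?h" by (intro continuous_intros)
  obtain z where z: "z \<in> cball x (d/2)" "\<And>u. u \<in> cball x (d/2) \<Longrightarrow> \<psi> z + ereal (?h z) \<le> \<psi> u + ereal (?h u)"
    using lsc_attains_minimum[OF lsc nm cont, of "cball x (d/2)"] d by auto
  have zb: "z \<in> ball x d" using z(1) d by auto
  have "g z + ?h z \<le> g x" using z(2)[of x] g[of z] g[of x] zb d by simp
  moreover have "g z \<ge> g x + y \<bullet> (z - x) - e * d" by (rule ineq[OF zb])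
  ultimately have "?c * ((z - x) \<bullet> (z - x)) \<le> e * d" by linarith
  then have "8 * e * (norm (z - x))^2 \<le> e * (d * d)" using d unfolding power2_norm_eq_inner
    by (simp add: pos_divide_le_eq mult.assoc)
  then have "e * (8 * (norm (z - x))^2) \<le> e * (d * d)" by (simp only: mult_ac)
  then have "8 * (norm (z - x))^2 \<le> d * d" using e by (rule mult_left_le_imp_le)
  then have "(norm (z - x))^2 \<le> d^2 / 8" unfolding power2_eq_square[of d] by linarith
  also have "\<dots> < d^2 / 4" using zero_less_power[OF d, of 2] by linarith
  also have "\<dots> = (d/2)^2" by (simp add: power_divide)
  finally have zx: "norm (z - x) < d / 2" by (rule power2_less_imp_less) (use d in simp)
  let ?g = "(2 * ?c) *\<^sub>R (z - x) - y"
  have "((\<lambda>u. c * ((u - x) \<bullet> (u - x)) - y \<bullet> (u - x)) has_derivative (\<lambda>v. ((2 * c) *\<^sub>R (z - x) - y) \<bullet> v)) (at z)" for c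
    by (auto intro!: derivative_eq_intros simp: inner_commute inner_diff_left algebra_simps fun_eq_iff)
  from this[of ?c] have "(?h has_derivative (\<lambda>v. ?g \<bullet> v)) (at z)" .
  then have "- ?g \<in> subdiff \<psi> z"
  proof (rule minimum_subgradient[rotated])
    show "0 < d / 2 - norm (z - x)" using zx by simp
    show "\<bar>\<psi> z\<bar> \<noteq> \<infinity>" using g[OF zb] by simp
    fix u assume "norm (u - z) < d / 2 - norm (z - x)"
    then have "u \<in> cball x (d/2)" using norm_triangle_ineq[of "u - z" "z - x"] by (simp add: dist_norm norm_minus_commute)
    then show "\<psi> z + ereal (?h z) \<le> \<psi> u + ereal (?h u)" by (rule z(2))
  qed
  moreover have "dist (- ?g) y = 2 * ?c * norm (z - x)"
  proof -
    have "- ?g - y = - ((2 * ?c) *\<^sub>R (z - x))" by simp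
    then have "dist (- ?g) y = norm ((2 * ?c) *\<^sub>R (z - x))" unfolding dist_norm by (simp only: norm_minus_cancel)
    also have "\<dots> = 2 * ?c * norm (z - x)" using d e by (simp only: norm_scaleR) simp
    finally show ?thesis .
  qed
  moreover have "2 * ?c * norm (z - x) \<le> 2 * ?c * (d / 2)" using zx d e by (intro mult_left_mono) auto
  moreover have "2 * ?c * (d / 2) = 8 * e" using d by simp
  moreover have "dist z x < d" using zb by (simp add: dist_commute)
  ultimately show ?thesis by (intro exI[of _ z] exI[of _ "- ?g"]) auto
qed

section \<open>Measurability of subdifferential graphs\<close>

text \<open>The second coordinate is the deviation from \<open>yb\<close>, so that the reference
  point becomes \<open>(xb, 0)\<close> whatever the parameter.\<close>

definition shifted_graph :: "('a::euclidean_space \<Rightarrow> ereal) \<Rightarrow> 'a \<Rightarrow> real \<Rightarrow> 'a \<Rightarrow> ('a \<times> 'a) set" where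
  "shifted_graph \<psi> xb r yb = {(x, y). x \<in> cball xb r \<and> y + yb \<in> subdiff \<psi> x}"

lemma shifted_graph_limit:
  fixes \<psi> :: "'a::euclidean_space \<Rightarrow> ereal"
  assumes fin: "\<And>x. x \<in> ball xb s \<Longrightarrow> \<bar>\<psi> x\<bar> \<noteq> \<infinity>" and cont: "continuous_on (ball xb s) (\<lambda>x. real_of_ereal (\<psi> x))"
    and x: "x \<in> ball xb s" and X: "X \<longlonglongrightarrow> x" and Y: "Y \<longlonglongrightarrow> y" and sub: "\<And>k. Y k + yb \<in> subdiff \<psi> (X k)"
  shows "y + yb \<in> subdiff \<psi> x"
proof (rule subdiff_closed_graph[OF fin[OF x] X _ sub])
  show "(\<lambda>k. Y k + yb) \<longlonglongrightarrow> y + yb" by (intro tendsto_intros Y)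
  have "isCont (\<lambda>x. real_of_ereal (\<psi> x)) x" using cont x by (simp add: continuous_on_eq_continuous_at)
  then show "(\<lambda>k. real_of_ereal (\<psi> (X k))) \<longlonglongrightarrow> real_of_ereal (\<psi> x)" by (rule isCont_tendsto_compose) (rule X)
qed

lemma shifted_graph_compact:
  fixes \<psi> :: "'a::euclidean_space \<Rightarrow> ereal"
  assumes fin: "\<And>x. x \<in> ball xb s \<Longrightarrow> \<bar>\<psi> x\<bar> \<noteq> \<infinity>" and cont: "continuous_on (ball xb s) (\<lambda>x. real_of_ereal (\<psi> x))"
    and r: "r < s" and bd: "\<And>x. x \<in> ball xb s \<Longrightarrow> subdiff \<psi> x \<subseteq> cball 0 \<kappa>"
  shows "compact (shifted_graph \<psi> xb r yb)"
  unfolding compact_eq_bounded_closed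
proof
  have sub: "cball xb r \<subseteq> ball xb s" using r by auto
  have "shifted_graph \<psi> xb r yb \<subseteq> cball xb r \<times> cball (- yb) \<kappa>"
  proof
    fix z assume "z \<in> shifted_graph \<psi> xb r yb"
    then have z: "fst z \<in> cball xb r" "snd z + yb \<in> subdiff \<psi> (fst z)" by (auto simp: shifted_graph_def)
    have "snd z + yb \<in> cball 0 \<kappa>" using bd[of "fst z"] sub z by blast
    then have "snd z \<in> cball (- yb) \<kappa>" by (simp add: dist_norm norm_minus_commute add.commute)
    then show "z \<in> cball xb r \<times> cball (- yb) \<kappa>" using z(1) by (simp add: mem_Times_iff)
  qed
  then show "bounded (shifted_graph \<psi> xb r yb)"
    by (rule bounded_subset[rotated]) (intro bounded_Times bounded_cball)
  show "closed (shifted_graph \<psi> xb r yb)" unfolding closed_sequential_limits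
  proof (intro allI impI, elim conjE)
    fix z l assume z: "\<forall>n. z n \<in> shifted_graph \<psi> xb r yb" "z \<longlonglongrightarrow> l"
    have 1: "fst (z n) \<in> cball xb r" "snd (z n) + yb \<in> subdiff \<psi> (fst (z n))" for n
      using z(1) by (auto simp: shifted_graph_def split_beta)
    have l: "fst l \<in> cball xb r"
      by (rule closed_sequentially[OF closed_cball 1(1) tendsto_fst[OF z(2)]])
    then have "snd l + yb \<in> subdiff \<psi> (fst l)"
      using sub by (intro shifted_graph_limit[OF fin cont _ tendsto_fst[OF z(2)] tendsto_snd[OF z(2)] 1(2)]) auto
    then show "l \<in> shifted_graph \<psi> xb r yb" using l by (auto simp: shifted_graph_def split_beta)
  qed
qed

text \<open>All quantifiers on the right range over countable sets, which makes the left-hand side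
  measurable in a parameter without a projection theorem.\<close>

lemma shifted_graph_hit_iff:
  fixes \<psi> :: "'a::euclidean_space \<Rightarrow> ereal"
  assumes lsc: "lsc \<psi>" and nm: "\<And>x. \<psi> x \<noteq> -\<infinity>"
    and fin: "\<And>x. x \<in> ball xb s \<Longrightarrow> \<bar>\<psi> x\<bar> \<noteq> \<infinity>" and cont: "continuous_on (ball xb s) (\<lambda>x. real_of_ereal (\<psi> x))"
    and r: "r < s" and bd: "\<And>x. x \<in> ball xb s \<Longrightarrow> subdiff \<psi> x \<subseteq> cball 0 \<kappa>"
    and D: "\<And>S :: 'a set. open S \<Longrightarrow> S \<noteq> {} \<Longrightarrow> \<exists>d\<in>D. d \<in> S"
    and C: "closed C" and C': "C' = C \<inter> (cball xb r \<times> UNIV)" "C' \<noteq> {}"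
  shows "shifted_graph \<psi> xb r yb \<inter> C \<noteq> {} \<longleftrightarrow>
    (\<forall>m. \<exists>n. \<exists>x\<in>D. \<exists>y\<in>D. (n > 0 \<and> 1 / real n < 1 / real (Suc m) \<and> ball x (1 / real n) \<subseteq> ball xb s \<and>
        infdist (x, y) C' < 3 * (1 / real (Suc m))) \<and>
      (\<forall>u\<in>D. u \<in> ball x (1 / real n) \<longrightarrow>
        real_of_ereal (\<psi> x) + (y + yb) \<bullet> (u - x) - 1 / real (Suc m) / real n \<le> real_of_ereal (\<psi> u)))"
    (is "?L \<longleftrightarrow> (\<forall>m. ?R m)")
proof
  let ?g = "\<lambda>x. real_of_ereal (\<psi> x)"
  have g: "\<psi> u = ereal (?g u)" if "u \<in> ball xb s" for u using fin[OF that] by (simp add: ereal_real')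
  have sub: "cball xb r \<subseteq> ball xb s" using r by auto
  {
    assume ?L
    then obtain x y where xy: "x \<in> cball xb r" "y + yb \<in> subdiff \<psi> x" "(x, y) \<in> C"
      by (auto simp: shifted_graph_def)
    then have xyC: "(x, y) \<in> C'" by (simp add: C')
    show "\<forall>m. ?R m"
    proof
      fix m
      define e where "e = 1 / real (Suc m)"
      have e: "e > 0" by (simp add: e_def)
      have "x \<in> ball xb s" using xy sub by auto
      from subgradient_approximation[OF open_ball this g cont xy(2) e D]
      obtain x' y1 n where A: "x' \<in> D" "dist x' x < e" "dist y1 (y + yb) < e" "n > 0" "1 / real n < e"
         "\<And>y' u. dist y' y1 < e / 8 \<Longrightarrow> u \<in> ball x' (1 / real n) \<Longrightarrow>
            u \<in> ball xb s \<and> ?g u \<ge> ?g x' + y' \<bullet> (u - x') - e / real n" by blast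
      have "ball (y1 - yb) (e/8) \<noteq> {}" using e by simp
      from D[OF open_ball this] obtain y' where y': "y' \<in> D" "y' \<in> ball (y1 - yb) (e/8)" by blast
      have d: "dist (y' + yb) y1 < e / 8" using y'(2) by (simp add: dist_norm norm_minus_commute algebra_simps)
      have "dist y' y \<le> dist (y' + yb) y1 + dist y1 (y + yb)"
        using dist_triangle[of "y' + yb" "y + yb" y1] by (simp add: dist_norm)
      then have "dist y' y < 2 * e" using d A(3) e by simp
      moreover have "dist (x', y') (x, y) \<le> dist x' x + dist y' y"
        using norm_Pair_le[of "x' - x" "y' - y"] by (simp add: dist_norm)
      ultimately have "infdist (x', y') C' < 3 * e" using infdist_le[OF xyC, of "(x', y')"] A(2) by linarith
      moreover have "ball x' (1 / real n) \<subseteq> ball xb s" using A(6)[of y1] e by auto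
      ultimately show "?R m" unfolding e_def[symmetric] using A(1,4,5) A(6)[OF d] y'(1)
        by (intro exI[of _ n] bexI[of _ x'] bexI[of _ y']) auto
    qed
  }
  {
    assume R: "\<forall>m. ?R m"
    \<comment> \<open>The factor 12 is 3 from the criterion, 1 for the shift of the base point and 8
      for that of the slope. These points need only lie in \<open>ball xb s\<close>; the smaller
      radius \<open>r\<close> is recovered in the limit, through \<open>C'\<close>.\<close>
    have "\<exists>x y. x \<in> ball xb s \<and> y + yb \<in> subdiff \<psi> x \<and> infdist (x, y) C' < 12 * (1 / real (Suc m))" for m
    proof -
      define e where "e = 1 / real (Suc m)"
      have e: "e > 0" by (simp add: e_def)
      obtain n x y where A: "n > 0" "1 / real n < e" "ball x (1 / real n) \<subseteq> ball xb s" "infdist (x, y) C' < 3 * e"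
        "\<And>u. u \<in> D \<Longrightarrow> u \<in> ball x (1 / real n) \<Longrightarrow> ?g x + (y + yb) \<bullet> (u - x) - e / real n \<le> ?g u"
        using R[rule_format, of m] unfolding e_def[symmetric] by blast
      \<comment> \<open>By continuity a violation would persist on an open set, and this set would
        contain a point of \<open>D\<close>.\<close>
      have ineq: "?g x + (y + yb) \<bullet> (u - x) - e * (1 / real n) \<le> ?g u" if u: "u \<in> ball x (1 / real n)" for u
      proof (rule ccontr)
        assume "\<not> ?thesis"
        moreover have cS: "continuous_on (ball x (1 / real n)) (\<lambda>u. ?g u - (?g x + (y + yb) \<bullet> (u - x) - e * (1 / real n)))"
          by (intro continuous_intros continuous_on_subset[OF cont A(3)])
        then have op: "open (ball x (1 / real n) \<inter> (\<lambda>u. ?g u - (?g x + (y + yb) \<bullet> (u - x) - e * (1 / real n))) -` {..<0})"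
            (is "open ?S")
          by (rule continuous_open_preimage) auto
        ultimately have "u \<in> ?S" using u by auto
        then obtain u' where "u' \<in> D" "u' \<in> ?S" using D[OF op] by blast
        then show False using A(5)[of u'] by auto
      qed
      have "\<exists>x' y'. dist x' x < 1 / real n \<and> dist y' (y + yb) \<le> 8 * e \<and> y' \<in> subdiff \<psi> x'"
        by (rule approximate_subgradient_nearby[OF lsc nm _ _ e ineq]) (use g A in auto)
      then obtain x' y' where B: "dist x' x < 1 / real n" "dist y' (y + yb) \<le> 8 * e" "y' \<in> subdiff \<psi> x'" by blast
      have "x' \<in> ball x (1 / real n)" using B(1) by (simp add: dist_commute)
      then have "x' \<in> ball xb s" using A(3) by blast
      moreover have "(y' - yb) + yb \<in> subdiff \<psi> x'" using B(3) by simp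
      moreover have "infdist (x', y' - yb) C' < 12 * e"
      proof -
        have "dist (x', y' - yb) (x, y) \<le> dist x' x + dist y' (y + yb)"
          using norm_Pair_le[of "x' - x" "y' - yb - y"] by (simp add: dist_norm algebra_simps)
        then show ?thesis using infdist_triangle[of "(x', y' - yb)" C' "(x, y)"] A(2,4) B(1,2) by linarith
      qed
      ultimately show ?thesis unfolding e_def by blast
    qed
    then obtain X Y where XY: "\<And>m. X m \<in> ball xb s" "\<And>m. Y m + yb \<in> subdiff \<psi> (X m)"
      "\<And>m. infdist (X m, Y m) C' < 12 * (1 / real (Suc m))" by metis
    have Yb: "Y m \<in> cball (- yb) \<kappa>" for m
    proof -
      have "Y m + yb \<in> cball 0 \<kappa>" using XY(2)[of m] bd[OF XY(1)[of m]] by blast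
      then show ?thesis by (simp add: dist_norm norm_minus_commute add.commute)
    qed
    have "bounded (range (\<lambda>m. (X m, Y m)))"
      by (rule bounded_subset[OF bounded_Times[OF bounded_ball[of xb s] bounded_cball[of "- yb" \<kappa>]]]) (use XY(1) Yb in blast)
    then obtain l q where l: "strict_mono q" "((\<lambda>m. (X m, Y m)) \<circ> q) \<longlonglongrightarrow> l"
      using bounded_imp_convergent_subsequence by blast
    have lim: "(\<lambda>m. (X (q m), Y (q m))) \<longlonglongrightarrow> l" using l(2) by (simp add: o_def)
    have "(\<lambda>m. 12 * (1 / real (Suc m))) \<longlonglongrightarrow> 12 * 0"
      by (intro tendsto_mult_left) (use LIMSEQ_Suc[OF lim_const_over_n[of 1]] in simp)
    from LIMSEQ_subseq_LIMSEQ[OF this l(1)] have l0: "(\<lambda>m. 12 * (1 / real (Suc (q m)))) \<longlonglongrightarrow> 0" by (simp add: o_def)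
    have "infdist l C' \<le> 0"
      by (rule LIMSEQ_le[OF tendsto_infdist[OF lim] l0]) (use XY(3) in \<open>auto intro!: less_imp_le\<close>)
    then have "infdist l C' = 0" using infdist_nonneg[of l C'] by linarith
    moreover have "closed C'" unfolding C' by (intro closed_Int C closed_Times closed_cball closed_UNIV)
    ultimately have lC: "l \<in> C'" using in_closed_iff_infdist_zero C'(2) by blast
    then have l1: "fst l \<in> cball xb r" by (auto simp: C')
    have "snd l + yb \<in> subdiff \<psi> (fst l)"
      using l1 sub tendsto_fst[OF lim] tendsto_snd[OF lim] XY(2)
      by (intro shifted_graph_limit[OF fin cont, of "fst l" "\<lambda>m. X (q m)" "\<lambda>m. Y (q m)"]) auto
    then have "l \<in> shifted_graph \<psi> xb r yb" using l1 by (auto simp: shifted_graph_def split_beta)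
    then show ?L using lC by (auto simp: C')
  }
qed

text \<open>The set \<open>G\<close> of full measure carries the assumptions that hold almost
  everywhere, so that pointwise arguments need no exceptional sets.\<close>

locale integrand_selection = finite_measure M for M :: "'t measure" +
  fixes \<phi> :: "'t \<Rightarrow> 'a::euclidean_space \<Rightarrow> ereal" and xbar :: 'a and ysbar :: "'t \<Rightarrow> 'a"
    and \<rho> :: real and \<kappa> :: "'t \<Rightarrow> real" and G Tpa Tna :: "'t set"
  assumes dec: "atomic_decomposition M Tpa Tna"
    and pni: "proper_normal_integrand M \<phi>"
    and ysbar_integrable: "integrable M ysbar" and kappa_integrable: "integrable M \<kappa>" and rho: "\<rho> > 0"
    and G: "G \<in> sets M" "AE t in M. t \<in> G"
    and ysbar: "\<And>t. t \<in> G \<Longrightarrow> ysbar t \<in> subdiff (\<phi> t) xbar"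
    and subdiff_bound: "\<And>t x. t \<in> G \<Longrightarrow> x \<in> cball xbar \<rho> \<Longrightarrow> subdiff (\<phi> t) x \<subseteq> cball 0 (\<kappa> t)"
begin

text \<open>Off \<open>G\<close> a default singleton keeps \<open>K r t\<close> compact and nonempty
  and keeps \<open>(xbar, 0)\<close> in it for all \<open>t\<close>. Compactness holds for radii
  below \<open>\<rho>/4\<close>, where the integrand is continuous; \<open>\<rho>/8\<close> will be
  the working radius.\<close>

definition K :: "real \<Rightarrow> 't \<Rightarrow> ('a \<times> 'a) set" where
  "K r t = (if t \<in> G then shifted_graph (\<phi> t) xbar r (ysbar t) else {(xbar, 0)})"

definition bnd :: "'t \<Rightarrow> real" where
  "bnd t = norm (ysbar t) + \<bar>\<kappa> t\<bar>"

lemma bnd_integrable: "integrable M bnd"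
  unfolding bnd_def using ysbar_integrable kappa_integrable by auto

lemma bnd_nonneg: "0 \<le> bnd t"
  by (simp add: bnd_def)

lemma G_space: "t \<in> G \<Longrightarrow> t \<in> space M"
  using G(1) sets.sets_into_space by blast

lemma lsc_phi: "t \<in> G \<Longrightarrow> lsc (\<phi> t)" and phi_nm: "t \<in> G \<Longrightarrow> \<phi> t x \<noteq> -\<infinity>"
  using pni G_space by (auto simp: proper_normal_integrand_def normal_integrand_def proper_def)

lemma phi_local:
  assumes "t \<in> G"
  shows "\<And>x. x \<in> ball xbar (\<rho>/4) \<Longrightarrow> \<bar>\<phi> t x\<bar> \<noteq> \<infinity>"
    "continuous_on (ball xbar (\<rho>/4)) (\<lambda>x. real_of_ereal (\<phi> t x))"
proof -
  have "\<bar>\<phi> t xbar\<bar> \<noteq> \<infinity>" using ysbar[OF assms] by (auto simp: subdiff_def split: if_splits)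
  from bounded_subgradients_continuous[OF lsc_phi[OF assms] phi_nm[OF assms] this rho subdiff_bound[OF assms]]
  show "\<And>x. x \<in> ball xbar (\<rho>/4) \<Longrightarrow> \<bar>\<phi> t x\<bar> \<noteq> \<infinity>"
    "continuous_on (ball xbar (\<rho>/4)) (\<lambda>x. real_of_ereal (\<phi> t x))" by auto
qed

lemma subdiff_bound': "t \<in> G \<Longrightarrow> x \<in> ball xbar (\<rho>/4) \<Longrightarrow> subdiff (\<phi> t) x \<subseteq> cball 0 (\<kappa> t)"
  using subdiff_bound[of t x] rho by auto

lemma K_iff: "t \<in> G \<Longrightarrow> (x, y) \<in> K r t \<longleftrightarrow> x \<in> cball xbar r \<and> y + ysbar t \<in> subdiff (\<phi> t) x"
  by (simp add: K_def shifted_graph_def)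

lemma K_mono: "0 \<le> r \<Longrightarrow> r \<le> r' \<Longrightarrow> K r t \<subseteq> K r' t"
  by (auto simp: K_def shifted_graph_def)

lemma K_center: "0 \<le> r \<Longrightarrow> (xbar, 0) \<in> K r t"
  using ysbar by (auto simp: K_def shifted_graph_def)

lemma K_fst: "0 \<le> r \<Longrightarrow> (x, y) \<in> K r t \<Longrightarrow> x \<in> cball xbar r"
  by (auto simp: K_def shifted_graph_def split: if_splits)

lemma K_snd:
  assumes r: "0 \<le> r" "r < \<rho>/4" and z: "(x, y) \<in> K r t"
  shows "norm y \<le> bnd t"
proof (cases "t \<in> G")
  case True
  then have "y + ysbar t \<in> cball 0 (\<kappa> t)"
    using z subdiff_bound'[OF True, of x] r by (auto simp: K_iff)
  then have "norm (y + ysbar t) \<le> \<bar>\<kappa> t\<bar>" by simp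
  then show ?thesis using norm_triangle_ineq4[of "y + ysbar t" "ysbar t"] by (simp add: bnd_def)
next
  case False
  then show ?thesis using z by (simp add: K_def bnd_nonneg)
qed

lemma K_compact:
  assumes r: "0 \<le> r" "r < \<rho>/4"
  shows "compact (K r t)"
  unfolding K_def using shifted_graph_compact[OF phi_local r(2) subdiff_bound'] by auto

section \<open>Measurability of the graphs and limits of their selections\<close>

lemma phi_measurable: "(\<lambda>t. \<phi> t x) \<in> borel_measurable M"
proof -
  have "(\<lambda>(t, x). \<phi> t x) \<in> borel_measurable (M \<Otimes>\<^sub>M borel)"
    using pni by (simp add: proper_normal_integrand_def normal_integrand_def)
  from measurable_compose[OF measurable_Pair[OF measurable_ident_sets[OF refl] measurable_const[of x]] this]
  show ?thesis by simp
qed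

lemma K_multifunction:
  assumes r: "0 \<le> r" "r < \<rho>/4"
  shows "compact_multifunction M (K r)"
proof -
  obtain D :: "'a set" where D: "countable D" "\<And>S :: 'a set. open S \<Longrightarrow> S \<noteq> {} \<Longrightarrow> \<exists>d\<in>D. d \<in> S"
    using countable_dense_exists by blast
  have "{t\<in>space M. K r t \<inter> C \<noteq> {}} \<in> sets M" if C: "closed C" for C
  proof -
    define C' where "C' = C \<inter> (cball xbar r \<times> UNIV)"
    \<comment> \<open>The conjunct \<open>C' \<noteq> {}\<close> is needed because
      \<open>infdist\<close> to the empty set is zero, which would satisfy the distance
      condition.\<close>
    define Q where "Q t \<longleftrightarrow> C' \<noteq> {} \<and> (\<forall>m. \<exists>n. \<exists>x\<in>D. \<exists>y\<in>D. (n > 0 \<and> 1 / real n < 1 / real (Suc m) \<and> ball x (1 / real n) \<subseteq> ball xbar (\<rho>/4) \<and>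
        infdist (x, y) C' < 3 * (1 / real (Suc m))) \<and>
      (\<forall>u\<in>D. u \<in> ball x (1 / real n) \<longrightarrow>
        real_of_ereal (\<phi> t x) + (y + ysbar t) \<bullet> (u - x) - 1 / real (Suc m) / real n \<le> real_of_ereal (\<phi> t u)))" for t
    have Q: "shifted_graph (\<phi> t) xbar r (ysbar t) \<inter> C \<noteq> {} \<longleftrightarrow> Q t" if t: "t \<in> G" for t
    proof (cases "C' = {}")
      case True
      then show ?thesis by (auto simp: Q_def C'_def shifted_graph_def)
    next
      case False
      have "shifted_graph (\<phi> t) xbar r (ysbar t) \<inter> C \<noteq> {} \<longleftrightarrow> (C' \<noteq> {} \<longrightarrow> Q t)"
        unfolding Q_def using False
          shifted_graph_hit_iff[OF lsc_phi[OF t] phi_nm[OF t] phi_local[OF t] r(2) subdiff_bound'[OF t] D(2) C C'_def False]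
        by simp
      then show ?thesis using False by simp
    qed
    have eq: "{t\<in>space M. K r t \<inter> C \<noteq> {}} =
        (G \<inter> {t\<in>space M. Q t}) \<union> (if (xbar, 0) \<in> C then space M - G else {})"
      using Q G_space by (auto simp: K_def)
    have "{t\<in>space M. Q t} \<in> sets M"
      unfolding Q_def
    proof (intro sets.sets_Collect_conj sets.sets_Collect_const sets.sets_Collect_countable_All
        sets.sets_Collect_countable_Ex sets.sets_Collect_countable_Ex' sets.sets_Collect_countable_All' D(1) sets.sets_Collect_imp)
      fix m n x y u
      have [measurable]: "(\<lambda>t. real_of_ereal (\<phi> t x)) \<in> borel_measurable M" for x
        using phi_measurable by measurable
      have [measurable]: "ysbar \<in> borel_measurable M" using ysbar_integrable by simp
      show "{t\<in>space M. real_of_ereal (\<phi> t x) + (y + ysbar t) \<bullet> (u - x) - 1 / real (Suc m) / real n \<le> real_of_ereal (\<phi> t u)} \<in> sets M"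
        by measurable
    qed
    then show ?thesis unfolding eq using G(1) by auto
  qed
  then show ?thesis using K_compact[OF r] K_center[OF r(1)] by (auto simp: compact_multifunction_def)
qed

text \<open>The Fatou lemma is applied to the pairs \<open>(Y k t, \<Theta> (Y k t))\<close>.
  Closedness of \<open>K r t\<close> and continuity of \<open>\<Theta>\<close> put every cluster
  point into the form \<open>(z, \<Theta> z)\<close> with \<open>(x, z)\<close> in
  \<open>K r t\<close>, so the nonlinear integral passes to the limit exactly.\<close>

lemma selection_limit:
  fixes \<Theta> :: "'a \<Rightarrow> 'b::euclidean_space"
  assumes r: "0 \<le> r" "r < \<rho>/4"
    and Ym: "\<And>k. Y k \<in> borel_measurable M" and XY: "\<And>k. AE t in M. (X k t, Y k t) \<in> K r t"
    and X: "AE t in M. (\<lambda>k. X k t) \<longlonglongrightarrow> x"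
    and Th: "continuous_on UNIV \<Theta>" "\<And>y. norm (\<Theta> y) \<le> b * norm y"
  shows "\<exists>s Z. strict_mono s \<and> integrable M Z \<and> (AE t in M. (x, Z t) \<in> K r t) \<and>
     (\<lambda>k. LINT t|M. \<Theta> (Y (s k) t)) \<longlonglongrightarrow> (LINT t|M. \<Theta> (Z t))"
proof -
  let ?f = "\<lambda>k t. (Y k t, \<Theta> (Y k t))"
  let ?g = "\<lambda>t. bnd t + \<bar>b\<bar> * bnd t"
  have Thm: "\<Theta> \<in> borel_measurable borel" by (rule borel_measurable_continuous_onI[OF Th(1)])
  have fm: "?f k \<in> borel_measurable M" for k
    using Ym[of k] measurable_compose[OF Ym[of k] Thm] by (intro borel_measurable_Pair) auto
  have g: "integrable M ?g" using bnd_integrable by auto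
  have Yb: "AE t in M. norm (Y k t) \<le> bnd t" for k
    using XY[of k] by eventually_elim (rule K_snd[OF r])
  have fb: "AE t in M. norm (?f k t) \<le> ?g t" for k
    using Yb[of k]
  proof eventually_elim
    case (elim t)
    have "norm (\<Theta> (Y k t)) \<le> \<bar>b\<bar> * bnd t"
      by (rule order_trans[OF Th(2)]) (use elim in \<open>auto intro!: mult_mono\<close>)
    then show ?case using norm_Pair_le[of "Y k t" "\<Theta> (Y k t)"] elim by linarith
  qed
  have fi: "integrable M (?f k)" for k
  proof (rule Bochner_Integration.integrable_bound[OF g fm])
    show "AE t in M. norm (?f k t) \<le> norm (?g t)" using fb[of k] by eventually_elim simp
  qed
  have "norm (integral\<^sup>L M (?f k)) \<le> integral\<^sup>L M ?g" for k
    by (rule order_trans[OF integral_norm_bound integral_mono_AE[OF integrable_norm[OF fi] g fb]])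
  then have "bounded (range (\<lambda>k. integral\<^sup>L M (?f k)))" by (auto simp: bounded_iff)
  then obtain l s where l: "strict_mono s" "((\<lambda>k. integral\<^sup>L M (?f k)) \<circ> s) \<longlonglongrightarrow> l"
    using bounded_imp_convergent_subsequence by blast
  have lim: "(\<lambda>k. integral\<^sup>L M (?f (s k))) \<longlonglongrightarrow> l" using l(2) by (simp add: o_def)
  have "l \<in> aumann_integral M (\<lambda>t. cluster_points (\<lambda>k. ?f (s k) t))"
    by (rule Fatou_multivalued[OF finite_measure_axioms dec fm fb g lim])
  then obtain V where V: "integrable M V" "AE t in M. V t \<in> cluster_points (\<lambda>k. ?f (s k) t)" "l = integral\<^sup>L M V"
    by (auto simp: aumann_integral_def)
  have XY': "AE t in M. \<forall>k. (X k t, Y k t) \<in> K r t" using XY by (simp add: AE_all_countable)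
  have Vt: "AE t in M. (x, fst (V t)) \<in> K r t \<and> snd (V t) = \<Theta> (fst (V t))"
    using V(2) XY' X
  proof eventually_elim
    case (elim t)
    then obtain q where q: "strict_mono q" "(\<lambda>k. ?f (s (q k)) t) \<longlonglongrightarrow> V t" by (auto simp: cluster_points_def)
    have Yl: "(\<lambda>k. Y (s (q k)) t) \<longlonglongrightarrow> fst (V t)" using tendsto_fst[OF q(2)] by simp
    have Xl: "(\<lambda>k. X (s (q k)) t) \<longlonglongrightarrow> x"
      using LIMSEQ_subseq_LIMSEQ[OF elim(3) strict_mono_o[OF l(1) q(1)]] by (simp add: o_def)
    have "(x, fst (V t)) \<in> K r t"
      by (rule closed_sequentially[OF compact_imp_closed[OF K_compact[OF r]] _ tendsto_Pair[OF Xl Yl]])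
         (use elim(2) in blast)
    moreover have "(\<lambda>k. \<Theta> (Y (s (q k)) t)) \<longlonglongrightarrow> \<Theta> (fst (V t))"
      using continuous_on_tendsto_compose[OF Th(1) Yl] by auto
    moreover have "(\<lambda>k. \<Theta> (Y (s (q k)) t)) \<longlonglongrightarrow> snd (V t)" using tendsto_snd[OF q(2)] by simp
    ultimately show ?case using LIMSEQ_unique by blast
  qed
  have Vi: "integrable M (\<lambda>t. fst (V t))" "integrable M (\<lambda>t. snd (V t))"
    "(LINT t|M. snd (V t)) = snd (integral\<^sup>L M V)" and fsnd: "(LINT t|M. snd (?f k t)) = snd (integral\<^sup>L M (?f k))" for k
    by (rule integrable_bounded_linear[OF bounded_linear_fst V(1)] integrable_bounded_linear[OF bounded_linear_snd V(1)]
      integral_bounded_linear[OF bounded_linear_snd V(1)] integral_bounded_linear[OF bounded_linear_snd fi])+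
  have "(LINT t|M. \<Theta> (fst (V t))) = (LINT t|M. snd (V t))"
    using Vt Vi measurable_compose[OF borel_measurable_integrable[OF Vi(1)] Thm]
    by (intro integral_cong_AE) (auto elim: eventually_mono)
  moreover have "(\<lambda>k. LINT t|M. \<Theta> (Y (s k) t)) \<longlonglongrightarrow> snd l"
    using tendsto_snd[OF lim] fsnd by simp
  ultimately have "(\<lambda>k. LINT t|M. \<Theta> (Y (s k) t)) \<longlonglongrightarrow> (LINT t|M. \<Theta> (fst (V t)))"
    using V(3) Vi(3) by simp
  then show ?thesis using l(1) Vi(1) Vt by (intro exI[of _ s] exI[of _ "\<lambda>t. fst (V t)"]) (auto elim: eventually_mono)
qed

end

section \<open>The penalised problem\<close>

definition smooth_norm :: "real \<Rightarrow> 'a::real_inner \<Rightarrow> real" where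
  "smooth_norm a y = sqrt (y \<bullet> y + a^2)"

lemma smooth_norm_ge: "norm y \<le> smooth_norm a y"
  unfolding smooth_norm_def norm_eq_sqrt_inner by (rule real_sqrt_le_mono) simp

lemma smooth_norm_ge': "0 \<le> a \<Longrightarrow> a \<le> smooth_norm a y"
  unfolding smooth_norm_def by (intro real_le_rsqrt) simp

lemma smooth_norm_le: "0 \<le> a \<Longrightarrow> smooth_norm a y \<le> norm y + a"
  unfolding smooth_norm_def
  by (rule real_le_lsqrt) (auto simp: power2_sum power2_norm_eq_inner)

lemma smooth_norm_continuous [continuous_intros]:
  "continuous_on S f \<Longrightarrow> continuous_on S (\<lambda>x. smooth_norm a (f x))"
  unfolding smooth_norm_def by (intro continuous_intros)

lemma smooth_norm_derivative:
  assumes "a > 0"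
  shows "(smooth_norm a has_derivative (\<lambda>d. (y /\<^sub>R smooth_norm a y) \<bullet> d)) (at y)"
proof -
  have pos: "0 < y \<bullet> y + a^2" using assms by (intro add_nonneg_pos) auto
  have "((\<lambda>y. y \<bullet> y + a^2) has_derivative (\<lambda>d. 2 * (y \<bullet> d))) (at y)"
    by (auto intro!: derivative_eq_intros simp: inner_commute)
  from has_derivative_real_sqrt[OF pos this]
  have "((\<lambda>y. sqrt (y \<bullet> y + a^2)) has_derivative (\<lambda>d. 2 * (y \<bullet> d) * (inverse (sqrt (y \<bullet> y + a^2)) / 2))) (at y)" .
  then show ?thesis unfolding smooth_norm_def[abs_def] by (simp add: mult.commute)
qed

text \<open>The first bound will keep the directions \<open>ws\<close> bounded in the supremum norm;
  the second, with the scale \<open>dl\<close>, makes the gradient small in mean when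
  \<open>Y\<close> is small in L1.\<close>

lemma smooth_norm_gradient_bound:
  assumes "a > 0"
  shows "norm (y /\<^sub>R smooth_norm a y) \<le> 1" "norm (y /\<^sub>R smooth_norm a y) \<le> norm y / a"
proof -
  have pos: "smooth_norm a y > 0" using smooth_norm_ge'[of a y] assms by linarith
  show "norm (y /\<^sub>R smooth_norm a y) \<le> 1"
    using smooth_norm_ge[of y a] pos by (simp add: divide_le_eq divide_inverse[symmetric] mult.commute)
  have "norm y * inverse (smooth_norm a y) \<le> norm y * inverse a"
    using smooth_norm_ge'[of a y] assms by (intro mult_left_mono le_imp_inverse_le) auto
  then show "norm (y /\<^sub>R smooth_norm a y) \<le> norm y / a"
    using pos by (simp add: divide_inverse mult.commute)
qed

text \<open>Assumption \<open>reg\<close> is regular normality with \<open>Y = ys - ysbar\<close>. It only sees the mean of \<open>Y\<close>; the penalty in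
  \<open>q\<close> below is \<open>e * norm Y\<close> where \<open>Y\<close> is small and outweighs \<open>w \<bullet> Y\<close> where \<open>norm Y \<ge> 2 * dl\<close>, while its slope
  stays bounded.\<close>

locale normal_approximation = integrand_selection +
  fixes v w :: 'b and e d0 :: real
  assumes e: "0 < e" and d0: "0 < d0"
    and reg: "\<And>x Y. norm (x - xbar) < d0 \<Longrightarrow> x \<in> cball xbar (\<rho>/8) \<Longrightarrow> integrable M Y \<Longrightarrow>
       (AE t in M. (x, Y t) \<in> K (\<rho>/8) t) \<Longrightarrow> norm (integral\<^sup>L M Y) < d0 \<Longrightarrow>
       v \<bullet> (x - xbar) - w \<bullet> integral\<^sup>L M Y \<le> e/4 * (norm (x - xbar) + norm (integral\<^sup>L M Y))"
begin

abbreviation "\<mu>T \<equiv> measure M (space M)"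

text \<open>The scale below which a selection is so small pointwise that its mean is smaller than
  \<open>d0\<close>; the \<open>+ 1\<close> covers total measure zero.\<close>

definition dl :: real where "dl = d0 / (4 * (\<mu>T + 1))"

lemma dl_bounds: "0 < dl" "2 * dl * \<mu>T < d0"
proof -
  have p: "\<mu>T + 1 > 0" using measure_nonneg[of M "space M"] by linarith
  then show d: "0 < dl" using d0 by (simp add: dl_def)
  have "2 * dl * \<mu>T \<le> 2 * dl * (\<mu>T + 1)" using d by simp
  also have "\<dots> = d0 / 2" using p by (simp add: dl_def field_simps)
  finally show "2 * dl * \<mu>T < d0" using d0 by simp
qed

definition q :: "'b \<Rightarrow> real" where
  "q y = w \<bullet> y + e * norm y + 2 * norm w * (smooth_norm dl y - dl)"

lemma q_ge: "w \<bullet> y + e * norm y \<le> q y"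
  using smooth_norm_ge'[of dl y] dl_bounds by (simp add: q_def)

text \<open>Beyond \<open>2 * dl\<close> the smoothed norm exceeds its minimum \<open>dl\<close> by
  at least half the norm; with the coefficient \<open>2 * norm w\<close> this compensates
  \<open>w \<bullet> y\<close>.\<close>

lemma q_far:
  assumes "2 * dl \<le> norm y" shows "e * norm y \<le> q y"
proof -
  have "norm y / 2 \<le> smooth_norm dl y - dl" using smooth_norm_ge[of y dl] assms by linarith
  then have "2 * norm w * (norm y / 2) \<le> 2 * norm w * (smooth_norm dl y - dl)" by (intro mult_left_mono) auto
  moreover have "- (norm w * norm y) \<le> w \<bullet> y" using Cauchy_Schwarz_ineq2[of w y] by linarith
  ultimately show ?thesis by (simp add: q_def)
qed

lemma q_lower: "- (2 * dl * norm w) \<le> q y"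
proof (cases "2 * dl \<le> norm y")
  case True
  then have "e * norm y \<le> q y" by (rule q_far)
  moreover have "0 \<le> e * norm y" "0 \<le> 2 * dl * norm w" using e dl_bounds by auto
  ultimately show ?thesis by linarith
next
  case False
  have "\<bar>w \<bullet> y\<bar> \<le> norm w * norm y" by (rule Cauchy_Schwarz_ineq2)
  also have "\<dots> \<le> norm w * (2 * dl)" using False by (intro mult_left_mono) auto
  finally have "- (2 * dl * norm w) \<le> w \<bullet> y" by (simp add: mult.commute mult.left_commute abs_le_iff)
  moreover have "0 \<le> e * norm y" using e by simp
  ultimately show ?thesis using q_ge[of y] by linarith
qed

lemma q_growth: "\<bar>q y\<bar> \<le> (3 * norm w + e) * norm y"
proof -
  have "\<bar>w \<bullet> y\<bar> \<le> norm w * norm y" by (rule Cauchy_Schwarz_ineq2)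
  moreover have "2 * norm w * (smooth_norm dl y - dl) \<le> 2 * norm w * norm y"
    using smooth_norm_le[of dl y] dl_bounds by (intro mult_left_mono) auto
  moreover have "0 \<le> 2 * norm w * (smooth_norm dl y - dl)" using smooth_norm_ge'[of dl y] dl_bounds by simp
  moreover have "0 \<le> e * norm y" using e by simp
  ultimately show ?thesis unfolding q_def by (simp add: algebra_simps abs_le_iff)
qed

lemma q_continuous: "continuous_on UNIV q"
  unfolding q_def[abs_def] by (intro continuous_intros)

lemma q_measurable [measurable]: "q \<in> borel_measurable borel"
  by (rule borel_measurable_continuous_onI[OF q_continuous])

lemma q_integrable:
  assumes "integrable M Y" shows "integrable M (\<lambda>t. q (Y t))"
proof (rule Bochner_Integration.integrable_bound)
  show "integrable M (\<lambda>t. (3 * norm w + e) * norm (Y t))" using assms by auto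
  show "(\<lambda>t. q (Y t)) \<in> borel_measurable M" using assms by measurable
  show "AE t in M. norm (q (Y t)) \<le> norm ((3 * norm w + e) * norm (Y t))"
    using q_growth by (auto intro!: AE_I2 intro: order_trans[OF _ abs_ge_self])
qed

lemma radius_bounds: "0 < \<rho>/8" "0 \<le> \<rho>/8" "\<rho>/8 < \<rho>/4"
  using rho by auto

text \<open>The part of \<open>Y\<close> below \<open>2 * dl\<close> has a mean smaller than
  \<open>d0\<close> and obeys regular normality, at the price of a quarter of \<open>e\<close>; the
  part beyond is handled by \<open>q_far\<close>.\<close>

lemma center_estimate:
  assumes Y: "integrable M Y" "AE t in M. (xbar, Y t) \<in> K (\<rho>/8) t"
  shows "3/4 * e * (LINT t|M. norm (Y t)) \<le> (LINT t|M. q (Y t))"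
proof -
  define S where "S = {t\<in>space M. norm (Y t) < 2 * dl}"
  have [measurable]: "Y \<in> borel_measurable M" using Y by simp
  have S: "S \<in> sets M" unfolding S_def by measurable
  \<comment> \<open>Replacing large values by zero is legitimate because \<open>(xbar, 0)\<close>
    lies in every \<open>K (\<rho>/8) t\<close>. This uses that the common point is
    \<open>xbar\<close>.\<close>
  define Z where "Z t = indicator S t *\<^sub>R Y t" for t
  have Z: "integrable M Z" unfolding Z_def by (intro integrable_mult_indicator S Y)
  have ZK: "AE t in M. (xbar, Z t) \<in> K (\<rho>/8) t"
    using Y(2) by eventually_elim (use K_center[OF radius_bounds(2)] in \<open>auto simp: Z_def split: split_indicator\<close>)
  have nZ: "norm (integral\<^sup>L M Z) \<le> (LINT t|M. norm (Z t))" by (rule integral_norm_bound)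
  also have "\<dots> \<le> (LINT t|M. 2 * dl)"
    using dl_bounds by (intro integral_mono integrable_norm Z) (auto simp: Z_def S_def split: split_indicator)
  also have "\<dots> = 2 * dl * \<mu>T" by simp
  finally have "norm (integral\<^sup>L M Z) < d0" using dl_bounds by simp
  from reg[of xbar, OF _ _ Z ZK this] have "- (w \<bullet> integral\<^sup>L M Z) \<le> e/4 * norm (integral\<^sup>L M Z)"
    using d0 rho by simp
  also have "\<dots> \<le> e/4 * (LINT t|M. norm (Z t))" using nZ e by (intro mult_left_mono) auto
  also have "\<dots> \<le> e/4 * (LINT t|M. norm (Y t))"
    using e by (intro mult_left_mono integral_mono integrable_norm Z Y) (auto simp: Z_def split: split_indicator)
  finally have 1: "- (e/4 * (LINT t|M. norm (Y t))) \<le> w \<bullet> integral\<^sup>L M Z" by simp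
  have "w \<bullet> integral\<^sup>L M Z + e * (LINT t|M. norm (Y t)) = (LINT t|M. w \<bullet> Z t + e * norm (Y t))"
    using Z Y by (simp add: Bochner_Integration.integral_add)
  also have "\<dots> \<le> (LINT t|M. q (Y t))"
    using q_ge q_far
    by (intro integral_mono q_integrable Bochner_Integration.integrable_add integrable_mult_right integrable_inner_right integrable_norm Z Y)
       (auto simp: Z_def S_def not_less split: split_indicator)
  finally show ?thesis using 1 by (simp add: field_simps)
qed

lemma q_norm_pair: "continuous_on UNIV (\<lambda>y. (q y, norm y))" "norm (q y, norm y) \<le> (3 * norm w + e + 1) * norm y"
proof -
  show "continuous_on UNIV (\<lambda>y. (q y, norm y))" by (intro continuous_intros q_continuous)
  show "norm (q y, norm y) \<le> (3 * norm w + e + 1) * norm y"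
    using norm_Pair_le[of "q y" "norm y"] q_growth[of y] by (simp add: distrib_right)
qed

text \<open>One selection \<open>Z\<close> has to serve both \<open>q\<close> and the norm, hence
  the vector-valued \<open>\<Theta>\<close>.\<close>

lemma selection_limit_q:
  assumes Ym: "\<And>k. Y k \<in> borel_measurable M" and XY: "\<And>k. AE t in M. (X k t, Y k t) \<in> K (\<rho>/8) t"
    and X: "AE t in M. (\<lambda>k. X k t) \<longlonglongrightarrow> x"
  shows "\<exists>s Z. strict_mono s \<and> integrable M Z \<and> (AE t in M. (x, Z t) \<in> K (\<rho>/8) t) \<and>
     (\<lambda>k. LINT t|M. q (Y (s k) t)) \<longlonglongrightarrow> (LINT t|M. q (Z t)) \<and>
     (\<lambda>k. LINT t|M. norm (Y (s k) t)) \<longlonglongrightarrow> (LINT t|M. norm (Z t))"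
proof -
  obtain s Z where s: "strict_mono s" "integrable M Z" "AE t in M. (x, Z t) \<in> K (\<rho>/8) t"
     "(\<lambda>k. LINT t|M. (q (Y (s k) t), norm (Y (s k) t))) \<longlonglongrightarrow> (LINT t|M. (q (Z t), norm (Z t)))"
    using selection_limit[OF radius_bounds(2,3) Ym XY X q_norm_pair] by blast
  have Yi: "integrable M (Y k)" for k
  proof (rule Bochner_Integration.integrable_bound[OF bnd_integrable Ym])
    show "AE t in M. norm (Y k t) \<le> norm (bnd t)"
      using XY[of k] by eventually_elim (use K_snd[OF radius_bounds(2,3)] bnd_nonneg in force)
  qed
  have pair: "fst (LINT t|M. (q (U t), norm (U t))) = (LINT t|M. q (U t))"
     "snd (LINT t|M. (q (U t), norm (U t))) = (LINT t|M. norm (U t))" if "integrable M U" for U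
  proof -
    have [measurable]: "U \<in> borel_measurable M" using that by simp
    have i: "integrable M (\<lambda>t. (q (U t), norm (U t)))"
    proof (rule Bochner_Integration.integrable_bound)
      show "integrable M (\<lambda>t. (3 * norm w + e + 1) * norm (U t))" using that by auto
      show "(\<lambda>t. (q (U t), norm (U t))) \<in> borel_measurable M" by (intro borel_measurable_Pair) measurable
      show "AE t in M. norm (q (U t), norm (U t)) \<le> norm ((3 * norm w + e + 1) * norm (U t))"
        using q_norm_pair(2) by (auto intro!: AE_I2 intro: order_trans[OF _ abs_ge_self])
    qed
    show "fst (LINT t|M. (q (U t), norm (U t))) = (LINT t|M. q (U t))"
      using integral_bounded_linear[OF bounded_linear_fst i] by simp
    show "snd (LINT t|M. (q (U t), norm (U t))) = (LINT t|M. norm (U t))"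
      using integral_bounded_linear[OF bounded_linear_snd i] by simp
  qed
  show ?thesis using s(1-3) tendsto_fst[OF s(4)] tendsto_snd[OF s(4)]
    unfolding pair[OF Yi] pair[OF s(2)] by blast
qed

text \<open>Away from \<open>xbar\<close> the value zero need not be admissible, so truncation fails
  and compactness replaces it: counterexamples with \<open>x\<close> tending to \<open>xbar\<close>
  would have a limit selection at the centre, where \<open>center_estimate\<close> applies.\<close>

lemma local_estimate:
  "\<exists>r1>0. r1 \<le> \<rho>/8 \<and> r1 \<le> e \<and> (\<forall>x\<in>cball xbar r1. \<forall>Y. integrable M Y \<longrightarrow> (AE t in M. (x, Y t) \<in> K (\<rho>/8) t) \<longrightarrow>
     e/2 * (norm (x - xbar) + (LINT t|M. norm (Y t)))
       \<le> - (v \<bullet> (x - xbar)) + e * norm (x - xbar) + (LINT t|M. q (Y t)))"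
proof (rule ccontr)
  assume neg: "\<not> ?thesis"
  define r0 where "r0 = min (\<rho>/8) e"
  have r0: "0 < r0" "r0 \<le> \<rho>/8" "r0 \<le> e" using radius_bounds e by (auto simp: r0_def)
  have rk: "0 < r0 / real (Suc k)" "r0 / real (Suc k) \<le> r0" for k
    using r0(1) by (simp_all add: divide_le_eq mult_le_cancel_left1 del: of_nat_Suc)
  have "\<exists>x Y. x \<in> cball xbar (r0 / real (Suc k)) \<and> integrable M Y \<and> (AE t in M. (x, Y t) \<in> K (\<rho>/8) t) \<and>
     - (v \<bullet> (x - xbar)) + e * norm (x - xbar) + (LINT t|M. q (Y t)) < e/2 * (norm (x - xbar) + (LINT t|M. norm (Y t)))" for k
  proof (rule ccontr)
    assume no: "\<not> ?thesis"
    have "\<exists>r1>0. r1 \<le> \<rho>/8 \<and> r1 \<le> e \<and> (\<forall>x\<in>cball xbar r1. \<forall>Y. integrable M Y \<longrightarrow> (AE t in M. (x, Y t) \<in> K (\<rho>/8) t) \<longrightarrow>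
     e/2 * (norm (x - xbar) + (LINT t|M. norm (Y t)))
       \<le> - (v \<bullet> (x - xbar)) + e * norm (x - xbar) + (LINT t|M. q (Y t)))"
    proof (intro exI[of _ "r0 / real (Suc k)"] conjI ballI allI impI)
      fix x Y assume "x \<in> cball xbar (r0 / real (Suc k))" "integrable M Y" "AE t in M. (x, Y t) \<in> K (\<rho>/8) t"
      then show "e/2 * (norm (x - xbar) + (LINT t|M. norm (Y t)))
       \<le> - (v \<bullet> (x - xbar)) + e * norm (x - xbar) + (LINT t|M. q (Y t))"
        using no not_le by blast
    qed (use rk[of k] r0 in linarith)+
    then show False using neg by blast
  qed
  then have "\<forall>k. \<exists>p. fst p \<in> cball xbar (r0 / real (Suc k)) \<and> integrable M (snd p) \<and> (AE t in M. (fst p, snd p t) \<in> K (\<rho>/8) t) \<and>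
     - (v \<bullet> (fst p - xbar)) + e * norm (fst p - xbar) + (LINT t|M. q (snd p t)) < e/2 * (norm (fst p - xbar) + (LINT t|M. norm (snd p t)))"
    by (simp only: split_paired_Ex fst_conv snd_conv simp_thms)
  from choice[OF this] obtain p where p: "\<forall>k. fst (p k) \<in> cball xbar (r0 / real (Suc k)) \<and> integrable M (snd (p k)) \<and>
     (AE t in M. (fst (p k), snd (p k) t) \<in> K (\<rho>/8) t) \<and>
     - (v \<bullet> (fst (p k) - xbar)) + e * norm (fst (p k) - xbar) + (LINT t|M. q (snd (p k) t))
       < e/2 * (norm (fst (p k) - xbar) + (LINT t|M. norm (snd (p k) t)))"
    by (rule exE)
  define x Y where "x k = fst (p k)" and "Y k = snd (p k)" for k
  have xY: "x k \<in> cball xbar (r0 / real (Suc k))" "integrable M (Y k)"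
    "AE t in M. (x k, Y k t) \<in> K (\<rho>/8) t"
    "- (v \<bullet> (x k - xbar)) + e * norm (x k - xbar) + (LINT t|M. q (Y k t)) < e/2 * (norm (x k - xbar) + (LINT t|M. norm (Y k t)))" for k
    using p[rule_format, of k] unfolding x_def Y_def by blast+
  have l0: "(\<lambda>k. r0 / real (Suc k)) \<longlonglongrightarrow> 0" using LIMSEQ_Suc[OF lim_const_over_n[of r0]] by simp
  have xl: "x \<longlonglongrightarrow> xbar"
  proof (rule LIM_zero_cancel, rule Lim_null_comparison[OF _ l0])
    show "\<forall>\<^sub>F k in sequentially. norm (x k - xbar) \<le> r0 / real (Suc k)"
      using xY(1) by (auto simp: dist_norm norm_minus_commute)
  qed
  have "\<exists>s Z. strict_mono s \<and> integrable M Z \<and> (AE t in M. (xbar, Z t) \<in> K (\<rho>/8) t) \<and>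
     (\<lambda>k. LINT t|M. q (Y (s k) t)) \<longlonglongrightarrow> (LINT t|M. q (Z t)) \<and>
     (\<lambda>k. LINT t|M. norm (Y (s k) t)) \<longlonglongrightarrow> (LINT t|M. norm (Z t))"
    using xY(2,3) xl by (intro selection_limit_q[where X="\<lambda>k t. x k"]) auto
  then obtain s Z where s: "strict_mono s" "integrable M Z" "AE t in M. (xbar, Z t) \<in> K (\<rho>/8) t"
     "(\<lambda>k. LINT t|M. q (Y (s k) t)) \<longlonglongrightarrow> (LINT t|M. q (Z t))"
     "(\<lambda>k. LINT t|M. norm (Y (s k) t)) \<longlonglongrightarrow> (LINT t|M. norm (Z t))" by blast
  have xs: "(\<lambda>k. x (s k)) \<longlonglongrightarrow> xbar" using LIMSEQ_subseq_LIMSEQ[OF xl s(1)] by (simp add: o_def)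
  have "- (v \<bullet> (xbar - xbar)) + e * norm (xbar - xbar) + (LINT t|M. q (Z t)) \<le> e/2 * (norm (xbar - xbar) + (LINT t|M. norm (Z t)))"
  proof (rule LIMSEQ_le)
    show "(\<lambda>k. - (v \<bullet> (x (s k) - xbar)) + e * norm (x (s k) - xbar) + (LINT t|M. q (Y (s k) t))) \<longlonglongrightarrow>
      - (v \<bullet> (xbar - xbar)) + e * norm (xbar - xbar) + (LINT t|M. q (Z t))"
      by (intro tendsto_intros xs s)
    show "(\<lambda>k. e/2 * (norm (x (s k) - xbar) + (LINT t|M. norm (Y (s k) t)))) \<longlonglongrightarrow> e/2 * (norm (xbar - xbar) + (LINT t|M. norm (Z t)))"
      by (intro tendsto_intros xs s)
  qed (use xY(4) less_imp_le in blast)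
  \<comment> \<open>The factor 3/4 at the centre against the assumed failure of 1/2 makes
    \<open>Z\<close> vanish. Hence the L1 norms of the counterexamples tend to zero, their means
    drop below \<open>d0\<close>, and regular normality applies to them without truncation.\<close>
  with center_estimate[OF s(2,3)] have "3/4 * e * (LINT t|M. norm (Z t)) \<le> e/2 * (LINT t|M. norm (Z t))" by simp
  then have "e * (LINT t|M. norm (Z t)) \<le> 0" by linarith
  then have "(LINT t|M. norm (Z t)) = 0" using e by (simp add: mult_le_0_iff order_antisym integral_nonneg_AE)
  then have "\<forall>\<^sub>F k in sequentially. (LINT t|M. norm (Y (s k) t)) < d0 \<and> dist (x (s k)) xbar < d0"
    using s(5) d0 by (intro eventually_conj order_tendstoD(2)[OF s(5)] tendstoD[OF xs]) auto
  then obtain k where k: "(LINT t|M. norm (Y (s k) t)) < d0" "norm (x (s k) - xbar) < d0"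
    by (auto simp: eventually_sequentially dist_norm)
  let ?x = "x (s k)" and ?Y = "Y (s k)"
  have nY: "norm (integral\<^sup>L M ?Y) \<le> (LINT t|M. norm (?Y t))" by (rule integral_norm_bound)
  have "?x \<in> cball xbar (\<rho>/8)" using xY(1)[of "s k"] rk(2)[of "s k"] r0(2) by (auto simp del: of_nat_Suc)
  from reg[OF k(2) this xY(2,3)] nY k(1)
  have "v \<bullet> (?x - xbar) - w \<bullet> integral\<^sup>L M ?Y \<le> e/4 * (norm (?x - xbar) + norm (integral\<^sup>L M ?Y))" by linarith
  also have "\<dots> \<le> e/4 * (norm (?x - xbar) + (LINT t|M. norm (?Y t)))" using nY e by (intro mult_left_mono) auto
  finally have 1: "v \<bullet> (?x - xbar) - w \<bullet> integral\<^sup>L M ?Y \<le> e/4 * (norm (?x - xbar) + (LINT t|M. norm (?Y t)))" .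
  have "w \<bullet> integral\<^sup>L M ?Y + e * (LINT t|M. norm (?Y t)) = (LINT t|M. w \<bullet> ?Y t + e * norm (?Y t))"
    using xY(2) by (simp add: Bochner_Integration.integral_add)
  also have "\<dots> \<le> (LINT t|M. q (?Y t))" using xY(2) q_ge by (intro integral_mono q_integrable) auto
  finally have 2: "w \<bullet> integral\<^sup>L M ?Y + e * (LINT t|M. norm (?Y t)) \<le> (LINT t|M. q (?Y t))" .
  have "0 \<le> e * norm (?x - xbar)" "0 \<le> e * (LINT t|M. norm (?Y t))" using e by auto
  \<comment> \<open>Here \<open>e - e/4\<close> on one side exceeds \<open>e/2\<close> on the other,
    while both factors are nonnegative.\<close>
  then show False using 1 2 xY(4)[of "s k"] by (simp add: distrib_left)
qed

text \<open>The smoothing \<open>1/k\<close> of the norm avoids a nonsmooth sum rule at the minimisers.\<close>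

definition cost :: "real \<Rightarrow> 'b \<Rightarrow> 'b \<times> 'b \<Rightarrow> real" where
  "cost k x z = w \<bullet> snd z + e * smooth_norm (1/k) (snd z) + 2 * norm w * (smooth_norm dl (snd z) - dl)
     + k * ((fst z - x) \<bullet> (fst z - x))"

lemma cost_ge: "q (snd z) + k * ((fst z - x) \<bullet> (fst z - x)) \<le> cost k x z"
  using mult_left_mono[OF smooth_norm_ge[of "snd z" "1/k"], of e] e by (simp add: q_def cost_def)

lemma cost_center: "k > 0 \<Longrightarrow> cost k x (xbar, 0) = e / k + k * ((xbar - x) \<bullet> (xbar - x))"
  using dl_bounds by (simp add: cost_def smooth_norm_def)

lemma cost_continuous: "continuous_on UNIV (cost k x)"
  unfolding cost_def[abs_def] by (intro continuous_intros)

lemma cost_bound: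
  assumes k: "k > 0" and x: "x \<in> cball xbar r" and z: "fst z \<in> cball xbar r"
  shows "\<bar>cost k x z\<bar> \<le> (3 * norm w + e) * norm (snd z) + (e / k + k * (2 * r)^2)"
proof -
  have 1: "\<bar>w \<bullet> snd z\<bar> \<le> norm w * norm (snd z)" by (rule Cauchy_Schwarz_ineq2)
  have 2: "2 * norm w * (smooth_norm dl (snd z) - dl) \<le> 2 * norm w * norm (snd z)"
    using smooth_norm_le[of dl "snd z"] dl_bounds by (intro mult_left_mono) auto
  have 3: "0 \<le> 2 * norm w * (smooth_norm dl (snd z) - dl)" using smooth_norm_ge'[of dl "snd z"] dl_bounds by simp
  have 4: "e * smooth_norm (1/k) (snd z) \<le> e * (norm (snd z) + 1/k)"
    using smooth_norm_le[of "1/k" "snd z"] e k by (intro mult_left_mono) auto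
  have 5: "0 \<le> e * smooth_norm (1/k) (snd z)" using e smooth_norm_ge[of "snd z" "1/k"] norm_ge_zero[of "snd z"]
    by (intro mult_nonneg_nonneg) linarith+
  have "norm (fst z - x) \<le> 2 * r"
    using norm_triangle_ineq4[of "fst z - xbar" "x - xbar"] x z by (simp add: dist_norm norm_minus_commute)
  then have "(norm (fst z - x))^2 \<le> (2 * r)^2" by (intro power_mono) auto
  then have 6: "k * ((fst z - x) \<bullet> (fst z - x)) \<le> k * (2 * r)^2"
    using k by (intro mult_left_mono) (auto simp: power2_norm_eq_inner)
  have 7: "0 \<le> k * ((fst z - x) \<bullet> (fst z - x))" using k by simp
  have 8: "0 \<le> e / k" using e k by simp
  have 9: "e * (norm (snd z) + 1/k) = e * norm (snd z) + e / k" by (simp add: distrib_left)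
  show ?thesis unfolding cost_def abs_le_iff distrib_right
    using 1 2 3 4 5 6 7 8 9 by (auto simp: abs_le_iff)
qed

lemma cost_integrable:
  assumes k: "k > 0" and r: "0 \<le> r" "r \<le> \<rho>/8" and x: "x \<in> cball xbar r"
    and f: "f \<in> borel_measurable M" "\<And>t. t \<in> space M \<Longrightarrow> f t \<in> K r t"
  shows "integrable M (\<lambda>t. cost k x (f t))"
proof (rule Bochner_Integration.integrable_bound)
  let ?g = "\<lambda>t. (3 * norm w + e) * bnd t + (e / k + k * (2 * r)^2)"
  show "integrable M ?g" using bnd_integrable by auto
  show "(\<lambda>t. cost k x (f t)) \<in> borel_measurable M"
    by (rule measurable_compose[OF f(1) borel_measurable_continuous_onI[OF cost_continuous]])
  show "AE t in M. norm (cost k x (f t)) \<le> norm (?g t)"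
  proof (rule AE_I2)
    fix t assume t: "t \<in> space M"
    have ft: "(fst (f t), snd (f t)) \<in> K r t" using f(2)[OF t] by simp
    have "\<bar>cost k x (f t)\<bar> \<le> (3 * norm w + e) * norm (snd (f t)) + (e / k + k * (2 * r)^2)"
      using cost_bound[OF k x K_fst[OF r(1) ft]] by simp
    also have "\<dots> \<le> ?g t" using K_snd[OF r(1) _ ft] r(2) radius_bounds(3) e by (intro add_right_mono mult_left_mono) auto
    finally show "norm (cost k x (f t)) \<le> norm (?g t)" by simp
  qed
qed

text \<open>The selection stays fixed while \<open>x\<close> varies. The term
  \<open>e * norm (x - xbar)\<close> absorbs the error in regular normality and costs at most
  \<open>e\<close> in the optimality condition for \<open>x\<close>.\<close>

definition J :: "real \<Rightarrow> ('a \<Rightarrow> 'b \<times> 'b) \<Rightarrow> 'b \<Rightarrow> real" where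
  "J k f x = - (v \<bullet> (x - xbar)) + e * norm (x - xbar) + (LINT t|M. cost k x (f t))"

text \<open>Only minimality in each argument separately is recorded, since only partial first-order
  conditions are used. The last conjunct compares with the value at \<open>xbar\<close> and the
  constant selection \<open>(xbar, 0)\<close>.\<close>

definition minimiser :: "real \<Rightarrow> real \<Rightarrow> 'b \<Rightarrow> ('a \<Rightarrow> 'b \<times> 'b) \<Rightarrow> bool" where
  "minimiser r k x f \<longleftrightarrow> x \<in> cball xbar r \<and> f \<in> borel_measurable M \<and>
    (\<forall>t\<in>space M. f t \<in> K r t \<and> (\<forall>z\<in>K r t. cost k x (f t) \<le> cost k x z)) \<and>
    (\<forall>x'\<in>cball xbar r. J k f x \<le> J k f x') \<and> J k f x \<le> e / k * \<mu>T"

text \<open>For each \<open>x\<close> the integrand is minimised pointwise by a measurable selection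
  \<open>S x\<close>. The value \<open>F\<close> is Lipschitz in \<open>x\<close>, because the cost
  is so uniformly over the ball, and attains its minimum there.\<close>

lemma minimiser_exists:
  assumes k: "k > 0" and r: "0 < r" "r \<le> \<rho>/8"
  shows "\<exists>x f. minimiser r k x f"
proof -
  have r': "0 \<le> r" "r < \<rho>/4" using r radius_bounds by auto
  have Kt: "compact (K r t)" "K r t \<noteq> {}" for t using K_compact[OF r'] K_center[OF r'(1)] by auto
  have cm: "continuous_on UNIV (\<lambda>z. - cost k x z)" for x by (intro continuous_intros cost_continuous)
  have "\<exists>f. f \<in> borel_measurable M \<and> (\<forall>t\<in>space M. f t \<in> K r t \<and> (\<forall>z\<in>K r t. cost k x (f t) \<le> cost k x z))" for x
  proof -
    obtain f where f: "f \<in> borel_measurable M"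
      "\<forall>t\<in>space M. f t \<in> K r t \<and> - cost k x (f t) = max_value (\<lambda>z. - cost k x z) (K r t)"
      using argmax_selection[OF K_multifunction[OF r'] cm[of x]] by blast
    have "cost k x (f t) \<le> cost k x z" if "t \<in> space M" "z \<in> K r t" for t z
      using max_value_ge[OF Kt(1) cm[of x] that(2)] f(2) that(1) by fastforce
    then show ?thesis using f by blast
  qed
  then obtain S where S: "\<And>x. S x \<in> borel_measurable M" "\<And>x t. t \<in> space M \<Longrightarrow> S x t \<in> K r t"
     "\<And>x t z. t \<in> space M \<Longrightarrow> z \<in> K r t \<Longrightarrow> cost k x (S x t) \<le> cost k x z" by metis
  have int: "integrable M (\<lambda>t. cost k x (S x' t))" if "x \<in> cball xbar r" for x x'
    by (rule cost_integrable[OF k r'(1) r(2) that S(1,2)])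
  define F where "F x = - (v \<bullet> (x - xbar)) + e * norm (x - xbar) + (LINT t|M. cost k x (S x t))" for x
  have diff: "cost k x z \<le> cost k x' z + 4 * r * k * norm (x - x')"
    if x: "x \<in> cball xbar r" "x' \<in> cball xbar r" and z: "fst z \<in> cball xbar r" for x x' z
  proof -
    have "(fst z - x) \<bullet> (fst z - x) - (fst z - x') \<bullet> (fst z - x') = (x' - x) \<bullet> ((fst z - x) + (fst z - x'))"
      by (simp add: algebra_simps inner_diff_left inner_diff_right inner_commute)
    also have "\<dots> \<le> norm (x' - x) * norm ((fst z - x) + (fst z - x'))" by (rule norm_cauchy_schwarz)
    also have "\<dots> \<le> norm (x' - x) * (4 * r)"
    proof (rule mult_left_mono)
      have "norm (fst z - y) \<le> 2 * r" if "y \<in> cball xbar r" for y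
        using norm_triangle_ineq4[of "fst z - xbar" "y - xbar"] that z by (simp add: dist_norm norm_minus_commute)
      from this[OF x(1)] this[OF x(2)] show "norm ((fst z - x) + (fst z - x')) \<le> 4 * r"
        using norm_triangle_ineq[of "fst z - x" "fst z - x'"] by linarith
    qed simp
    finally have "k * ((fst z - x) \<bullet> (fst z - x) - (fst z - x') \<bullet> (fst z - x')) \<le> k * (norm (x' - x) * (4 * r))"
      using k by (intro mult_left_mono) auto
    then show ?thesis by (simp add: cost_def norm_minus_commute algebra_simps)
  qed
  have lip: "(LINT t|M. cost k x (S x t)) \<le> (LINT t|M. cost k x' (S x' t)) + 4 * r * k * norm (x - x') * \<mu>T"
    if x: "x \<in> cball xbar r" "x' \<in> cball xbar r" for x x'
  proof -
    have "(LINT t|M. cost k x (S x t)) \<le> (LINT t|M. cost k x' (S x' t) + 4 * r * k * norm (x - x'))"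
    proof (intro integral_mono int x Bochner_Integration.integrable_add)
      fix t assume t: "t \<in> space M"
      have "fst (S x' t) \<in> cball xbar r" using K_fst[OF r'(1), of "fst (S x' t)" "snd (S x' t)"] S(2)[OF t] by auto
      then show "cost k x (S x t) \<le> cost k x' (S x' t) + 4 * r * k * norm (x - x')"
        using S(3)[OF t S(2)[OF t], of x x'] diff[OF x, of "S x' t"] by linarith
    qed auto
    also have "\<dots> = (LINT t|M. cost k x' (S x' t)) + 4 * r * k * norm (x - x') * \<mu>T"
      using int[OF x(2)] by (simp add: Bochner_Integration.integral_add mult.commute)
    finally show ?thesis .
  qed
  have "(4 * r * k * \<mu>T)-lipschitz_on (cball xbar r) (\<lambda>x. LINT t|M. cost k x (S x t))"
  proof (rule lipschitz_onI)
    fix x x' assume "x \<in> cball xbar r" "x' \<in> cball xbar r"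
    then show "dist (LINT t|M. cost k x (S x t)) (LINT t|M. cost k x' (S x' t)) \<le> 4 * r * k * \<mu>T * dist x x'"
      using lip[of x x'] lip[of x' x] by (simp add: dist_norm norm_minus_commute abs_le_iff mult_ac)
  qed (use r k in auto)
  then have "continuous_on (cball xbar r) F"
    unfolding F_def[abs_def] by (intro continuous_intros lipschitz_on_continuous_on)
  then obtain x where x: "x \<in> cball xbar r" "\<And>x'. x' \<in> cball xbar r \<Longrightarrow> F x \<le> F x'"
    using continuous_attains_inf[of "cball xbar r" F] r by auto
  have JF: "J k (S x) x = F x" by (simp add: J_def F_def)
  \<comment> \<open>At \<open>x'\<close> the selection \<open>S x'\<close> is at least as good as
    \<open>S x\<close>, so minimality of \<open>F\<close> passes to the problem with frozen
    selection.\<close>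
  have "F x' \<le> J k (S x) x'" if "x' \<in> cball xbar r" for x'
    unfolding F_def J_def using S(3)[OF _ S(2)] by (intro add_left_mono integral_mono int that) auto
  then have "\<forall>x'\<in>cball xbar r. J k (S x) x \<le> J k (S x) x'" using x(2) JF by fastforce
  moreover have "J k (S x) x \<le> e / k * \<mu>T"
  proof -
    have xb: "xbar \<in> cball xbar r" using r by simp
    have "F x \<le> F xbar" by (rule x(2)[OF xb])
    also have "\<dots> = (LINT t|M. cost k xbar (S xbar t))" by (simp add: F_def)
    also have "\<dots> \<le> (LINT t|M. e / k)"
    proof (intro integral_mono int xb)
      fix t assume t: "t \<in> space M"
      show "cost k xbar (S xbar t) \<le> e / k"
        using S(3)[OF t K_center[OF r'(1)], of xbar] cost_center[OF k, of xbar] by simp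
    qed simp
    also have "\<dots> = e / k * \<mu>T" by simp
    finally show ?thesis using JF by simp
  qed
  ultimately show ?thesis unfolding minimiser_def using x(1) S by (intro exI[of _ x] exI[of _ "S x"]) auto
qed

end

section \<open>Normals at the minimisers\<close>

context normal_approximation
begin

lemma minimiser_estimates:
  assumes k: "k > 0" and r: "0 < r" "r \<le> \<rho>/8" and f: "minimiser r k x f"
  shows "integrable M (\<lambda>t. snd (f t))" "integrable M (\<lambda>t. (fst (f t) - x) \<bullet> (fst (f t) - x))"
    "- (v \<bullet> (x - xbar)) + e * norm (x - xbar) + (LINT t|M. q (snd (f t)))
       + k * (LINT t|M. (fst (f t) - x) \<bullet> (fst (f t) - x)) \<le> e / k * \<mu>T"
proof -
  have r': "0 \<le> r" "r < \<rho>/4" using r radius_bounds by auto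
  have x: "x \<in> cball xbar r" and fm: "f \<in> borel_measurable M" and fK: "\<And>t. t \<in> space M \<Longrightarrow> f t \<in> K r t"
    and J: "J k f x \<le> e / k * \<mu>T"
    using f by (auto simp: minimiser_def)
  have fm': "(\<lambda>t. fst (f t)) \<in> borel_measurable M" "(\<lambda>t. snd (f t)) \<in> borel_measurable M"
    using measurable_compose[OF fm borel_measurable_continuous_onI[OF continuous_on_fst[OF continuous_on_id]]]
      measurable_compose[OF fm borel_measurable_continuous_onI[OF continuous_on_snd[OF continuous_on_id]]] by auto
  have fK': "(fst (f t), snd (f t)) \<in> K r t" if "t \<in> space M" for t using fK[OF that] by simp
  show Y: "integrable M (\<lambda>t. snd (f t))"
  proof (rule Bochner_Integration.integrable_bound[OF bnd_integrable fm'(2)])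
    show "AE t in M. norm (snd (f t)) \<le> norm (bnd t)"
      using K_snd[OF r' fK'] bnd_nonneg by (intro AE_I2) simp
  qed
  show I: "integrable M (\<lambda>t. (fst (f t) - x) \<bullet> (fst (f t) - x))"
  proof (rule integrable_const_bound[where B="(2 * r)^2"])
    show "AE t in M. norm ((fst (f t) - x) \<bullet> (fst (f t) - x)) \<le> (2 * r)^2"
    proof (rule AE_I2)
      fix t assume "t \<in> space M"
      then have "fst (f t) \<in> cball xbar r" by (rule K_fst[OF r'(1) fK'])
      then have "norm (fst (f t) - x) \<le> 2 * r"
        using norm_triangle_ineq4[of "fst (f t) - xbar" "x - xbar"] x by (simp add: dist_norm norm_minus_commute)
      then have "(norm (fst (f t) - x))^2 \<le> (2 * r)^2" by (intro power_mono) auto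
      then show "norm ((fst (f t) - x) \<bullet> (fst (f t) - x)) \<le> (2 * r)^2" by (simp add: power2_norm_eq_inner)
    qed
    show "(\<lambda>t. (fst (f t) - x) \<bullet> (fst (f t) - x)) \<in> borel_measurable M" using fm'(1) by measurable
  qed
  have "(LINT t|M. q (snd (f t))) + k * (LINT t|M. (fst (f t) - x) \<bullet> (fst (f t) - x))
     = (LINT t|M. q (snd (f t)) + k * ((fst (f t) - x) \<bullet> (fst (f t) - x)))"
    using q_integrable[OF Y] I by simp
  also have "\<dots> \<le> (LINT t|M. cost k x (f t))"
    by (intro integral_mono Bochner_Integration.integrable_add q_integrable Y integrable_mult_right I
        cost_integrable[OF k r'(1) r(2) x fm fK] cost_ge)
  finally show "- (v \<bullet> (x - xbar)) + e * norm (x - xbar) + (LINT t|M. q (snd (f t)))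
       + k * (LINT t|M. (fst (f t) - x) \<bullet> (fst (f t) - x)) \<le> e / k * \<mu>T"
    using J by (simp add: J_def)
qed

text \<open>The penalty forces \<open>X - x\<close> to zero in L2, so along a subsequence all
  \<open>X t\<close> share the limit of the \<open>x\<close>. The limit selection at this common
  point has nonpositive value, and \<open>loc\<close> then makes the displacement and the L1 norm
  vanish; the latter is the limit of the L1 norms of the minimisers.\<close>

lemma minimisers_converge:
  assumes r: "0 < r" "r \<le> \<rho>/8"
    and loc: "\<And>x Y. x \<in> cball xbar r \<Longrightarrow> integrable M Y \<Longrightarrow> (AE t in M. (x, Y t) \<in> K (\<rho>/8) t) \<Longrightarrow>
       e/2 * (norm (x - xbar) + (LINT t|M. norm (Y t))) \<le> - (v \<bullet> (x - xbar)) + e * norm (x - xbar) + (LINT t|M. q (Y t))"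
    and h: "h > 0"
  shows "\<exists>k\<ge>N. \<exists>x f. minimiser r (real (Suc k)) x f \<and> norm (x - xbar) < h \<and> (LINT t|M. norm (snd (f t))) < h"
proof -
  have "\<exists>x f. minimiser r (real (Suc k)) x f" for k by (rule minimiser_exists[OF _ r]) simp
  then obtain x f where xf: "\<And>k. minimiser r (real (Suc k)) (x k) (f k)" by metis
  let ?d = "\<lambda>k t. (fst (f k t) - x k) \<bullet> (fst (f k t) - x k)"
  have x: "x k \<in> cball xbar r" for k using xf[of k] by (simp add: minimiser_def)
  have main: "- (v \<bullet> (x k - xbar)) + e * norm (x k - xbar) + (LINT t|M. q (snd (f k t)))
       + real (Suc k) * (LINT t|M. ?d k t) \<le> e / real (Suc k) * \<mu>T" for k
    by (rule minimiser_estimates(3)[OF _ r xf]) simp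
  have di: "integrable M (?d k)" for k by (rule minimiser_estimates(2)[OF _ r xf]) simp
  have Yi: "integrable M (\<lambda>t. snd (f k t))" for k by (rule minimiser_estimates(1)[OF _ r xf]) simp
  have d0: "0 \<le> (LINT t|M. ?d k t)" for k by (intro integral_nonneg_AE) auto
  \<comment> \<open>The three terms bound the value of the minimiser, the linear term in
    \<open>v\<close> and, through \<open>q_lower\<close>, the negative part of the integral of
    \<open>q\<close>, all independently of \<open>k\<close>.\<close>
  define B where "B = e * \<mu>T + norm v * r + 2 * dl * norm w * \<mu>T"
  have dB: "(LINT t|M. ?d k t) \<le> B / real (Suc k)" for k
  proof -
    have "v \<bullet> (x k - xbar) \<le> norm v * norm (x k - xbar)" by (rule norm_cauchy_schwarz)
    also have "\<dots> \<le> norm v * r" using x[of k] by (intro mult_left_mono) (auto simp: dist_norm norm_minus_commute)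
    finally have 1: "v \<bullet> (x k - xbar) \<le> norm v * r" .
    have "(LINT t|M. - (2 * dl * norm w)) \<le> (LINT t|M. q (snd (f k t)))"
      by (intro integral_mono q_integrable Yi q_lower) simp
    then have 2: "- (2 * dl * norm w * \<mu>T) \<le> (LINT t|M. q (snd (f k t)))" by (simp add: ac_simps)
    have "e / real (Suc k) * \<mu>T \<le> e / 1 * \<mu>T" using e by (intro mult_right_mono divide_left_mono) auto
    moreover have "0 \<le> e * norm (x k - xbar)" using e by simp
    ultimately have "real (Suc k) * (LINT t|M. ?d k t) \<le> B" using main[of k] 1 2 by (simp add: B_def)
    then show ?thesis by (simp add: le_divide_eq mult.commute)
  qed
  obtain xs s1 where s1: "xs \<in> cball xbar r" "strict_mono s1" "(x \<circ> s1) \<longlonglongrightarrow> xs"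
    using compact_cball[of xbar r, unfolded compact_def] x by blast
  have Bl: "(\<lambda>k. B / real (Suc k)) \<longlonglongrightarrow> 0" using LIMSEQ_Suc[OF lim_const_over_n[of B]] by simp
  have "(\<lambda>k. LINT t|M. ?d k t) \<longlonglongrightarrow> 0"
    by (rule tendsto_sandwich[OF _ _ tendsto_const Bl]) (use d0 dB in auto)
  from LIMSEQ_subseq_LIMSEQ[OF this s1(2)]
  have "(\<lambda>k. LINT t|M. norm (?d (s1 k) t)) \<longlonglongrightarrow> 0" by (simp add: o_def)
  from tendsto_L1_AE_subseq[OF di this] obtain s2 where s2: "strict_mono s2" "AE t in M. (\<lambda>k. ?d (s1 (s2 k)) t) \<longlonglongrightarrow> 0"
    by blast
  define s where "s = s1 \<circ> s2"
  have s: "strict_mono s" using s1 s2 by (simp add: s_def strict_mono_o)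
  have xl: "(\<lambda>k. x (s k)) \<longlonglongrightarrow> xs" using LIMSEQ_subseq_LIMSEQ[OF s1(3) s2(1)] by (simp add: o_def s_def)
  have Xl: "AE t in M. (\<lambda>k. fst (f (s k) t)) \<longlonglongrightarrow> xs"
    using s2(2)
  proof eventually_elim
    case (elim t)
    have "(\<lambda>k. sqrt (?d (s k) t)) \<longlonglongrightarrow> sqrt 0" using elim by (intro tendsto_real_sqrt) (simp add: s_def)
    then have "(\<lambda>k. norm (fst (f (s k) t) - x (s k))) \<longlonglongrightarrow> 0" by (simp add: norm_eq_sqrt_inner)
    then have "(\<lambda>k. (fst (f (s k) t) - x (s k)) + x (s k)) \<longlonglongrightarrow> 0 + xs"
      by (intro tendsto_add xl) (simp add: tendsto_norm_zero_iff)
    then show ?case by simp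
  qed
  have fK: "AE t in M. (fst (f k t), snd (f k t)) \<in> K (\<rho>/8) t" for k
  proof (rule AE_I2)
    fix t assume "t \<in> space M"
    then have "f k t \<in> K r t" using xf[of k] by (simp add: minimiser_def)
    then show "(fst (f k t), snd (f k t)) \<in> K (\<rho>/8) t" using K_mono[of r "\<rho>/8" t] r by auto
  qed
  have "\<exists>s' Z. strict_mono s' \<and> integrable M Z \<and> (AE t in M. (xs, Z t) \<in> K (\<rho>/8) t) \<and>
     (\<lambda>k. LINT t|M. q (snd (f (s (s' k)) t))) \<longlonglongrightarrow> (LINT t|M. q (Z t)) \<and>
     (\<lambda>k. LINT t|M. norm (snd (f (s (s' k)) t))) \<longlonglongrightarrow> (LINT t|M. norm (Z t))"
    by (rule selection_limit_q[where X="\<lambda>k t. fst (f (s k) t)" and Y="\<lambda>k t. snd (f (s k) t)"])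
       (use Yi fK Xl in auto)
  then obtain s' Z where s': "strict_mono s'" "integrable M Z" "AE t in M. (xs, Z t) \<in> K (\<rho>/8) t"
     "(\<lambda>k. LINT t|M. q (snd (f (s (s' k)) t))) \<longlonglongrightarrow> (LINT t|M. q (Z t))"
     "(\<lambda>k. LINT t|M. norm (snd (f (s (s' k)) t))) \<longlonglongrightarrow> (LINT t|M. norm (Z t))" by blast
  let ?S = "\<lambda>k. s (s' k)"
  have S: "strict_mono ?S" using strict_mono_o[OF s s'(1)] by (simp add: o_def)
  have xS: "(\<lambda>k. x (?S k)) \<longlonglongrightarrow> xs" using LIMSEQ_subseq_LIMSEQ[OF xl s'(1)] by (simp add: o_def)
  have "- (v \<bullet> (xs - xbar)) + e * norm (xs - xbar) + (LINT t|M. q (Z t)) \<le> 0"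
  proof (rule LIMSEQ_le)
    show "(\<lambda>k. - (v \<bullet> (x (?S k) - xbar)) + e * norm (x (?S k) - xbar) + (LINT t|M. q (snd (f (?S k) t)))) \<longlonglongrightarrow>
      - (v \<bullet> (xs - xbar)) + e * norm (xs - xbar) + (LINT t|M. q (Z t))"
      by (intro tendsto_intros xS s')
    have "(\<lambda>k. (e * \<mu>T) / real (Suc k)) \<longlonglongrightarrow> 0" using LIMSEQ_Suc[OF lim_const_over_n[of "e * \<mu>T"]] by simp
    from LIMSEQ_subseq_LIMSEQ[OF this S] show "(\<lambda>k. e / real (Suc (?S k)) * \<mu>T) \<longlonglongrightarrow> 0" by (simp add: o_def)
    have nn: "0 \<le> real (Suc k) * (LINT t|M. ?d k t)" for k using d0 by simp
    have "- (v \<bullet> (x k - xbar)) + e * norm (x k - xbar) + (LINT t|M. q (snd (f k t))) \<le> e / real (Suc k) * \<mu>T" for k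
      using main[of k] nn[of k] by linarith
    then show "\<exists>N. \<forall>n\<ge>N. - (v \<bullet> (x (?S n) - xbar)) + e * norm (x (?S n) - xbar) + (LINT t|M. q (snd (f (?S n) t)))
        \<le> e / real (Suc (?S n)) * \<mu>T" by blast
  qed
  with loc[OF s1(1) s'(2,3)] have "e/2 * (norm (xs - xbar) + (LINT t|M. norm (Z t))) \<le> 0" by linarith
  then have "norm (xs - xbar) + (LINT t|M. norm (Z t)) \<le> 0" using e by (simp add: mult_le_0_iff)
  moreover have "0 \<le> (LINT t|M. norm (Z t))" by (intro integral_nonneg_AE) auto
  ultimately have "norm (xs - xbar) = 0" "(LINT t|M. norm (Z t)) = 0"
    using norm_ge_zero[of "xs - xbar"] by linarith+
  then have z: "xs = xbar" "(LINT t|M. norm (Z t)) = 0" by simp_all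
  have "\<forall>\<^sub>F k in sequentially. dist (x (?S k)) xbar < h \<and> (LINT t|M. norm (snd (f (?S k) t))) < h \<and> N \<le> k"
    using h z xS by (intro eventually_conj tendstoD order_tendstoD(2)[OF s'(5)] eventually_ge_at_top) auto
  then obtain k where k: "dist (x (?S k)) xbar < h" "(LINT t|M. norm (snd (f (?S k) t))) < h" "N \<le> k"
    by (auto simp: eventually_sequentially)
  moreover have "N \<le> ?S k" using k(3) seq_suble[OF S, of k] by simp
  ultimately show ?thesis using xf by (intro exI[of _ "?S k"]) (auto simp: dist_norm)
qed

section \<open>First-order conditions at the minimisers\<close>

definition grad :: "real \<Rightarrow> 'b \<Rightarrow> 'b" where
  "grad k y = e *\<^sub>R (y /\<^sub>R smooth_norm (1/k) y) + (2 * norm w) *\<^sub>R (y /\<^sub>R smooth_norm dl y)"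

lemma grad_bound:
  assumes k: "k > 0"
  shows "norm (grad k y) \<le> e + 2 * norm w" "norm (grad k y) \<le> e + 2 * norm w * (norm y / dl)"
proof -
  have k1: "1 / k > 0" using k by simp
  have "norm (grad k y) \<le> e * norm (y /\<^sub>R smooth_norm (1/k) y) + (2 * norm w) * norm (y /\<^sub>R smooth_norm dl y)"
    unfolding grad_def using e by (intro order_trans[OF norm_triangle_ineq]) (simp only: norm_scaleR, simp)
  moreover have "e * norm (y /\<^sub>R smooth_norm (1/k) y) \<le> e * 1"
    using e smooth_norm_gradient_bound(1)[OF k1, of y] by (intro mult_left_mono) auto
  moreover have "(2 * norm w) * norm (y /\<^sub>R smooth_norm dl y) \<le> (2 * norm w) * 1"
    using smooth_norm_gradient_bound(1)[OF dl_bounds(1), of y] by (intro mult_left_mono) auto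
  moreover have "(2 * norm w) * norm (y /\<^sub>R smooth_norm dl y) \<le> (2 * norm w) * (norm y / dl)"
    using smooth_norm_gradient_bound(2)[OF dl_bounds(1), of y] by (intro mult_left_mono) auto
  ultimately show "norm (grad k y) \<le> e + 2 * norm w" "norm (grad k y) \<le> e + 2 * norm w * (norm y / dl)"
    by linarith+
qed

lemma grad_continuous:
  assumes k: "k > 0"
  shows "continuous_on UNIV (grad k)"
proof -
  have "smooth_norm a y \<noteq> 0" if "a > 0" for a and y :: 'b using smooth_norm_ge'[of a y] that by linarith
  from this[of "1/k"] this[of dl] show ?thesis unfolding grad_def[abs_def] using k dl_bounds
    by (intro continuous_intros) auto
qed

text \<open>The shift by \<open>c\<close>, later \<open>ysbar t\<close>, returns from deviations to
  the original graph of the subdifferential.\<close>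

lemma cost_derivative:
  assumes k: "k > 0"
  shows "((\<lambda>z. cost k x (fst z, snd z - c)) has_derivative
     (\<lambda>d. ((2 * k) *\<^sub>R (X - x), w + grad k Y) \<bullet> d)) (at (X, Y + c))"
proof -
  have k1: "1 / k > 0" using k by simp
  have s: "((\<lambda>z. smooth_norm a (snd z - c)) has_derivative (\<lambda>d. (Y /\<^sub>R smooth_norm a Y) \<bullet> snd d)) (at (X, Y + c))"
    if "a > 0" for a
  proof -
    have "((\<lambda>z. snd z - c) has_derivative (\<lambda>d. snd d)) (at (X, Y + c))"
      by (auto intro!: derivative_eq_intros)
    from has_derivative_compose[OF this, of "smooth_norm a"] smooth_norm_derivative[OF that, of Y]
    show ?thesis by simp
  qed
  have "((\<lambda>z. w \<bullet> (snd z - c) + e * smooth_norm (1/k) (snd z - c) + 2 * norm w * (smooth_norm dl (snd z - c) - dl)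
     + k * ((fst z - x) \<bullet> (fst z - x))) has_derivative
     (\<lambda>d. w \<bullet> snd d + e * ((Y /\<^sub>R smooth_norm (1/k) Y) \<bullet> snd d) + 2 * norm w * ((Y /\<^sub>R smooth_norm dl Y) \<bullet> snd d)
     + k * (2 * ((X - x) \<bullet> fst d)))) (at (X, Y + c))"
    by (auto intro!: derivative_eq_intros s[OF k1] s[OF dl_bounds(1)] simp: inner_commute)
  then show ?thesis unfolding cost_def fst_conv snd_conv
    by (rule has_derivative_eq_rhs) (simp add: fun_eq_iff grad_def inner_prod_def inner_add_left algebra_simps)
qed

text \<open>Pointwise optimality gives the regular normals, with \<open>ws\<close> equal to
  \<open>w\<close> plus the gradient of the penalty. Optimality in \<open>x\<close> gives the mean
  of \<open>vs\<close> up to \<open>e\<close>, the slope of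
  \<open>e * norm (x - xbar)\<close>.\<close>

lemma approximate_normals:
  "\<exists>X Y vs ws. X \<in> borel_measurable M \<and> integrable M Y \<and> integrable M vs \<and> ws \<in> borel_measurable M \<and>
    (\<forall>t\<in>space M. norm (X t - xbar) \<le> e \<and> norm (ws t) \<le> 3 * norm w + e) \<and>
    (LINT t|M. norm (Y t)) \<le> e \<and> (LINT t|M. norm (ws t - w)) \<le> e * (\<mu>T + 1) \<and> norm (integral\<^sup>L M vs - v) \<le> e \<and>
    (\<forall>t\<in>G. Y t + ysbar t \<in> subdiff (\<phi> t) (X t) \<and>
       (vs t, - ws t) \<in> regular_normal_cone (X t, Y t + ysbar t) (gph (subdiff (\<phi> t))))"
proof -
  obtain r where r: "0 < r" "r \<le> \<rho>/8" "r \<le> e"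
    and loc: "\<And>x Y. x \<in> cball xbar r \<Longrightarrow> integrable M Y \<Longrightarrow> (AE t in M. (x, Y t) \<in> K (\<rho>/8) t) \<Longrightarrow>
       e/2 * (norm (x - xbar) + (LINT t|M. norm (Y t))) \<le> - (v \<bullet> (x - xbar)) + e * norm (x - xbar) + (LINT t|M. q (Y t))"
    using local_estimate by blast
  have r': "0 \<le> r" "r < \<rho>/4" using r radius_bounds by auto
  \<comment> \<open>The first entry keeps \<open>x\<close> well inside the ball, the second bounds
    the L1 norm of \<open>Y\<close>, and the third makes the \<open>dl\<close> part of the gradient
    at most \<open>e\<close> in mean.\<close>
  define h where "h = min (min (r/4) e) (e * dl / (2 * norm w + 1))"
  have w1: "2 * norm w + 1 > 0" using norm_ge_zero[of w] by linarith
  have h: "h > 0" "h \<le> r/4" "h \<le> e" "2 * norm w * (h / dl) \<le> e"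
  proof -
    show "h > 0" using r e dl_bounds w1 by (auto simp: h_def)
    show "h \<le> r/4" "h \<le> e" unfolding h_def by linarith+
    have "h / dl \<le> e / (2 * norm w + 1)" using dl_bounds w1 by (simp add: h_def divide_le_eq min_le_iff_disj)
    then have "2 * norm w * (h / dl) \<le> 2 * norm w * (e / (2 * norm w + 1))" by (intro mult_left_mono) auto
    also have "\<dots> \<le> (2 * norm w + 1) * (e / (2 * norm w + 1))" using e w1 by (intro mult_right_mono) auto
    also have "\<dots> = e" using w1 by simp
    finally show "2 * norm w * (h / dl) \<le> e" .
  qed
  \<comment> \<open>For such \<open>k\<close> the quadratic penalty outweighs the lowest value of
    \<open>q\<close> and the smoothing error \<open>e / k\<close> already at distance
    \<open>r/4\<close>.\<close>
  obtain N :: nat where N: "(2 * dl * norm w + e) / (r/4)^2 < real N" using reals_Archimedean2 by blast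
  obtain k' x f where k': "k' \<ge> N" and mf: "minimiser r (real (Suc k')) x f" and xh: "norm (x - xbar) < h"
     and Yh: "(LINT t|M. norm (snd (f t))) < h"
    using minimisers_converge[OF r(1,2) loc h(1)] by blast
  define k where "k = real (Suc k')"
  have k: "k > 0" "k \<ge> 1" by (simp_all add: k_def)
  have kN: "2 * dl * norm w + e \<le> k * (r/4)^2"
  proof -
    have "2 * dl * norm w + e < real N * (r/4)^2" using N r by (simp add: divide_less_eq)
    also have "\<dots> \<le> k * (r/4)^2" using k' by (intro mult_right_mono) (auto simp: k_def)
    finally show ?thesis by simp
  qed
  define X where "X t = fst (f t)" for t
  define Y where "Y t = snd (f t)" for t
  have fXY: "f t = (X t, Y t)" for t by (simp add: X_def Y_def)
  have mf': "minimiser r k x f" using mf by (simp add: k_def)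
  note est = minimiser_estimates[OF k(1) r(1,2) mf']
  have x: "x \<in> cball xbar r" and fm: "f \<in> borel_measurable M" and fK: "\<And>t. t \<in> space M \<Longrightarrow> f t \<in> K r t"
    and fmin: "\<And>t z. t \<in> space M \<Longrightarrow> z \<in> K r t \<Longrightarrow> cost k x (f t) \<le> cost k x z"
    and J: "\<And>x'. x' \<in> cball xbar r \<Longrightarrow> J k f x \<le> J k f x'"
    using mf' by (auto simp: minimiser_def)
  have Xm: "X \<in> borel_measurable M"
    using measurable_compose[OF fm borel_measurable_continuous_onI[OF continuous_on_fst[OF continuous_on_id]]]
    by (simp add: X_def[abs_def])
  have Yi: "integrable M Y" using est(1) by (simp add: Y_def[abs_def])
  \<comment> \<open>Comparison with the admissible point \<open>(xbar, 0)\<close> gives this for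
    every \<open>t\<close>, not just in mean: \<open>X t\<close> must be interior, because the
    minimisation sees the graph only over the ball of radius \<open>r\<close>.\<close>
  have Xx: "norm (X t - xbar) < 3/4 * r" if t: "t \<in> space M" for t
  proof -
    have "q (Y t) + k * ((X t - x) \<bullet> (X t - x)) \<le> e / k + k * ((xbar - x) \<bullet> (xbar - x))"
      using fmin[OF t K_center[OF r'(1)]] cost_ge[of "f t" k x] cost_center[OF k(1), of x] by (simp add: X_def Y_def)
    moreover have "e / k \<le> e" using e k by (simp add: divide_le_eq mult_le_cancel_left1)
    moreover have "k * ((xbar - x) \<bullet> (xbar - x)) \<le> k * (r/4)^2"
    proof -
      have "(norm (xbar - x))^2 \<le> (r/4)^2" using xh h(2) by (intro power_mono) (auto simp: norm_minus_commute)
      then show ?thesis using k by (intro mult_left_mono) (auto simp: power2_norm_eq_inner)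
    qed
    ultimately have "k * ((X t - x) \<bullet> (X t - x)) \<le> k * (2 * (r/4)^2)"
      using q_lower[of "Y t"] kN by linarith
    then have "(norm (X t - x))^2 \<le> 2 * (r/4)^2" using k(1) by (simp add: power2_norm_eq_inner)
    also have "\<dots> = r^2 / 8" by (simp add: power_divide)
    also have "\<dots> < r^2 / 4" using zero_less_power[OF r(1), of 2] by linarith
    also have "\<dots> = (r/2)^2" by (simp add: power_divide)
    finally have "norm (X t - x) < r / 2" by (rule power2_less_imp_less) (use r in simp)
    then show ?thesis using norm_triangle_ineq[of "X t - x" "x - xbar"] xh h(2) by simp
  qed
  define ws where "ws t = w + grad k (Y t)" for t
  define vs where "vs t = (2 * k) *\<^sub>R (x - X t)" for t
  have wsm: "ws \<in> borel_measurable M"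
    unfolding ws_def[abs_def]
    using measurable_compose[OF borel_measurable_integrable[OF Yi] borel_measurable_continuous_onI[OF grad_continuous[OF k(1)]]]
    by measurable
  have wsb: "norm (ws t) \<le> 3 * norm w + e" for t
    using norm_triangle_ineq[of w "grad k (Y t)"] grad_bound(1)[OF k(1), of "Y t"] by (simp add: ws_def)
  have Xi: "integrable M X"
  proof (rule integrable_const_bound[OF _ Xm])
    show "AE t in M. norm (X t) \<le> norm xbar + 3/4 * r"
    proof (rule AE_I2)
      fix t assume "t \<in> space M"
      then show "norm (X t) \<le> norm xbar + 3/4 * r" using Xx[of t] norm_triangle_ineq2[of "X t" xbar] by linarith
    qed
  qed
  have vsi: "integrable M vs" unfolding vs_def[abs_def] using Xi by auto
  have wsL: "(LINT t|M. norm (ws t - w)) \<le> e * (\<mu>T + 1)"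
  proof -
    have "(LINT t|M. norm (ws t - w)) \<le> (LINT t|M. e + 2 * norm w / dl * norm (Y t))"
    proof (intro integral_mono Bochner_Integration.integrable_add integrable_mult_right integrable_norm Yi)
      show "integrable M (\<lambda>t. ws t - w)"
      proof (rule integrable_const_bound)
        show "AE t in M. norm (ws t - w) \<le> e + 2 * norm w" using grad_bound(1)[OF k(1)] by (simp add: ws_def)
        show "(\<lambda>t. ws t - w) \<in> borel_measurable M" using wsm by measurable
      qed
      show "norm (ws t - w) \<le> e + 2 * norm w / dl * norm (Y t)" for t
        using grad_bound(2)[OF k(1), of "Y t"] by (simp add: ws_def)
    qed simp
    also have "\<dots> = e * \<mu>T + 2 * norm w / dl * (LINT t|M. norm (Y t))"
      using Yi by (simp add: mult.commute)
    also have "2 * norm w / dl * (LINT t|M. norm (Y t)) \<le> 2 * norm w / dl * h"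
      using Yh dl_bounds by (intro mult_left_mono) (auto simp: Y_def)
    also have "\<dots> \<le> e" using h(4) by simp
    finally show ?thesis by (simp add: distrib_left)
  qed
  have vsL: "norm (integral\<^sup>L M vs - v) \<le> e"
  proof -
    define D where "D = integral\<^sup>L M vs - v"
    have ineq: "0 \<le> D \<bullet> d + e * norm d + k * \<mu>T * (d \<bullet> d)" if d: "x + d \<in> cball xbar r" for d
    proof -
      have c: "cost k (x + d) (f t) = cost k x (f t) + vs t \<bullet> d + k * (d \<bullet> d)" for t
        by (simp add: cost_def vs_def X_def algebra_simps inner_diff_left inner_diff_right inner_add_left inner_add_right inner_commute)
      have ci: "integrable M (\<lambda>t. cost k x (f t))" by (rule cost_integrable[OF k(1) r'(1) r(2) x fm fK])
      have "(LINT t|M. cost k (x + d) (f t)) = (LINT t|M. cost k x (f t)) + integral\<^sup>L M vs \<bullet> d + k * \<mu>T * (d \<bullet> d)"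
        unfolding c using ci vsi by simp
      then have "J k f (x + d) - J k f x = D \<bullet> d + e * norm (x + d - xbar) - e * norm (x - xbar) + k * \<mu>T * (d \<bullet> d)"
        by (simp add: J_def D_def algebra_simps inner_diff_left inner_diff_right inner_add_left inner_add_right inner_commute)
      moreover have "e * norm (x + d - xbar) \<le> e * norm (x - xbar) + e * norm d"
      proof -
        have "norm (x + d - xbar) \<le> norm (x - xbar) + norm d"
          using norm_triangle_ineq[of "x - xbar" d] by (simp add: algebra_simps)
        then have "e * norm (x + d - xbar) \<le> e * (norm (x - xbar) + norm d)" using e by (intro mult_left_mono) auto
        then show ?thesis by (simp add: distrib_left)
      qed
      ultimately show ?thesis using J[OF d] by linarith
    qed
    show ?thesis
    proof (rule ccontr)
      assume "\<not> ?thesis"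
      then have big: "norm D > e" by (simp add: D_def)
      then have Dp: "norm D > 0" using e by linarith
      have xr: "norm (x - xbar) < r / 4" using xh h(2) by linarith
      \<comment> \<open>The test direction is \<open>- s *\<^sub>R D\<close>, short enough to stay
        in the ball. After division by \<open>s\<close> the quadratic term vanishes in the limit,
        contradicting \<open>norm D > e\<close>.\<close>
      have "(norm D)^2 \<le> e * norm D + k * \<mu>T * (norm D)^2 * s" if s: "0 < s" "s \<le> r / (4 * norm D)" for s
      proof -
        have "norm (s *\<^sub>R D) \<le> r / 4"
        proof -
          have "s * norm D \<le> r / (4 * norm D) * norm D" using s Dp by (intro mult_right_mono) auto
          also have "\<dots> = r / 4" using Dp by simp
          finally show ?thesis using s by simp
        qed
        then have "x + (- s *\<^sub>R D) \<in> cball xbar r"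
          using xr norm_triangle_ineq4[of "x - xbar" "s *\<^sub>R D"] r(1)
          by (simp add: dist_norm norm_minus_commute algebra_simps)
        from ineq[OF this] have "0 \<le> s * (e * norm D + k * \<mu>T * (norm D)^2 * s - (norm D)^2)"
          using s by (simp add: power2_norm_eq_inner algebra_simps)
        then show ?thesis using s by (simp add: zero_le_mult_iff)
      qed
      then have ev: "\<forall>\<^sub>F s in at_right 0. (norm D)^2 \<le> e * norm D + k * \<mu>T * (norm D)^2 * s"
        using r(1) Dp unfolding eventually_at_right_field
        by (intro exI[of _ "r / (4 * norm D)"]) auto
      have "((\<lambda>s. e * norm D + k * \<mu>T * (norm D)^2 * s) \<longlongrightarrow> e * norm D + k * \<mu>T * (norm D)^2 * 0) (at_right 0)"
        by (intro tendsto_intros)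
      from tendsto_lowerbound[OF this ev] have "(norm D)^2 \<le> e * norm D" by simp
      then show False using big Dp by (simp add: power2_eq_square)
    qed
  qed
  have "Y t + ysbar t \<in> subdiff (\<phi> t) (X t)" if "t \<in> G" for t
    using fK[OF G_space[OF that]] K_iff[OF that] by (simp add: fXY)
  moreover have "(vs t, - ws t) \<in> regular_normal_cone (X t, Y t + ysbar t) (gph (subdiff (\<phi> t)))" if t: "t \<in> G" for t
  proof -
    have "- ((2 * k) *\<^sub>R (X t - x), w + grad k (Y t)) \<in> regular_normal_cone (X t, Y t + ysbar t) (gph (subdiff (\<phi> t)))"
    proof (rule minimum_regular_normal[OF _ cost_derivative[OF k(1), of x "ysbar t" "X t" "Y t"]])
      show "(X t, Y t + ysbar t) \<in> gph (subdiff (\<phi> t))"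
        using fK[OF G_space[OF t]] K_iff[OF t] by (simp add: fXY gph_def)
      \<comment> \<open>With \<open>Xx\<close> this radius keeps all competitors within distance
        \<open>r\<close> of \<open>xbar\<close>, so local minimality over the whole graph follows
        from that over \<open>K r t\<close>.\<close>
      show "0 < r / 4" using r by simp
      fix u assume u: "u \<in> gph (subdiff (\<phi> t))" "norm (u - (X t, Y t + ysbar t)) < r / 4"
      have "norm (fst u - X t) \<le> norm (u - (X t, Y t + ysbar t))"
        using norm_fst_le[of "fst u - X t" "snd u - (Y t + ysbar t)"] by (cases u) simp
      then have "norm (fst u - xbar) \<le> r"
        using norm_triangle_ineq[of "fst u - X t" "X t - xbar"] Xx[OF G_space[OF t]] u(2) by simp
      then have "(fst u, snd u - ysbar t) \<in> K r t"
        using u(1) by (auto simp: K_iff[OF t] gph_def dist_norm norm_minus_commute split_beta)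
      from fmin[OF G_space[OF t] this]
      show "cost k x (fst (X t, Y t + ysbar t), snd (X t, Y t + ysbar t) - ysbar t) \<le> cost k x (fst u, snd u - ysbar t)"
        by (simp add: fXY)
    qed
    moreover have "- ((2 * k) *\<^sub>R (X t - x), w + grad k (Y t)) = (vs t, - ws t)"
      by (simp add: vs_def ws_def scaleR_diff_right)
    ultimately show ?thesis by simp
  qed
  moreover have "norm (X t - xbar) \<le> e" if "t \<in> space M" for t using Xx[OF that] r by simp
  moreover have "(LINT t|M. norm (Y t)) \<le> e" using Yh h(3) by (simp add: Y_def)
  ultimately show ?thesis using Xm Yi vsi wsm wsb wsL vsL
    by (intro exI[of _ X] exI[of _ Y] exI[of _ vs] exI[of _ ws]) auto
qed

end

section \<open>The inclusion\<close>

theorem theorem7p4: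
  fixes M :: "'t measure"
    and \<phi> :: "'t \<Rightarrow> real ^ 'n \<Rightarrow> ereal"
    and xbar ybar :: "real ^ 'n"
    and ysbar :: "'t \<Rightarrow> real ^ 'n"
    and \<rho> :: real
    and \<kappa> :: "'t \<Rightarrow> real"
    and Tpa Tna :: "'t set"
  assumes "finite_measure M" and "complete_measure M"
    and "atomic_decomposition M Tpa Tna"
    and "proper_normal_integrand M \<phi>"
    and "xbar \<in> edom (expected_functional M \<phi>)"
    and "ybar \<in> subdiff (expected_functional M \<phi>) xbar"
    and "ysbar \<in> subgradient_selections M \<phi> xbar ybar"
    and "\<rho> > 0"
    and "integrable M \<kappa>" and "AE t in M. 0 < \<kappa> t"
    and a: "\<And>x. x \<in> cball xbar \<rho> \<Longrightarrow>
          subdiff (expected_functional M \<phi>) x = aumann_integral M (\<lambda>t. subdiff (\<phi> t) x)"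
    and b: "\<And>t x. t \<in> Tna \<Longrightarrow> x \<in> cball xbar \<rho> \<Longrightarrow> lower_regular_at (\<phi> t) x"
    and c: "AE t in M. \<forall>x\<in>cball xbar \<rho>. subdiff (\<phi> t) x \<subseteq> cball 0 (\<kappa> t)"
    and "second_order_quasi_Lipschitz M \<phi> xbar ysbar"
  shows "\<forall>w :: real ^ 'n.
           combined_second_subdiff (expected_functional M \<phi>) xbar ybar w
             \<subseteq> aumann_integral M (\<lambda>t. basic_second_subdiff (\<phi> t) xbar (ysbar t) w)"
proof (intro allI subsetI)
  fix w v :: "real ^ 'n"
  assume v: "v \<in> combined_second_subdiff (expected_functional M \<phi>) xbar ybar w"
  interpret finite_measure M by fact
  let ?E = "expected_functional M \<phi>"
  have ys: "integrable M ysbar" "integral\<^sup>L M ysbar = ybar" "AE t in M. ysbar t \<in> subdiff (\<phi> t) xbar"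
    using assms(7) by (auto simp: subgradient_selections_def)
  \<comment> \<open>The two conditions are joined so that one null set can be removed for both; its
    complement is \<open>G\<close>.\<close>
  have "AE t in M. ysbar t \<in> subdiff (\<phi> t) xbar \<and> (\<forall>x\<in>cball xbar \<rho>. subdiff (\<phi> t) x \<subseteq> cball 0 (\<kappa> t))"
    using ys(3) c by eventually_elim simp
  from AE_E3[OF this] obtain Z where Z: "\<And>t. t \<in> space M - Z \<Longrightarrow> ysbar t \<in> subdiff (\<phi> t) xbar \<and>
      (\<forall>x\<in>cball xbar \<rho>. subdiff (\<phi> t) x \<subseteq> cball 0 (\<kappa> t))" "Z \<in> null_sets M" by blast
  define G where "G = space M - Z"
  have AEG: "AE t in M. t \<in> G"
    using AE_not_in[OF Z(2)] AE_space by eventually_elim (simp add: G_def)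
  interpret integrand_selection M \<phi> xbar ysbar \<rho> \<kappa> G Tpa Tna
  proof
    show "G \<in> sets M" using Z(2) by (auto simp: G_def)
    show "ysbar t \<in> subdiff (\<phi> t) xbar" if "t \<in> G" for t using Z(1) that by (simp add: G_def)
    show "subdiff (\<phi> t) x \<subseteq> cball 0 (\<kappa> t)" if "t \<in> G" "x \<in> cball xbar \<rho>" for t x
      using Z(1)[of t] that unfolding G_def by blast
  qed (fact assms ys AEG)+
  have nrm: "(v, - w) \<in> regular_normal_cone (xbar, ybar) (gph (subdiff ?E))"
    using v by (simp add: combined_second_subdiff_def regular_coderivative_def)
  define P where "P e X Y vs ws \<longleftrightarrow> X \<in> borel_measurable M \<and> integrable M Y \<and> integrable M vs \<and> ws \<in> borel_measurable M \<and>
    (\<forall>t\<in>space M. norm (X t - xbar) \<le> e \<and> norm (ws t) \<le> 3 * norm w + e) \<and>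
    (LINT t|M. norm (Y t)) \<le> e \<and> (LINT t|M. norm (ws t - w)) \<le> e * (measure M (space M) + 1) \<and> norm (integral\<^sup>L M vs - v) \<le> e \<and>
    (\<forall>t\<in>G. Y t + ysbar t \<in> subdiff (\<phi> t) (X t) \<and>
       (vs t, - ws t) \<in> regular_normal_cone (X t, Y t + ysbar t) (gph (subdiff (\<phi> t))))"
    for e :: real and X Y vs ws
  have "\<exists>X Y vs ws. P e X Y vs ws" if e: "e > 0" for e
  proof -
    obtain d where d: "d > 0" "\<And>z. z \<in> gph (subdiff ?E) \<Longrightarrow> norm (z - (xbar, ybar)) < d \<Longrightarrow>
        (v, - w) \<bullet> (z - (xbar, ybar)) \<le> e/4 * norm (z - (xbar, ybar))"
      using nrm e unfolding regular_normal_cone_iff by (metis zero_less_divide_iff zero_less_numeral)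
    \<comment> \<open>By \<open>a\<close>, the integral of \<open>Y + ysbar\<close> is a subgradient
      of the integral functional at \<open>x\<close>, so the pair lies on the graph tested by the
      normal. Each component gets half of \<open>d\<close>, as the product norm is at most the
      sum.\<close>
    have "normal_approximation M \<phi> xbar ysbar \<rho> \<kappa> G Tpa Tna v w e (d/2)"
    proof
      fix x Y
      assume x: "norm (x - xbar) < d/2" "x \<in> cball xbar (\<rho>/8)" and Y: "integrable M Y"
        "AE t in M. (x, Y t) \<in> K (\<rho>/8) t" "norm (integral\<^sup>L M Y) < d/2"
      have "AE t in M. Y t + ysbar t \<in> subdiff (\<phi> t) x"
        using Y(2) AEG by eventually_elim (simp add: K_iff)
      moreover have "integrable M (\<lambda>t. Y t + ysbar t)" "(LINT t|M. Y t + ysbar t) = integral\<^sup>L M Y + ybar"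
        using Y(1) ys by auto
      ultimately have "integral\<^sup>L M Y + ybar \<in> aumann_integral M (\<lambda>t. subdiff (\<phi> t) x)"
        unfolding aumann_integral_def mem_Collect_eq by (intro exI[of _ "\<lambda>t. Y t + ysbar t"]) simp
      moreover have "x \<in> cball xbar \<rho>" using x(2) assms(8) by auto
      ultimately have gr: "(x, integral\<^sup>L M Y + ybar) \<in> gph (subdiff ?E)" using a by (simp add: gph_def)
      have n: "norm ((x, integral\<^sup>L M Y + ybar) - (xbar, ybar)) \<le> norm (x - xbar) + norm (integral\<^sup>L M Y)"
        using norm_Pair_le[of "x - xbar" "integral\<^sup>L M Y"] by simp
      from d(2)[OF gr] n x(1) Y(3)
      have "(v, - w) \<bullet> ((x, integral\<^sup>L M Y + ybar) - (xbar, ybar)) \<le> e/4 * norm ((x, integral\<^sup>L M Y + ybar) - (xbar, ybar))"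
        by linarith
      also have "\<dots> \<le> e/4 * (norm (x - xbar) + norm (integral\<^sup>L M Y))" using n e by (intro mult_left_mono) auto
      finally show "v \<bullet> (x - xbar) - w \<bullet> integral\<^sup>L M Y \<le> e/4 * (norm (x - xbar) + norm (integral\<^sup>L M Y))"
        by (simp add: inner_prod_def)
    qed (use d e in auto)
    from normal_approximation.approximate_normals[OF this] show ?thesis unfolding P_def .
  qed
  then have "\<exists>X Y vs ws. P (1 / real (Suc j)) X Y vs ws" for j by simp
  then obtain X Y vs ws where XYP: "\<And>j. P (1 / real (Suc j)) (X j) (Y j) (vs j) (ws j)" by metis
  have meas: "X j \<in> borel_measurable M" "integrable M (Y j)" "integrable M (vs j)" "ws j \<in> borel_measurable M"
    and Xb: "\<And>t. t \<in> space M \<Longrightarrow> norm (X j t - xbar) \<le> 1 / real (Suc j)"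
    and wsb: "\<And>t. t \<in> space M \<Longrightarrow> norm (ws j t) \<le> 3 * norm w + 1 / real (Suc j)"
    and Yb: "(LINT t|M. norm (Y j t)) \<le> 1 / real (Suc j)"
    and wsL: "(LINT t|M. norm (ws j t - w)) \<le> 1 / real (Suc j) * (measure M (space M) + 1)"
    and vsL: "norm (integral\<^sup>L M (vs j) - v) \<le> 1 / real (Suc j)"
    and sub: "\<And>t. t \<in> G \<Longrightarrow> Y j t + ysbar t \<in> subdiff (\<phi> t) (X j t)"
    and reg: "\<And>t. t \<in> G \<Longrightarrow> (vs j t, - ws j t) \<in> regular_normal_cone (X j t, Y j t + ysbar t) (gph (subdiff (\<phi> t)))"
    for j using XYP[of j] unfolding P_def by blast+
  have j1: "1 / real (Suc j) \<le> 1" for j by simp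
  have jl: "(\<lambda>j. 1 / real (Suc j)) \<longlonglongrightarrow> 0" using LIMSEQ_Suc[OF lim_const_over_n[of 1]] by simp
  have wsb': "norm (ws j t) \<le> 3 * norm w + 1" if "t \<in> space M" for j t using wsb[OF that, of j] j1[of j] by linarith
  have wsi: "integrable M (\<lambda>t. ws j t - w)" for j
  proof (rule integrable_const_bound)
    show "AE t in M. norm (ws j t - w) \<le> 3 * norm w + 1 + norm w"
    proof (rule AE_I2)
      fix t assume "t \<in> space M"
      then show "norm (ws j t - w) \<le> 3 * norm w + 1 + norm w"
        using wsb'[of t j] norm_triangle_ineq4[of "ws j t" w] by linarith
    qed
    show "(\<lambda>t. ws j t - w) \<in> borel_measurable M" using meas(4)[of j] by measurable
  qed

  \<comment> \<open>Summing the two deviations yields a single subsequence along which both vanish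
    almost everywhere.\<close>
  let ?D = "\<lambda>j t. norm (Y j t) + norm (ws j t - w)"
  have Di: "integrable M (?D j)" for j using meas(2) wsi by (intro Bochner_Integration.integrable_add integrable_norm)
  have "(\<lambda>j. LINT t|M. norm (?D j t)) \<longlonglongrightarrow> 0"
  proof (rule tendsto_sandwich[OF _ _ tendsto_const])
    have "(\<lambda>j. 1 / real (Suc j) + 1 / real (Suc j) * (measure M (space M) + 1)) \<longlonglongrightarrow> 0 + 0 * (measure M (space M) + 1)"
      by (intro tendsto_intros jl)
    then show "(\<lambda>j. 1 / real (Suc j) + 1 / real (Suc j) * (measure M (space M) + 1)) \<longlonglongrightarrow> 0" by simp
    have "(LINT t|M. norm (?D j t)) = (LINT t|M. norm (Y j t)) + (LINT t|M. norm (ws j t - w))" for j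
      using Bochner_Integration.integral_add[OF integrable_norm[OF meas(2)] integrable_norm[OF wsi], of j j] by simp
    then show "\<forall>\<^sub>F j in sequentially. (LINT t|M. norm (?D j t)) \<le> 1 / real (Suc j) + 1 / real (Suc j) * (measure M (space M) + 1)"
      using add_mono[OF Yb wsL] by (simp only: eventually_sequentially) blast
  qed (auto intro!: always_eventually)
  from tendsto_L1_AE_subseq[OF Di this] obtain s where s: "strict_mono s" "AE t in M. (\<lambda>j. ?D (s j) t) \<longlonglongrightarrow> 0" by blast

  obtain \<eta> l where eta: "\<eta> > 0" and l: "integrable M l" "AE t in M. 0 < l t"
    and ql: "\<And>xs ys ws. xs \<in> Linf M \<Longrightarrow> Linf_norm M (\<lambda>t. xs t - xbar) \<le> ennreal \<eta> \<Longrightarrow>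
           integrable M ys \<Longrightarrow> L1_norm M (\<lambda>t. ys t - ysbar t) \<le> \<eta> \<Longrightarrow>
           (AE t in M. ys t \<in> subdiff (\<phi> t) (xs t)) \<Longrightarrow> ws \<in> Linf M \<Longrightarrow>
           (AE t in M. (SUP v\<in>basic_second_subdiff (\<phi> t) (xs t) (ys t) (ws t). ereal (norm v)) \<le> ereal (l t * norm (ws t)))"
    using assms(14) unfolding second_order_quasi_Lipschitz_def by blast
  obtain j0 :: nat where j0: "1 / real (Suc j0) < \<eta>" using eta nat_approx_posE by blast
  have Linf_bound: "Linf_norm M f \<le> ennreal b" if "f \<in> borel_measurable M" "\<And>t. t \<in> space M \<Longrightarrow> norm (f t) \<le> b" for f :: "'t \<Rightarrow> real ^ 'n" and b
    unfolding Linf_norm_def using that by (intro esssup_I) (auto intro!: AE_I2 ennreal_leI)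
  \<comment> \<open>Regular normals are limiting normals, so \<open>vs j t\<close> lies in the set
    bounded by the quasi-Lipschitzian property. The uniform bound on \<open>ws\<close> yields a
    dominating function independent of \<open>j\<close>.\<close>
  have vsb: "AE t in M. norm (vs j t) \<le> l t * (3 * norm w + 1)" if j: "j \<ge> j0" for j
  proof -
    have je: "1 / real (Suc j) \<le> \<eta>"
    proof -
      have "1 / real (Suc j) \<le> 1 / real (Suc j0)" using j by (intro divide_left_mono) auto
      then show ?thesis using j0 by linarith
    qed
    have "norm (X j t) \<le> norm xbar + 1" if "t \<in> space M" for t
      using Xb[OF that, of j] j1[of j] norm_triangle_ineq2[of "X j t" xbar] by linarith
    from Linf_bound[OF meas(1) this] have "X j \<in> Linf M"
      using meas(1) by (auto simp: Linf_def intro: le_less_trans)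
    moreover have "Linf_norm M (\<lambda>t. X j t - xbar) \<le> ennreal \<eta>"
    proof (rule Linf_bound)
      show "(\<lambda>t. X j t - xbar) \<in> borel_measurable M" using meas(1)[of j] by measurable
      show "norm (X j t - xbar) \<le> \<eta>" if "t \<in> space M" for t using Xb[OF that, of j] je by linarith
    qed
    moreover have "integrable M (\<lambda>t. Y j t + ysbar t)" using meas(2) ys(1) by simp
    moreover have "L1_norm M (\<lambda>t. Y j t + ysbar t - ysbar t) \<le> \<eta>"
      using Yb[of j] je by (simp add: L1_norm_def)
    moreover have "AE t in M. Y j t + ysbar t \<in> subdiff (\<phi> t) (X j t)"
      using AEG by eventually_elim (rule sub)
    moreover have "ws j \<in> Linf M"
      using meas(4) Linf_bound[OF meas(4) wsb', of j] by (auto simp: Linf_def intro: le_less_trans)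
    ultimately have "AE t in M. (SUP v\<in>basic_second_subdiff (\<phi> t) (X j t) (Y j t + ysbar t) (ws j t). ereal (norm v))
        \<le> ereal (l t * norm (ws j t))"
      by (rule ql)
    then show ?thesis using AEG AE_space l(2)
    proof eventually_elim
      case (elim t)
      have "(vs j t, - ws j t) \<in> limiting_normal_cone (X j t, Y j t + ysbar t) (gph (subdiff (\<phi> t)))"
        using reg[OF elim(2)] regular_subset_limiting_normal_cone by blast
      then have "vs j t \<in> basic_second_subdiff (\<phi> t) (X j t) (Y j t + ysbar t) (ws j t)"
        by (simp add: basic_second_subdiff_def coderivative_def)
      then have "ereal (norm (vs j t)) \<le> ereal (l t * norm (ws j t))"
        using elim(1) by (meson SUP_upper order_trans)
      moreover have "l t * norm (ws j t) \<le> l t * (3 * norm w + 1)"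
        using wsb'[OF elim(3)] elim(4) by (intro mult_left_mono) auto
      ultimately show ?case by simp
    qed
  qed

  \<comment> \<open>The shift by \<open>j0\<close> makes the domination hold for every member of the
    subsequence.\<close>
  define r where "r j = s (j + j0)" for j
  have r: "strict_mono r" using s(1) by (auto simp: r_def strict_mono_def)
  have rj: "j0 \<le> r j" for j using seq_suble[OF s(1), of "j + j0"] by (simp add: r_def)
  have "(\<lambda>j. integral\<^sup>L M (vs j)) \<longlonglongrightarrow> v"
  proof (rule LIM_zero_cancel, rule Lim_null_comparison[OF _ jl])
    show "\<forall>\<^sub>F j in sequentially. norm (integral\<^sup>L M (vs j) - v) \<le> 1 / real (Suc j)"
      using vsL by (intro always_eventually allI)
  qed
  from LIMSEQ_subseq_LIMSEQ[OF this r] have lim: "(\<lambda>j. integral\<^sup>L M (vs (r j))) \<longlonglongrightarrow> v" by (simp add: o_def)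
  have "v \<in> aumann_integral M (\<lambda>t. cluster_points (\<lambda>j. vs (r j) t))"
    by (rule Fatou_multivalued[OF assms(1,3) borel_measurable_integrable[OF meas(3)] vsb[OF rj] _ lim])
       (use l(1) in simp)
  then obtain V where V: "integrable M V" "AE t in M. V t \<in> cluster_points (\<lambda>j. vs (r j) t)" "v = integral\<^sup>L M V"
    by (auto simp: aumann_integral_def)
  have "AE t in M. V t \<in> basic_second_subdiff (\<phi> t) xbar (ysbar t) w"
    using V(2) s(2) AEG
  proof eventually_elim
    case (elim t)
    then obtain p where p: "strict_mono p" "(\<lambda>j. vs (r (p j)) t) \<longlonglongrightarrow> V t" by (auto simp: cluster_points_def)
    let ?m = "\<lambda>j. r (p j)"
    have m: "strict_mono ?m" using strict_mono_o[OF r p(1)] by (simp add: o_def)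
    have "strict_mono (\<lambda>j. p j + j0)" using p(1) by (simp add: strict_mono_def)
    from LIMSEQ_subseq_LIMSEQ[OF elim(2) this] have D0: "(\<lambda>j. ?D (?m j) t) \<longlonglongrightarrow> 0" by (simp add: o_def r_def)
    have Y0: "(\<lambda>j. Y (?m j) t) \<longlonglongrightarrow> 0" by (rule Lim_null_comparison[OF _ D0]) (auto intro!: always_eventually)
    have W0: "(\<lambda>j. ws (?m j) t) \<longlonglongrightarrow> w"
      by (rule LIM_zero_cancel, rule Lim_null_comparison[OF _ D0]) (auto intro!: always_eventually)
    have X0: "(\<lambda>j. X (?m j) t) \<longlonglongrightarrow> xbar"
    proof (rule LIM_zero_cancel, rule Lim_null_comparison)
      show "\<forall>\<^sub>F j in sequentially. norm (X (?m j) t - xbar) \<le> 1 / real (Suc (?m j))"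
        using Xb[OF G_space[OF elim(3)]] by (intro always_eventually allI)
      show "(\<lambda>j. 1 / real (Suc (?m j))) \<longlonglongrightarrow> 0" using LIMSEQ_subseq_LIMSEQ[OF jl m] by (simp add: o_def)
    qed
    \<comment> \<open>The subsequence realising the cluster point depends on \<open>t\<close>; since
      base points and directions \<open>ws\<close> converge along all of \<open>s\<close>, they also
      converge along it.\<close>
    have "(V t, - w) \<in> limiting_normal_cone (xbar, 0 + ysbar t) (gph (subdiff (\<phi> t)))"
    proof (rule limiting_normal_cone_closed)
      show "(\<lambda>j. (X (?m j) t, Y (?m j) t + ysbar t)) \<longlonglongrightarrow> (xbar, 0 + ysbar t)"
        by (intro tendsto_intros X0 Y0)
      show "(\<lambda>j. (vs (?m j) t, - ws (?m j) t)) \<longlonglongrightarrow> (V t, - w)" by (intro tendsto_intros p W0)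
      show "(vs (?m j) t, - ws (?m j) t) \<in> limiting_normal_cone (X (?m j) t, Y (?m j) t + ysbar t) (gph (subdiff (\<phi> t)))" for j
        using reg[OF elim(3)] regular_subset_limiting_normal_cone by blast
    qed
    then show ?case by (simp add: basic_second_subdiff_def coderivative_def)
  qed
  then show "v \<in> aumann_integral M (\<lambda>t. basic_second_subdiff (\<phi> t) xbar (ysbar t) w)"
    using V by (auto simp: aumann_integral_def)
qed

end
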